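(* Let $m\ge 2$ and $1\le n\le m$ be integers. Let $\rho$ be a density operator on $\mathcal{H}_A\otimes\mathcal{H}_{B_1}\otimes\cdots\otimes\mathcal{H}_{B_n}$ (finite-dimensional, $\dim\mathcal{H}_A=d$). Let $M_1,\dots,M_m$ be observables on $\mathcal{H}_A$ with orthonormal eigenbases $\{|\psi^i_k\rangle\}_{k=1}^d$. Let $\mathbf{S}_1,\dots,\mathbf{S}_n$ be nonempty, pairwise disjoint subsets of $\{M_1,\dots,M_m\}$ whose union is $\{M_1,\dots,M_m\}$, and $m_t=|\mathbf{S}_t|$. Then $$\sum_{t=1}^n\sum_{M_i\in\mathbf{S}_t}S(M_i|B_t)\geqslant-\frac{1}{m-1}\log_2\Big(\prod_{1\le i<j\le m}c_{ij}\Big)+\frac{1}{m-1}\sum_{t=1}^n\frac{m_t(m_t-1)}{2}S(A|B_t)+\max\{0,\delta_{mn}\},$$ where $$\delta_{mn}=\frac{m(m-1)-\sum_{t=1}^n m_t(m_t-1)}{2(m-1)}S(A)+\sum_{t=1}^n\frac{m_t(m_t-1)}{2(m-1)}\mathcal{I}(A:B_t)-\sum_{t=1}^n\sum_{M_i\in\mathbf{S}_t}\mathcal{I}(M_i:B_t).$$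
   Context: All logarithms are base 2. $S(\sigma)=-\mathrm{Tr}\,\sigma\log_2\sigma$; $\rho^X$ is the reduced state of $\rho$ on subsystem(s) $X$, and $S(A)=S(\rho^A)$. $c_{ij}=\max_{k,l}|\langle\psi^i_k|\psi^j_l\rangle|^2$. $S(A|B_t)=S(\rho^{AB_t})-S(\rho^{B_t})$. $\mathcal{I}(A:B_t)=S(\rho^A)+S(\rho^{B_t})-S(\rho^{AB_t})$ is the mutual information. Post-measurement state: $\rho^{M_iB_t}=\sum_k(|\psi^i_k\rangle\langle\psi^i_k|\otimes\mathbb{I})\rho^{AB_t}(|\psi^i_k\rangle\langle\psi^i_k|\otimes\mathbb{I})$, with reduced state $\rho^{M_i}$ on $A$. $S(M_i|B_t)=S(\rho^{M_iB_t})-S(\rho^{B_t})$, and the Holevo quantity is $\mathcal{I}(M_i:B_t)=S(\rho^{M_i})+S(\rho^{B_t})-S(\rho^{M_iB_t})$. *)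

theory Defs
  imports Complex_Main
begin

text \<open>Composite system with subsystems indexed by natural numbers (system 0 is A,
system t is B_t). Subsystem j has dimension D j. A computational basis vector of the
subsystems in S is an index function x with x j < D j for j in S and x j = 0 outside S.\<close>

definition cfg :: "(nat \<Rightarrow> nat) \<Rightarrow> nat set \<Rightarrow> (nat \<Rightarrow> nat) set" where
  "cfg D S = {x. (\<forall>j\<in>S. x j < D j) \<and> (\<forall>j. j \<notin> S \<longrightarrow> x j = 0)}"

type_synonym op = "(nat \<Rightarrow> nat) \<Rightarrow> (nat \<Rightarrow> nat) \<Rightarrow> complex"

definition ptrace :: "(nat \<Rightarrow> nat) \<Rightarrow> nat set \<Rightarrow> nat set \<Rightarrow> op \<Rightarrow> op" where
  "ptrace D T S X = (\<lambda>x y. \<Sum>z\<in>cfg D (T - S). X (\<lambda>j. x j + z j) (\<lambda>j. y j + z j))"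

definition density :: "(nat \<Rightarrow> nat) \<Rightarrow> nat set \<Rightarrow> op \<Rightarrow> bool" where
  "density D S X \<longleftrightarrow>
     (\<forall>x\<in>cfg D S. \<forall>y\<in>cfg D S. X y x = cnj (X x y)) \<and>
     (\<forall>u. (\<Sum>x\<in>cfg D S. \<Sum>y\<in>cfg D S. cnj (u x) * X x y * u y) \<in> \<real> \<and>
          0 \<le> Re (\<Sum>x\<in>cfg D S. \<Sum>y\<in>cfg D S. cnj (u x) * X x y * u y)) \<and>
     (\<Sum>x\<in>cfg D S. X x x) = 1"

definition spectral_decomp :: "'a set \<Rightarrow> ('a \<Rightarrow> 'a \<Rightarrow> complex) \<Rightarrow> (nat \<Rightarrow> real) \<Rightarrow> bool" where
  "spectral_decomp I X lam \<longleftrightarrow>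
     (\<exists>v :: nat \<Rightarrow> 'a \<Rightarrow> complex.
        (\<forall>k<card I. \<forall>l<card I. (\<Sum>x\<in>I. cnj (v k x) * v l x) = (if k = l then 1 else 0)) \<and>
        (\<forall>x\<in>I. \<forall>y\<in>I. X x y = (\<Sum>k<card I. complex_of_real (lam k) * v k x * cnj (v k y))))"

text \<open>Von Neumann entropy S(sigma) = - Tr sigma log2 sigma = - sum of lambda log2 lambda
over the eigenvalues (0 log 0 = 0, as log 2 0 = 0 in Isabelle).\<close>
definition vn_entropy :: "'a set \<Rightarrow> ('a \<Rightarrow> 'a \<Rightarrow> complex) \<Rightarrow> real" where
  "vn_entropy I X =
     (let lam = (SOME lam. spectral_decomp I X lam) in - (\<Sum>k<card I. lam k * log 2 (lam k)))"

text \<open>Post-measurement state on the subsystems {0,t}: sum_k (P_k (x) I) X (P_k (x) I)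
with P_k = |psi_k><psi_k| acting on subsystem 0 (dimension d).\<close>
definition postmeas :: "nat \<Rightarrow> (nat \<Rightarrow> nat \<Rightarrow> complex) \<Rightarrow> op \<Rightarrow> op" where
  "postmeas d psi X = (\<lambda>x y. \<Sum>k<d. \<Sum>a<d. \<Sum>b<d.
      psi k (x 0) * cnj (psi k a) * X (x(0 := a)) (y(0 := b)) * psi k b * cnj (psi k (y 0)))"

definition inner_vec :: "nat \<Rightarrow> (nat \<Rightarrow> complex) \<Rightarrow> (nat \<Rightarrow> complex) \<Rightarrow> complex" where
  "inner_vec d u v = (\<Sum>a<d. cnj (u a) * v a)"

definition overlap :: "nat \<Rightarrow> (nat \<Rightarrow> nat \<Rightarrow> complex) \<Rightarrow> (nat \<Rightarrow> nat \<Rightarrow> complex) \<Rightarrow> real" where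
  "overlap d psi phi = Max {(cmod (inner_vec d (psi k) (phi l)))\<^sup>2 | k l. k < d \<and> l < d}"

end

theory Submission
  imports Defs "HOL-Computational_Algebra.Fundamental_Theorem_Algebra"
begin

text \<open>Every pair of observables satisfies an entropic uncertainty relation, and averaging these over all
  pairs gives both bounds under the maximum. For two observables \<open>X\<close>, \<open>Z\<close> with the same memory \<open>B\<close>,
  \<open>S(ZB) - S(AB)\<close> is the relative entropy of \<open>\<rho>\<close> and its \<open>Z\<close>-pinching; measuring \<open>X\<close> does not increase it, and
  the pinched state is then at most \<open>c\<close> times the identity on \<open>A\<close> tensored with \<open>\<rho>\<^sup>B\<close>, so
  \<open>S(X|B) + S(Z|B) \<ge> - log c + S(A|B)\<close>. For two different memories \<open>B\<close>, \<open>C\<close> one purifies: \<open>S(Z|CR)\<close> equals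
  \<open>S(ZB) - S(AB)\<close>, and discarding \<open>R\<close> only increases the conditional entropy. The bound with \<open>\<delta>\<close> is the first
  relation with trivial memory. Monotonicity of relative entropy rests on a variational formula: for each
  \<open>s > 0\<close>, the supremum over \<open>Y\<close> of \<open>2 Re Tr (Y\<^sup>* \<rho>) - Tr (Y Y\<^sup>* \<sigma>) - s Tr (Y\<^sup>* Y \<rho>)\<close> is monotone under these
  operations, and it is the derivative in \<open>s\<close> of a function whose increment between \<open>0\<close> and infinity is, up to a
  divergent term that depends on the trace only, the relative entropy.\<close>

section \<open>Hermitian matrices on finite index sets\<close>

text \<open>The obstacle is monotonicity of relative entropy, which usually calls for logarithms of
  operators and their concavity. In the variational formula both states enter linearly, so a partial
  trace or a measurement can be moved onto the trial operator \<open>Y\<close>, and an operator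
  inequality for \<open>\<sigma>\<close> passes straight through; logarithms are taken only of
  eigenvalues. Two encodings keep the rest elementary. A measured state is a family of unnormalised
  conditional states of the memory, so its entropy is a plain sum. A purification is a Gram factor
  \<open>M\<close> of the state, and the common nonzero spectrum of the two Gram matrices of
  \<open>M\<close> replaces both the Schmidt decomposition and unitary invariance. The factor
  \<open>1 / (m - 1)\<close> arises because each observable lies in \<open>m - 1\<close> pairs. The
  quantity \<open>\<delta>\<close> is built so that adding it to the first bound cancels every
  S(A|B): what remains is the memoryless bound, the log overlaps plus m/2 times S(A), less the
  Holevo quantities, which convert each S(M) into S(M|B).\<close>

definition inner_on :: "'a set \<Rightarrow> ('a \<Rightarrow> complex) \<Rightarrow> ('a \<Rightarrow> complex) \<Rightarrow> complex" where
  "inner_on I u v = (\<Sum>x\<in>I. cnj (u x) * v x)"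

definition mat_app :: "'a set \<Rightarrow> ('b \<Rightarrow> 'a \<Rightarrow> complex) \<Rightarrow> ('a \<Rightarrow> complex) \<Rightarrow> 'b \<Rightarrow> complex" where
  "mat_app I X u = (\<lambda>x. \<Sum>y\<in>I. X x y * u y)"

definition hermitian_on :: "'a set \<Rightarrow> ('a \<Rightarrow> 'a \<Rightarrow> complex) \<Rightarrow> bool" where
  "hermitian_on I X \<longleftrightarrow> (\<forall>x\<in>I. \<forall>y\<in>I. X y x = cnj (X x y))"

text \<open>Completeness is part of the definition, not a consequence of counting: the label set
  \<open>J\<close> may have any type, and labels and coordinates play symmetric roles, as is
  convenient for overlap matrices of two bases.\<close>

definition onb :: "'j set \<Rightarrow> 'a set \<Rightarrow> ('j \<Rightarrow> 'a \<Rightarrow> complex) \<Rightarrow> bool" where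
  "onb J I v \<longleftrightarrow>
     (\<forall>k\<in>J. \<forall>l\<in>J. inner_on I (v k) (v l) = of_bool (k = l)) \<and>
     (\<forall>x\<in>I. \<forall>y\<in>I. (\<Sum>k\<in>J. v k x * cnj (v k y)) = of_bool (x = y))"

lemma inner_on_cong [cong]:
  "I = I' \<Longrightarrow> (\<And>x. x \<in> I' \<Longrightarrow> u x = u' x) \<Longrightarrow> (\<And>x. x \<in> I' \<Longrightarrow> v x = v' x) \<Longrightarrow>
   inner_on I u v = inner_on I' u' v'"
  by (simp add: inner_on_def)

lemma cnj_inner_on: "cnj (inner_on I u v) = inner_on I v u"
  by (simp add: inner_on_def mult.commute)

lemma inner_on_self: "inner_on I u u = complex_of_real (\<Sum>x\<in>I. (cmod (u x))\<^sup>2)"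
  by (simp add: inner_on_def complex_norm_square mult.commute del: of_real_power)

lemma inner_on_sum_right:
  "inner_on I u (\<lambda>x. \<Sum>k\<in>K. c k * f k x) = (\<Sum>k\<in>K. c k * inner_on I u (f k))"
  by (simp add: inner_on_def sum_distrib_left mult.left_commute) (rule sum.swap)

lemma inner_on_diff_right:
  "inner_on I u (\<lambda>x. f x - g x) = inner_on I u f - inner_on I u g"
  by (simp add: inner_on_def algebra_simps sum_subtractf)

lemma inner_on_scale_right: "inner_on I u (\<lambda>x. c * f x) = c * inner_on I u f"
  by (simp add: inner_on_def sum_distrib_left mult.left_commute)

lemma inner_on_scale_left: "inner_on I (\<lambda>x. c * f x) u = cnj c * inner_on I f u"
  by (simp add: inner_on_def sum_distrib_left mult.assoc)

lemma inner_on_hermitian: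
  assumes "hermitian_on I X"
  shows "inner_on I u (mat_app I X v) = inner_on I (mat_app I X u) v"
proof -
  have "inner_on I u (mat_app I X v) = (\<Sum>x\<in>I. \<Sum>y\<in>I. cnj (u x) * X x y * v y)"
    by (simp add: inner_on_def mat_app_def sum_distrib_left mult.assoc)
  also have "\<dots> = (\<Sum>y\<in>I. \<Sum>x\<in>I. cnj (u x) * X x y * v y)"
    by (rule sum.swap)
  also have "\<dots> = (\<Sum>y\<in>I. \<Sum>x\<in>I. cnj (X y x * u x) * v y)"
  proof (intro sum.cong refl)
    fix x y assume "x \<in> I" "y \<in> I"
    then have "X x y = cnj (X y x)" using assms unfolding hermitian_on_def by blast
    then show "cnj (u x) * X x y * v y = cnj (X y x * u x) * v y"
      by (simp only: complex_cnj_mult mult_ac)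
  qed
  also have "\<dots> = inner_on I (mat_app I X u) v"
    by (simp add: inner_on_def mat_app_def sum_distrib_right)
  finally show ?thesis .
qed

section \<open>Linear dependence and eigenvectors\<close>

lemma underdetermined_system:
  fixes A :: "nat \<Rightarrow> 'a \<Rightarrow> complex"
  assumes "finite I" "n < card I"
  shows "\<exists>u. (\<exists>x\<in>I. u x \<noteq> 0) \<and> (\<forall>j<n. (\<Sum>x\<in>I. A j x * u x) = 0)"
  using assms
proof (induction n arbitrary: I A)
  case 0
  then obtain x where "x \<in> I" by fastforce
  then show ?case by (intro exI[of _ "\<lambda>_. 1"]) auto
next
  case (Suc n)
  show ?case
  proof (cases "\<forall>x\<in>I. A n x = 0")
    case True
    obtain u where u: "\<exists>x\<in>I. u x \<noteq> 0" "\<forall>j<n. (\<Sum>x\<in>I. A j x * u x) = 0"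
      using Suc.IH[of I A] Suc.prems by auto
    show ?thesis
      using u True by (intro exI[of _ u]) (auto simp: less_Suc_eq)
  next
    case False
    then obtain y where y: "y \<in> I" "A n y \<noteq> 0" by auto
    define I' where "I' = I - {y}"
    have fI': "finite I'" "n < card I'" using Suc.prems y by (auto simp: I'_def)
    \<comment> \<open>Equation \<open>n\<close> is solved for the unknown \<open>y\<close>;
      \<open>B\<close> holds the coefficients of the other equations after substitution, and
      \<open>c\<close> below is the value of the eliminated unknown.\<close>
    define B where "B = (\<lambda>j x. A j x - A j y * A n x / A n y)"
    obtain u where u: "\<exists>x\<in>I'. u x \<noteq> 0" "\<forall>j<n. (\<Sum>x\<in>I'. B j x * u x) = 0"
      using Suc.IH[OF fI', of B] by auto
    define c where "c = - (\<Sum>x\<in>I'. A n x * u x) / A n y"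
    define w where "w = u(y := c)"
    have split: "(\<Sum>x\<in>I. A j x * w x) = A j y * c + (\<Sum>x\<in>I'. A j x * u x)" for j
    proof -
      have "(\<Sum>x\<in>I. A j x * w x) = A j y * w y + (\<Sum>x\<in>I'. A j x * w x)"
        using Suc.prems y by (simp add: I'_def sum.remove)
      also have "(\<Sum>x\<in>I'. A j x * w x) = (\<Sum>x\<in>I'. A j x * u x)"
        by (intro sum.cong) (auto simp: w_def I'_def)
      finally show ?thesis by (simp add: w_def)
    qed
    have "(\<Sum>x\<in>I. A j x * w x) = 0" if "j < Suc n" for j
    proof (cases "j = n")
      case True
      then show ?thesis using y by (simp add: split c_def)
    next
      case False
      then have "(\<Sum>x\<in>I'. B j x * u x) = 0" using that u by auto
      then have "(\<Sum>x\<in>I'. A j x * u x) = (\<Sum>x\<in>I'. (A j y / A n y) * (A n x * u x))"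
        by (simp add: B_def left_diff_distrib sum_subtractf mult.assoc)
      also have "\<dots> = A j y / A n y * (\<Sum>x\<in>I'. A n x * u x)"
        by (rule sum_distrib_left[symmetric])
      finally show ?thesis by (simp add: split c_def)
    qed
    moreover have "\<exists>x\<in>I. w x \<noteq> 0"
      using u(1) by (auto simp: w_def I'_def)
    ultimately show ?thesis by blast
  qed
qed

lemma linear_dependence:
  fixes f :: "nat \<Rightarrow> 'a \<Rightarrow> complex"
  assumes "finite I"
  shows "\<exists>c. (\<exists>j\<le>card I. c j \<noteq> 0) \<and> (\<forall>x\<in>I. (\<Sum>j\<le>card I. c j * f j x) = 0)"
proof -
  obtain h where h: "bij_betw h {..<card I} I"
    using ex_bij_betw_nat_finite[OF assms] by (auto simp: lessThan_atLeast0)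
  obtain c where c: "\<exists>j\<in>{..card I}. c j \<noteq> 0"
      "\<forall>i<card I. (\<Sum>j\<in>{..card I}. f j (h i) * c j) = 0"
    using underdetermined_system[of "{..card I}" "card I" "\<lambda>i j. f j (h i)"] by auto
  have "(\<Sum>j\<le>card I. c j * f j x) = 0" if "x \<in> I" for x
  proof -
    have "x \<in> h ` {..<card I}" using h that by (simp add: bij_betw_def)
    then obtain i where "i < card I" "x = h i" by blast
    then show ?thesis using c(2) by (simp add: mult.commute)
  qed
  then show ?thesis using c(1) by auto
qed

definition poly_app :: "'a set \<Rightarrow> ('a \<Rightarrow> 'a \<Rightarrow> complex) \<Rightarrow> ('a \<Rightarrow> complex) \<Rightarrow> complex poly \<Rightarrow> 'a \<Rightarrow> complex" where
  "poly_app I X u p = (\<lambda>x. \<Sum>j\<le>degree p. coeff p j * (mat_app I X ^^ j) u x)"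

lemma poly_app_bound:
  assumes "degree p \<le> n"
  shows "poly_app I X u p x = (\<Sum>j\<le>n. coeff p j * (mat_app I X ^^ j) u x)"
  unfolding poly_app_def
  by (rule sum.mono_neutral_left) (use assms in \<open>auto simp: coeff_eq_0\<close>)

lemma mat_app_sum: "mat_app I X (\<lambda>x. \<Sum>k\<in>K. c k * f k x) = (\<lambda>x. \<Sum>k\<in>K. c k * mat_app I X (f k) x)"
  by (rule ext) (simp add: mat_app_def sum_distrib_left mult.left_commute, rule sum.swap)

text \<open>The factor \<open>[:- a, 1:]\<close> acts as X - a. When the product annihilates
  \<open>u\<close>, the cofactor therefore yields an eigenvector for \<open>a\<close>, unless it
  yields zero.\<close>

lemma poly_app_linear_factor:
  "poly_app I X u ([:- a, 1:] * q) x = mat_app I X (poly_app I X u q) x - a * poly_app I X u q x"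
proof -
  let ?n = "degree q"
  have d: "degree ([:- a, 1:] * q) \<le> Suc ?n"
    using degree_mult_le[of "[:-a,1:]" q] by simp
  have cf: "coeff ([:- a, 1:] * q) j = (case j of 0 \<Rightarrow> 0 | Suc i \<Rightarrow> coeff q i) - a * coeff q j" for j
    by (simp add: coeff_pCons split: nat.split)
  have "poly_app I X u ([:- a, 1:] * q) x
     = (\<Sum>j\<le>Suc ?n. (case j of 0 \<Rightarrow> 0 | Suc i \<Rightarrow> coeff q i) * (mat_app I X ^^ j) u x)
       - (\<Sum>j\<le>Suc ?n. a * (coeff q j * (mat_app I X ^^ j) u x))"
    unfolding poly_app_bound[OF d] cf by (simp only: left_diff_distrib sum_subtractf mult.assoc)
  also have "(\<Sum>j\<le>Suc ?n. (case j of 0 \<Rightarrow> 0 | Suc i \<Rightarrow> coeff q i) * (mat_app I X ^^ j) u x)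
     = (\<Sum>i\<le>?n. coeff q i * (mat_app I X ^^ Suc i) u x)"
    by (simp add: sum.atMost_Suc_shift del: sum.atMost_Suc)
  also have "\<dots> = mat_app I X (poly_app I X u q) x"
    unfolding poly_app_def by (simp add: mat_app_sum)
  also have "(\<Sum>j\<le>Suc ?n. a * (coeff q j * (mat_app I X ^^ j) u x)) = a * poly_app I X u q x"
    by (simp add: poly_app_def coeff_eq_0 sum_distrib_left)
  finally show ?thesis .
qed

text \<open>A vanishing combination of least degree of the iterates of a vector factors off an
  eigenvector, which lies in the span of the iterates and so in every invariant subspace
  containing the vector.\<close>

lemma krylov_eigenvector:
  assumes "finite I" "\<exists>x\<in>I. u x \<noteq> 0"
  shows "\<exists>p a. (\<exists>x\<in>I. poly_app I X u p x \<noteq> 0) \<and>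
     (\<forall>x\<in>I. mat_app I X (poly_app I X u p) x = a * poly_app I X u p x)"
proof -
  define P where "P = (\<lambda>p. p \<noteq> 0 \<and> (\<forall>x\<in>I. poly_app I X u p x = 0))"
  obtain c where c: "\<exists>j\<le>card I. c j \<noteq> 0"
      "\<forall>x\<in>I. (\<Sum>j\<le>card I. c j * (mat_app I X ^^ j) u x) = 0"
    using linear_dependence[OF assms(1), of "\<lambda>j. (mat_app I X ^^ j) u"] by blast
  define p0 where "p0 = (\<Sum>j\<le>card I. monom (c j) j)"
  have cf: "coeff p0 j = (if j \<le> card I then c j else 0)" for j
    by (simp add: p0_def coeff_sum)
  have "degree p0 \<le> card I" by (rule degree_le) (simp add: cf)
  then have "P p0"
    using c by (auto simp: P_def poly_app_bound cf poly_eq_iff)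
  then obtain p where p: "P p" "\<And>q. P q \<Longrightarrow> degree p \<le> degree q"
    using arg_min_nat_lemma[of P p0 degree] by blast
  \<comment> \<open>A nonzero constant would annihilate \<open>u\<close> itself, so \<open>p\<close>
    has a root. The cofactor \<open>q\<close> then has smaller degree and, by minimality, does not
    annihilate \<open>u\<close>.\<close>
  have "degree p \<noteq> 0"
  proof
    assume d: "degree p = 0"
    then have "coeff p 0 \<noteq> 0" using p(1) by (auto simp: P_def poly_eq_iff) (metis coeff_eq_0 neq0_conv)
    then show False using p(1) assms(2) d by (auto simp: P_def poly_app_def)
  qed
  then obtain a where "poly p a = 0"
    using fundamental_theorem_of_algebra[of p] by (auto simp: constant_degree)
  then obtain q where q: "p = [:- a, 1:] * q"
    by (auto simp: poly_eq_0_iff_dvd)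
  have "q \<noteq> 0" using p(1) q by (auto simp: P_def)
  then have "degree p = Suc (degree q)" unfolding q by (subst degree_mult_eq) auto
  then have "\<not> P q" using p(2)[of q] by auto
  then have "\<exists>x\<in>I. poly_app I X u q x \<noteq> 0" using \<open>q \<noteq> 0\<close> by (auto simp: P_def)
  moreover have "\<forall>x\<in>I. mat_app I X (poly_app I X u q) x = a * poly_app I X u q x"
    using p(1) poly_app_linear_factor[of I X u a q] unfolding P_def q by (metis eq_iff_diff_eq_0)
  ultimately show ?thesis by blast
qed

text \<open>The orthogonal complement of an eigenvector is invariant under a Hermitian matrix, so it
  contains all iterates of each of its vectors. This keeps a newly found eigenvector orthogonal to
  the earlier ones.\<close>

lemma inner_on_poly_app_eq_0:
  assumes "hermitian_on I X" "\<forall>x\<in>I. mat_app I X v x = a * v x" "inner_on I v u = 0"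
  shows "inner_on I v (poly_app I X u p) = 0"
proof -
  have "inner_on I v ((mat_app I X ^^ j) u) = 0" for j
  proof (induction j)
    case (Suc j)
    have "inner_on I v ((mat_app I X ^^ Suc j) u) = inner_on I (\<lambda>x. a * v x) ((mat_app I X ^^ j) u)"
      using assms(2) by (simp add: inner_on_hermitian[OF assms(1)])
    then show ?case using Suc by (simp add: inner_on_scale_left)
  qed (use assms in auto)
  then show ?thesis by (simp add: poly_app_def inner_on_sum_right)
qed

lemma inner_on_eq_0_iff:
  assumes "finite I"
  shows "inner_on I u u = 0 \<longleftrightarrow> (\<forall>x\<in>I. u x = 0)"
  unfolding inner_on_self of_real_eq_0_iff using assms by (simp add: sum_nonneg_eq_0_iff)

lemma orthonormal_eigenvectors:
  assumes "finite I" "hermitian_on I X" "n \<le> card I"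
  shows "\<exists>v a. (\<forall>k<n. \<forall>l<n. inner_on I (v k) (v l) = of_bool (k = l)) \<and>
     (\<forall>k<n. \<forall>x\<in>I. mat_app I X (v k) x = a k * v k x)"
  using assms(3)
proof (induction n)
  case (Suc n)
  then obtain v a where v: "\<forall>k<n. \<forall>l<n. inner_on I (v k) (v l) = of_bool (k = l)"
    "\<forall>k<n. \<forall>x\<in>I. mat_app I X (v k) x = a k * v k x" by auto
  obtain u where u: "\<exists>x\<in>I. u x \<noteq> 0" "\<forall>j<n. inner_on I (v j) u = 0"
    using underdetermined_system[of I n "\<lambda>j x. cnj (v j x)"] Suc.prems assms(1)
    by (auto simp: inner_on_def)
  obtain p b where pb: "\<exists>x\<in>I. poly_app I X u p x \<noteq> 0"
     "\<forall>x\<in>I. mat_app I X (poly_app I X u p) x = b * poly_app I X u p x"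
    using krylov_eigenvector[OF assms(1) u(1)] by blast
  define f where "f = poly_app I X u p"
  define N where "N = (\<Sum>x\<in>I. (cmod (f x))\<^sup>2)"
  have "N \<ge> 0" by (simp add: N_def sum_nonneg)
  moreover have "N \<noteq> 0"
    using pb(1) assms(1) by (auto simp: N_def f_def sum_nonneg_eq_0_iff)
  ultimately have N: "N > 0" by simp
  define r where "r = complex_of_real (1 / sqrt N)"
  have rr: "cnj r * r * inner_on I f f = 1"
    unfolding inner_on_self N_def[symmetric] r_def complex_cnj_complex_of_real of_real_mult[symmetric]
    using N by (simp add: power2_eq_square[symmetric] power_divide del: of_real_mult)
  have orth: "inner_on I (v j) f = 0" if "j < n" for j
    unfolding f_def using inner_on_poly_app_eq_0[OF assms(2)] u(2) v(2) that by blast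
  then have orth': "inner_on I f (v j) = 0" if "j < n" for j
    using that by (metis cnj_inner_on complex_cnj_zero)
  have ap: "mat_app I X (\<lambda>x. r * f x) x = r * mat_app I X f x" for x
    by (simp add: mat_app_def sum_distrib_left mult.left_commute)
  show ?case
    using v orth orth' rr pb(2)
    by (intro exI[of _ "v(n := \<lambda>x. r * f x)"] exI[of _ "a(n := b)"])
       (auto simp: less_Suc_eq inner_on_scale_left inner_on_scale_right ap f_def[symmetric] mult_ac)
qed auto

text \<open>Maximality: a nonzero vector orthogonal to all \<open>v k\<close> would give
  \<open>card I + 1\<close> independent vectors. Completeness follows by applying this to what
  remains of each unit vector after projection onto the \<open>v k\<close>.\<close>

lemma orthonormal_imp_onb:
  fixes v :: "nat \<Rightarrow> 'a \<Rightarrow> complex"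
  assumes "finite I" "\<forall>k<card I. \<forall>l<card I. inner_on I (v k) (v l) = of_bool (k = l)"
  shows "onb {..<card I} I v"
proof -
  let ?n = "card I"
  have zero: "\<forall>x\<in>I. f x = 0" if f: "\<forall>k<?n. inner_on I (v k) f = 0" for f
  proof (rule ccontr)
    assume ne: "\<not> (\<forall>x\<in>I. f x = 0)"
    define w where "w = v(?n := f)"
    obtain c where c: "\<exists>j\<le>?n. c j \<noteq> 0" "\<forall>x\<in>I. (\<Sum>j\<le>?n. c j * w j x) = 0"
      using linear_dependence[OF assms(1), of w] by blast
    have eq: "(\<Sum>j\<le>?n. c j * inner_on I (w k) (w j)) = 0" for k
      using c(2) unfolding inner_on_sum_right[symmetric] by (simp add: inner_on_def)
    have f': "\<forall>k<?n. inner_on I f (v k) = 0"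
      using f by (metis cnj_inner_on complex_cnj_zero)
    have "c k = 0" if "k < ?n" for k
    proof -
      have "(\<Sum>j<?n. c j * inner_on I (v k) (w j)) = (\<Sum>j<?n. if k = j then c j else 0)"
        using that assms(2) by (intro sum.cong) (auto simp: w_def)
      then have "(\<Sum>j\<le>?n. c j * inner_on I (w k) (w j)) = c k"
        using that f by (simp add: w_def lessThan_Suc_atMost[symmetric])
      then show ?thesis using eq by simp
    qed
    moreover from this have "c ?n = 0"
      using eq[of ?n] ne assms(1) f' by (simp add: w_def lessThan_Suc_atMost[symmetric] inner_on_eq_0_iff)
    ultimately show False using c(1) by (metis le_neq_implies_less)
  qed
  have "(\<Sum>k<?n. v k x * cnj (v k y)) = of_bool (x = y)" if "x \<in> I" "y \<in> I" for x y
  proof -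
    define f where "f = (\<lambda>x. of_bool (x = y) - (\<Sum>k<?n. cnj (v k y) * v k x))"
    have "inner_on I (v l) f = 0" if "l < ?n" for l
    proof -
      have "inner_on I (v l) (\<lambda>x. of_bool (x = y)) = cnj (v l y)"
        using assms(1) \<open>y \<in> I\<close> by (simp add: inner_on_def of_bool_def if_distrib cong: if_cong)
      moreover have "(\<Sum>k<?n. cnj (v k y) * inner_on I (v l) (v k)) = (\<Sum>k<?n. if l = k then cnj (v k y) else 0)"
        using that assms(2) by (intro sum.cong) auto
      ultimately show ?thesis
        using that unfolding f_def by (simp add: inner_on_diff_right inner_on_sum_right)
    qed
    then show ?thesis using zero[of f] that by (auto simp: f_def mult.commute)
  qed
  then show ?thesis using assms(2) by (auto simp: onb_def)
qed

section \<open>Expansions in orthonormal bases and the spectral theorem\<close>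

lemma onb_expand:
  assumes "onb J I v" "finite I" "x \<in> I"
  shows "u x = (\<Sum>k\<in>J. inner_on I (v k) u * v k x)"
proof -
  have "(\<Sum>k\<in>J. inner_on I (v k) u * v k x) = (\<Sum>k\<in>J. \<Sum>y\<in>I. v k x * cnj (v k y) * u y)"
    by (simp add: inner_on_def sum_distrib_right sum_distrib_left mult_ac)
  also have "\<dots> = (\<Sum>y\<in>I. (\<Sum>k\<in>J. v k x * cnj (v k y)) * u y)"
    by (subst sum.swap) (simp add: sum_distrib_right)
  also have "\<dots> = (\<Sum>y\<in>I. if x = y then u y else 0)"
    using assms by (intro sum.cong) (auto simp: onb_def)
  also have "\<dots> = u x" using assms by simp
  finally show ?thesis ..
qed

lemma onb_parseval:
  assumes "onb J I v" "finite I"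
  shows "inner_on I u w = (\<Sum>k\<in>J. inner_on I (v k) w * inner_on I u (v k))"
proof -
  have "inner_on I u w = inner_on I u (\<lambda>x. \<Sum>k\<in>J. inner_on I (v k) w * v k x)"
    using onb_expand[OF assms, of _ w] by (intro inner_on_cong) auto
  then show ?thesis by (simp add: inner_on_sum_right)
qed

lemma onb_parseval_norm:
  assumes "onb J I v" "finite I"
  shows "(\<Sum>x\<in>I. (cmod (u x))\<^sup>2) = (\<Sum>k\<in>J. (cmod (inner_on I (v k) u))\<^sup>2)"
proof -
  have "complex_of_real (\<Sum>x\<in>I. (cmod (u x))\<^sup>2) = (\<Sum>k\<in>J. inner_on I (v k) u * cnj (inner_on I (v k) u))"
    unfolding inner_on_self[symmetric] onb_parseval[OF assms, of u u] cnj_inner_on ..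
  also have "\<dots> = complex_of_real (\<Sum>k\<in>J. (cmod (inner_on I (v k) u))\<^sup>2)"
    by (simp add: complex_norm_square del: of_real_power)
  finally show ?thesis using of_real_eq_iff by blast
qed

definition eigen_expansion ::
  "'j set \<Rightarrow> 'a set \<Rightarrow> ('j \<Rightarrow> real) \<Rightarrow> ('j \<Rightarrow> 'a \<Rightarrow> complex) \<Rightarrow> ('a \<Rightarrow> 'a \<Rightarrow> complex) \<Rightarrow> bool" where
  "eigen_expansion J I p v X \<longleftrightarrow>
     (\<forall>x\<in>I. \<forall>y\<in>I. X x y = (\<Sum>k\<in>J. complex_of_real (p k) * v k x * cnj (v k y)))"

theorem hermitian_spectral_theorem:
  assumes "finite I" "hermitian_on I X"
  shows "\<exists>p v. onb {..<card I} I v \<and> eigen_expansion {..<card I} I p v X"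
proof -
  obtain v a where v: "\<forall>k<card I. \<forall>l<card I. inner_on I (v k) (v l) = of_bool (k = l)"
     "\<forall>k<card I. \<forall>x\<in>I. mat_app I X (v k) x = a k * v k x"
    using orthonormal_eigenvectors[OF assms order.refl] by blast
  have onb: "onb {..<card I} I v" by (rule orthonormal_imp_onb[OF assms(1) v(1)])
  have real: "a k = complex_of_real (Re (a k))" if "k < card I" for k
  proof -
    have "inner_on I (v k) (\<lambda>x. a k * v k x) = inner_on I (\<lambda>x. a k * v k x) (v k)"
      using inner_on_hermitian[OF assms(2), of "v k" "v k"] v(2) that by simp
    then have "a k = cnj (a k)" using v(1) that by (simp add: inner_on_scale_left inner_on_scale_right)
    then have "Im (a k) = - Im (a k)" by (metis cnj.simps(2))
    then show ?thesis by (simp add: complex_eq_iff)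
  qed
  have "X x y = (\<Sum>k<card I. complex_of_real (Re (a k)) * v k x * cnj (v k y))"
    if xy: "x \<in> I" "y \<in> I" for x y
  proof -
    have "X x y = (\<Sum>z\<in>I. X x z * of_bool (z = y))"
      using assms(1) xy by (simp add: of_bool_def if_distrib cong: if_cong)
    also have "\<dots> = (\<Sum>z\<in>I. X x z * (\<Sum>k<card I. v k z * cnj (v k y)))"
      using onb xy by (intro sum.cong) (auto simp: onb_def)
    also have "\<dots> = (\<Sum>k<card I. mat_app I X (v k) x * cnj (v k y))"
      unfolding mat_app_def sum_distrib_left sum_distrib_right
      by (subst sum.swap) (simp add: mult.assoc)
    also have "\<dots> = (\<Sum>k<card I. complex_of_real (Re (a k)) * v k x * cnj (v k y))"
      using v(2) xy real by (intro sum.cong) auto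
    finally show ?thesis .
  qed
  then have "eigen_expansion {..<card I} I (\<lambda>k. Re (a k)) v X" by (auto simp: eigen_expansion_def)
  with onb show ?thesis by blast
qed

section \<open>Von Neumann entropy\<close>

definition qform :: "'a set \<Rightarrow> ('a \<Rightarrow> 'a \<Rightarrow> complex) \<Rightarrow> ('a \<Rightarrow> complex) \<Rightarrow> complex" where
  "qform I X u = (\<Sum>x\<in>I. \<Sum>y\<in>I. cnj (u x) * X x y * u y)"

definition psd_on :: "'a set \<Rightarrow> ('a \<Rightarrow> 'a \<Rightarrow> complex) \<Rightarrow> bool" where
  "psd_on I X \<longleftrightarrow> hermitian_on I X \<and> (\<forall>u. 0 \<le> Re (qform I X u))"

lemma sum_rotate: "(\<Sum>x\<in>A. \<Sum>y\<in>B. \<Sum>z\<in>C. f x y z) = (\<Sum>z\<in>C. \<Sum>x\<in>A. \<Sum>y\<in>B. f x y z)"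
proof -
  have "(\<Sum>x\<in>A. \<Sum>y\<in>B. \<Sum>z\<in>C. f x y z) = (\<Sum>x\<in>A. \<Sum>z\<in>C. \<Sum>y\<in>B. f x y z)"
    by (intro sum.cong refl sum.swap)
  then show ?thesis by (simp only: sum.swap[of _ A C])
qed

text \<open>The quadratic form is the sum over \<open>E\<close> of the squared moduli of the
  overlaps of \<open>u\<close> with the columns of \<open>M\<close>.\<close>

lemma psd_on_gram:
  "psd_on I (\<lambda>x y. \<Sum>e\<in>E. M x e * cnj (M y e))"
proof -
  have "qform I (\<lambda>x y. \<Sum>e\<in>E. M x e * cnj (M y e)) u
      = complex_of_real (\<Sum>e\<in>E. (cmod (inner_on I u (\<lambda>x. M x e)))\<^sup>2)" for u
  proof -
    have "qform I (\<lambda>x y. \<Sum>e\<in>E. M x e * cnj (M y e)) u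
        = (\<Sum>x\<in>I. \<Sum>e\<in>E. \<Sum>y\<in>I. (cnj (u x) * M x e) * cnj (cnj (u y) * M y e))"
      unfolding qform_def by (intro sum.cong refl, subst sum.swap)
        (simp add: sum_distrib_left sum_distrib_right mult_ac)
    also have "\<dots> = (\<Sum>e\<in>E. inner_on I u (\<lambda>x. M x e) * cnj (inner_on I u (\<lambda>x. M x e)))"
      by (subst sum.swap) (simp add: inner_on_def sum_product)
    finally show ?thesis by (simp add: complex_norm_square del: of_real_power)
  qed
  then show ?thesis
    by (auto simp: psd_on_def hermitian_on_def mult.commute intro!: sum_nonneg)
qed

lemma qform_sum:
  "qform I (\<lambda>x y. \<Sum>k\<in>K. X k x y) u = (\<Sum>k\<in>K. qform I (X k) u)"
  unfolding qform_def sum_distrib_left sum_distrib_right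
  by (rule sum_rotate)

lemma psd_on_sum:
  assumes "\<And>k. k \<in> K \<Longrightarrow> psd_on I (X k)"
  shows "psd_on I (\<lambda>x y. \<Sum>k\<in>K. X k x y)"
proof -
  have "(\<Sum>k\<in>K. X k y x) = cnj (\<Sum>k\<in>K. X k x y)" if "x \<in> I" "y \<in> I" for x y
    unfolding cnj_sum using assms that by (intro sum.cong refl) (metis hermitian_on_def psd_on_def)
  then show ?thesis
    using assms unfolding psd_on_def qform_sum hermitian_on_def Re_sum by (blast intro: sum_nonneg)
qed

lemma qform_eigen:
  assumes "eigen_expansion J I p v X"
  shows "qform I X u = complex_of_real (\<Sum>k\<in>J. p k * (cmod (inner_on I (v k) u))\<^sup>2)"
proof -
  have "qform I X u = (\<Sum>x\<in>I. \<Sum>y\<in>I. \<Sum>k\<in>J. complex_of_real (p k) * (cnj (u x) * v k x) * (cnj (v k y) * u y))"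
    unfolding qform_def using assms
    by (intro sum.cong refl) (simp add: eigen_expansion_def sum_distrib_left sum_distrib_right mult_ac)
  also have "\<dots> = (\<Sum>k\<in>J. complex_of_real (p k) * (inner_on I u (v k) * inner_on I (v k) u))"
    unfolding inner_on_def sum_product
    by (subst sum_rotate) (simp only: sum_distrib_left mult.assoc)
  also have "\<dots> = (\<Sum>k\<in>J. complex_of_real (p k) * complex_of_real ((cmod (inner_on I (v k) u))\<^sup>2))"
    unfolding complex_norm_square cnj_inner_on by (simp only: mult.commute)
  finally show ?thesis by simp
qed

lemma eigen_expansion_apply:
  assumes "onb J I v" "eigen_expansion J I p v X" "finite J" "k \<in> J" "x \<in> I"
  shows "mat_app I X (v k) x = complex_of_real (p k) * v k x"
proof -
  have "mat_app I X (v k) x = (\<Sum>y\<in>I. \<Sum>l\<in>J. complex_of_real (p l) * v l x * (cnj (v l y) * v k y))"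
    unfolding mat_app_def using assms
    by (intro sum.cong refl) (simp add: eigen_expansion_def sum_distrib_left sum_distrib_right mult_ac)
  also have "\<dots> = (\<Sum>l\<in>J. complex_of_real (p l) * v l x * inner_on I (v l) (v k))"
    by (subst sum.swap) (simp add: inner_on_def sum_distrib_left)
  also have "\<dots> = (\<Sum>l\<in>J. if k = l then complex_of_real (p l) * v l x else 0)"
    using assms by (intro sum.cong) (auto simp: onb_def)
  also have "\<dots> = complex_of_real (p k) * v k x" using assms by simp
  finally show ?thesis .
qed

lemma qform_eigenvector:
  assumes "onb J I v" "eigen_expansion J I p v X" "finite J" "k \<in> J"
  shows "qform I X (v k) = complex_of_real (p k)"
proof -
  have "qform I X (v k) = inner_on I (v k) (mat_app I X (v k))"
    by (simp add: qform_def inner_on_def mat_app_def sum_distrib_left mult.assoc)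
  also have "\<dots> = inner_on I (v k) (\<lambda>x. complex_of_real (p k) * v k x)"
    using assms by (simp add: eigen_expansion_apply)
  also have "\<dots> = complex_of_real (p k)"
    using assms by (simp only: inner_on_scale_right) (simp add: onb_def)
  finally show ?thesis .
qed

lemma eigen_expansion_hermitian: "eigen_expansion J I p v X \<Longrightarrow> hermitian_on I X"
  by (auto simp: eigen_expansion_def hermitian_on_def mult_ac)

lemma eigen_expansion_psd:
  assumes "onb J I v" "eigen_expansion J I p v X" "finite J" "psd_on I X" "k \<in> J"
  shows "0 \<le> p k"
  using qform_eigenvector[OF assms(1-3,5)] assms(4) unfolding psd_on_def by (metis Re_complex_of_real)

text \<open>The entropy is defined through an arbitrarily chosen list of eigenvalues. The spectral
  theorem shows that there is something to choose, and orthonormality of \<open>card I\<close>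
  vectors gives the completeness that \<open>onb\<close> demands.\<close>

lemma vn_entropy_obtain:
  assumes "finite I" "hermitian_on I X"
  obtains p v where "onb {..<card I} I v" "eigen_expansion {..<card I} I p v X"
    "vn_entropy I X = - (\<Sum>k<card I. p k * log 2 (p k))"
proof -
  have sd: "spectral_decomp I X p \<longleftrightarrow> (\<exists>v. onb {..<card I} I v \<and> eigen_expansion {..<card I} I p v X)" for p
  proof
    assume "spectral_decomp I X p"
    then obtain v where v: "\<forall>k<card I. \<forall>l<card I. (\<Sum>x\<in>I. cnj (v k x) * v l x) = (if k = l then 1 else 0)"
      "\<forall>x\<in>I. \<forall>y\<in>I. X x y = (\<Sum>k<card I. complex_of_real (p k) * v k x * cnj (v k y))"
      unfolding spectral_decomp_def by blast
    have "onb {..<card I} I v"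
      using v(1) by (intro orthonormal_imp_onb assms) (auto simp: inner_on_def)
    then show "\<exists>v. onb {..<card I} I v \<and> eigen_expansion {..<card I} I p v X"
      using v(2) by (intro exI[of _ v]) (auto simp: eigen_expansion_def)
  next
    assume "\<exists>v. onb {..<card I} I v \<and> eigen_expansion {..<card I} I p v X"
    then obtain v where v: "onb {..<card I} I v" "eigen_expansion {..<card I} I p v X" by blast
    show "spectral_decomp I X p"
      unfolding spectral_decomp_def using v
      by (intro exI[of _ v]) (auto simp: onb_def inner_on_def eigen_expansion_def)
  qed
  define p where "p = (SOME p. spectral_decomp I X p)"
  have "\<exists>p. spectral_decomp I X p" using hermitian_spectral_theorem[OF assms] sd by blast
  then have "spectral_decomp I X p" unfolding p_def by (rule someI_ex)
  then obtain v where "onb {..<card I} I v" "eigen_expansion {..<card I} I p v X" using sd by blast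
  moreover have "vn_entropy I X = - (\<Sum>k<card I. p k * log 2 (p k))"
    by (simp add: vn_entropy_def p_def Let_def)
  ultimately show thesis using that by blast
qed

lemma vn_entropy_cong:
  assumes "\<And>x y. x \<in> I \<Longrightarrow> y \<in> I \<Longrightarrow> X x y = Y x y"
  shows "vn_entropy I X = vn_entropy I Y"
proof -
  have "spectral_decomp I X = spectral_decomp I Y"
    using assms by (intro ext) (simp add: spectral_decomp_def)
  then show ?thesis by (simp add: vn_entropy_def)
qed

text \<open>With \<open>a\<^sub>k\<^sub>l\<close> the matrix of \<open>M\<close> between the two eigenbases, \<open>(\<lambda>\<^sub>k - \<mu>\<^sub>l) a\<^sub>k\<^sub>l = 0\<close>, and the rows
  and columns of \<open>|a\<^sub>k\<^sub>l|\<^sup>2\<close> sum to \<open>\<lambda>\<^sub>k\<close> and \<open>\<mu>\<^sub>l\<close>.\<close>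

lemma gram_spectral_sum:
  fixes M :: "'a \<Rightarrow> 'b \<Rightarrow> complex" and g :: "real \<Rightarrow> real"
  assumes fin: "finite I" "finite J" "finite K" "finite L"
    and v: "onb K I v" "eigen_expansion K I p v (\<lambda>x y. \<Sum>j\<in>J. M x j * cnj (M y j))"
    and w: "onb L J w" "eigen_expansion L J q w (\<lambda>i j. \<Sum>x\<in>I. M x i * cnj (M x j))"
  shows "(\<Sum>k\<in>K. p k * g (p k)) = (\<Sum>l\<in>L. q l * g (q l))"
proof -
  define c where "c = (\<lambda>k j. inner_on I (v k) (\<lambda>x. M x j))"
  define d where "d = (\<lambda>l x. inner_on J (w l) (\<lambda>j. M x j))"
  define a where "a = (\<lambda>k l. inner_on J (w l) (c k))"
  have a2: "a k l = inner_on I (v k) (d l)" for k l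
    unfolding a_def c_def d_def inner_on_def sum_distrib_left
    by (subst sum.swap) (simp add: mult_ac)
  have row: "(\<Sum>l\<in>L. (cmod (a k l))\<^sup>2) = p k" if "k \<in> K" for k
  proof -
    have "complex_of_real (\<Sum>l\<in>L. (cmod (a k l))\<^sup>2) = complex_of_real (\<Sum>j\<in>J. (cmod (c k j))\<^sup>2)"
      unfolding a_def using onb_parseval_norm[OF w(1) fin(2)] by simp
    also have "\<dots> = (\<Sum>j\<in>J. c k j * cnj (c k j))"
      by (simp add: complex_norm_square del: of_real_power)
    also have "\<dots> = (\<Sum>j\<in>J. \<Sum>x\<in>I. \<Sum>y\<in>I. cnj (v k x) * (M x j * cnj (M y j)) * v k y)"
      by (simp add: c_def inner_on_def sum_product mult_ac)
    also have "\<dots> = qform I (\<lambda>x y. \<Sum>j\<in>J. M x j * cnj (M y j)) (v k)"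
      unfolding qform_def sum_distrib_left sum_distrib_right by (rule sum_rotate[symmetric])
    also have "\<dots> = complex_of_real (p k)" by (rule qform_eigenvector[OF v fin(3) that])
    finally show ?thesis using of_real_eq_iff by blast
  qed
  have col: "(\<Sum>k\<in>K. (cmod (a k l))\<^sup>2) = q l" if "l \<in> L" for l
  proof -
    have "complex_of_real (\<Sum>k\<in>K. (cmod (a k l))\<^sup>2) = complex_of_real (\<Sum>x\<in>I. (cmod (d l x))\<^sup>2)"
      unfolding a2 using onb_parseval_norm[OF v(1) fin(1)] by simp
    also have "\<dots> = (\<Sum>x\<in>I. d l x * cnj (d l x))"
      by (simp add: complex_norm_square del: of_real_power)
    also have "\<dots> = (\<Sum>x\<in>I. \<Sum>i\<in>J. \<Sum>j\<in>J. cnj (w l i) * (M x i * cnj (M x j)) * w l j)"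
      by (simp add: d_def inner_on_def sum_product mult_ac)
    also have "\<dots> = qform J (\<lambda>i j. \<Sum>x\<in>I. M x i * cnj (M x j)) (w l)"
      unfolding qform_def sum_distrib_left sum_distrib_right by (rule sum_rotate[symmetric])
    also have "\<dots> = complex_of_real (q l)" by (rule qform_eigenvector[OF w fin(4) that])
    finally show ?thesis using of_real_eq_iff by blast
  qed
  have eig: "complex_of_real (p k) * a k l = complex_of_real (q l) * a k l" if "k \<in> K" "l \<in> L" for k l
  proof -
    have 1: "(\<Sum>j\<in>J. c k j * cnj (M y j)) = complex_of_real (p k) * cnj (v k y)" if "y \<in> I" for y
    proof -
      have "(\<Sum>j\<in>J. c k j * cnj (M y j)) = cnj (mat_app I (\<lambda>x y. \<Sum>j\<in>J. M x j * cnj (M y j)) (v k) y)"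
        unfolding mat_app_def c_def inner_on_def cnj_sum sum_distrib_right
        by (subst sum.swap) (simp add: sum_distrib_left sum_distrib_right mult_ac)
      then show ?thesis using eigen_expansion_apply[OF v fin(3) \<open>k \<in> K\<close> that] by simp
    qed
    have 2: "(\<Sum>y\<in>I. cnj (M y j) * d l y) = complex_of_real (q l) * cnj (w l j)" if "j \<in> J" for j
    proof -
      have "(\<Sum>y\<in>I. cnj (M y j) * d l y) = cnj (mat_app J (\<lambda>i j. \<Sum>x\<in>I. M x i * cnj (M x j)) (w l) j)"
        unfolding mat_app_def d_def inner_on_def cnj_sum sum_distrib_left
        by (subst sum.swap) (simp add: sum_distrib_left sum_distrib_right mult_ac)
      then show ?thesis using eigen_expansion_apply[OF w fin(4) \<open>l \<in> L\<close> that] by simp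
    qed
    have "complex_of_real (p k) * a k l = (\<Sum>y\<in>I. (\<Sum>j\<in>J. c k j * cnj (M y j)) * d l y)"
      by (simp add: a2 inner_on_def 1 sum_distrib_left mult.assoc)
    also have "\<dots> = (\<Sum>j\<in>J. c k j * (\<Sum>y\<in>I. cnj (M y j) * d l y))"
      unfolding sum_distrib_left sum_distrib_right by (subst sum.swap) (simp add: mult.assoc)
    also have "\<dots> = complex_of_real (q l) * a k l"
      using 2 by (simp add: a_def inner_on_def sum_distrib_left[symmetric] mult_ac cong: sum.cong)
    finally show ?thesis .
  qed
  \<comment> \<open>The factor in front of \<open>g\<close> becomes a row sum. Zero eigenvalues thus
    contribute nothing whatever \<open>g 0\<close> is, and \<open>K\<close> and \<open>L\<close> may
    differ in size.\<close>
  have "(\<Sum>k\<in>K. p k * g (p k)) = (\<Sum>k\<in>K. \<Sum>l\<in>L. (cmod (a k l))\<^sup>2 * g (p k))"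
    by (intro sum.cong refl) (simp only: sum_distrib_right[symmetric] row)
  also have "\<dots> = (\<Sum>k\<in>K. \<Sum>l\<in>L. (cmod (a k l))\<^sup>2 * g (q l))"
  proof (intro sum.cong refl)
    fix k l assume "k \<in> K" "l \<in> L"
    then have "a k l = 0 \<or> p k = q l" using eig[of k l] by auto
    then show "(cmod (a k l))\<^sup>2 * g (p k) = (cmod (a k l))\<^sup>2 * g (q l)" by auto
  qed
  also have "\<dots> = (\<Sum>l\<in>L. q l * g (q l))"
    by (subst sum.swap, intro sum.cong refl) (simp only: sum_distrib_right[symmetric] col)
  finally show ?thesis .
qed

text \<open>Read \<open>M\<close> as the amplitudes of a pure state on \<open>I\<close> and
  \<open>J\<close>: the two matrices are its marginals. Every purification argument below goes
  through this identity.\<close>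

lemma vn_entropy_gram_swap:
  fixes M :: "'a \<Rightarrow> 'b \<Rightarrow> complex"
  assumes "finite I" "finite J"
  shows "vn_entropy I (\<lambda>x y. \<Sum>j\<in>J. M x j * cnj (M y j))
       = vn_entropy J (\<lambda>i j. \<Sum>x\<in>I. M x i * cnj (M x j))"
proof -
  obtain p v where v: "onb {..<card I} I v"
      "eigen_expansion {..<card I} I p v (\<lambda>x y. \<Sum>j\<in>J. M x j * cnj (M y j))"
      "vn_entropy I (\<lambda>x y. \<Sum>j\<in>J. M x j * cnj (M y j)) = - (\<Sum>k<card I. p k * log 2 (p k))"
    using psd_on_gram[of I M J] unfolding psd_on_def by (elim conjE vn_entropy_obtain[OF assms(1)])
  obtain q w where w: "onb {..<card J} J w"
      "eigen_expansion {..<card J} J q w (\<lambda>i j. \<Sum>x\<in>I. M x i * cnj (M x j))"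
      "vn_entropy J (\<lambda>i j. \<Sum>x\<in>I. M x i * cnj (M x j)) = - (\<Sum>k<card J. q k * log 2 (q k))"
    using psd_on_gram[of J "\<lambda>j x. M x j" I] unfolding psd_on_def by (elim conjE vn_entropy_obtain[OF assms(2)])
  show ?thesis
    using gram_spectral_sum[OF assms _ _ v(1,2) w(1,2), of "log 2"] v(3) w(3) by simp
qed

lemma cnj_of_bool [simp]: "cnj (of_bool b) = of_bool b"
  by (cases b) auto

lemma onb_of_bool:
  assumes "finite J"
  shows "onb J J (\<lambda>k j. of_bool (k = j))"
proof -
  have *: "(\<Sum>x\<in>J. of_bool (k = x) * of_bool (l = x)) = (of_bool (k = l) :: complex)" if "k \<in> J" for k l
  proof -
    have "(\<Sum>x\<in>J. of_bool (k = x) * of_bool (l = x)) = (\<Sum>x\<in>J. if k = x then of_bool (k = l) else (0 :: complex))"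
      by (intro sum.cong) auto
    then show ?thesis using assms that by simp
  qed
  have "(\<Sum>x\<in>J. of_bool (x = k) * of_bool (x = l)) = (\<Sum>x\<in>J. of_bool (k = x) * (of_bool (l = x) :: complex))" for k l
    by (intro sum.cong) auto
  with * show ?thesis by (simp add: onb_def inner_on_def)
qed

text \<open>The vectors \<open>v k\<close>, scaled by the square roots of \<open>p k\<close>, form a
  Gram factor of \<open>X\<close> whose other Gram matrix is diagonal with entries
  \<open>p k\<close>, so the chosen spectrum and \<open>p\<close> give the same entropy. The family
  may be incomplete because the missing eigenvalues are zero.\<close>

lemma vn_entropy_orthonormal:
  assumes "finite I" "finite J" "\<And>k. k \<in> J \<Longrightarrow> 0 \<le> p k"
    and v: "\<And>k l. k \<in> J \<Longrightarrow> l \<in> J \<Longrightarrow> inner_on I (v k) (v l) = of_bool (k = l)"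
    and X: "eigen_expansion J I p v X"
  shows "vn_entropy I X = - (\<Sum>k\<in>J. p k * log 2 (p k))"
proof -
  obtain q w where w: "onb {..<card I} I w" "eigen_expansion {..<card I} I q w X"
      "vn_entropy I X = - (\<Sum>k<card I. q k * log 2 (q k))"
    by (rule vn_entropy_obtain[OF assms(1) eigen_expansion_hermitian[OF X]])
  define M where "M = (\<lambda>x k. complex_of_real (sqrt (p k)) * v k x)"
  have XM: "X x y = (\<Sum>j\<in>J. M x j * cnj (M y j))" if "x \<in> I" "y \<in> I" for x y
  proof -
    have "complex_of_real (p j) * v j x * cnj (v j y) = M x j * cnj (M y j)" if "j \<in> J" for j
    proof -
      have "M x j * cnj (M y j) = complex_of_real (sqrt (p j) * sqrt (p j)) * v j x * cnj (v j y)"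
        by (simp only: M_def complex_cnj_mult complex_cnj_complex_of_real of_real_mult mult_ac)
      then show ?thesis using assms(3)[OF that] by simp
    qed
    then show ?thesis using X that by (simp add: eigen_expansion_def)
  qed
  have w2: "eigen_expansion {..<card I} I q w (\<lambda>x y. \<Sum>j\<in>J. M x j * cnj (M y j))"
    using w(2) XM by (simp add: eigen_expansion_def)
  have d1: "onb J J (\<lambda>k j. of_bool (k = j))"
    by (rule onb_of_bool[OF assms(2)])
  have "(\<Sum>x\<in>I. M x i * cnj (M x j)) = (\<Sum>k\<in>J. complex_of_real (p k) * of_bool (k = i) * of_bool (k = j))"
    if "i \<in> J" "j \<in> J" for i j
  proof -
    have "(\<Sum>x\<in>I. M x i * cnj (M x j)) = complex_of_real (sqrt (p i) * sqrt (p j)) * inner_on I (v j) (v i)"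
      by (simp add: M_def inner_on_def sum_distrib_left mult_ac)
    also have "\<dots> = of_bool (i = j) * complex_of_real (p i)"
      using v that assms(3)[of i] by (cases "i = j") (simp_all del: of_real_mult)
    also have "\<dots> = (\<Sum>k\<in>J. if k = i then of_bool (i = j) * complex_of_real (p i) else 0)"
      using that assms(2) by simp
    also have "\<dots> = (\<Sum>k\<in>J. complex_of_real (p k) * of_bool (k = i) * of_bool (k = j))"
      by (intro sum.cong) auto
    finally show ?thesis .
  qed
  then have d2: "eigen_expansion J J p (\<lambda>k j. of_bool (k = j)) (\<lambda>i j. \<Sum>x\<in>I. M x i * cnj (M x j))"
    by (simp add: eigen_expansion_def)
  show ?thesis
    using gram_spectral_sum[OF assms(1,2) _ assms(2) w(1) w2 d1 d2, of "log 2"] w(3) by simp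
qed

section \<open>Monotonicity of relative entropy\<close>

text \<open>An index stands for a pair of eigenvectors of two states, \<open>a\<close> or
  \<open>b\<close> for their squared overlap, the other arguments for the two eigenvalues. The
  hypothesis \<open>le\<close> says that the derivative of \<open>G\<close> below is nonnegative;
  the value of \<open>G\<close> at \<open>0\<close> and its limit at infinity supply the two kinds
  of logarithmic terms.\<close>

lemma relative_log_sum_mono:
  fixes a p q :: "'i \<Rightarrow> real" and b p' q' :: "'j \<Rightarrow> real"
  assumes fin: "finite P" "finite Q"
    and P: "\<And>i. i \<in> P \<Longrightarrow> 0 \<le> p i" "\<And>i. i \<in> P \<Longrightarrow> 0 \<le> q i"
      "\<And>i. i \<in> P \<Longrightarrow> q i = 0 \<Longrightarrow> a i * p i = 0"
    and Q: "\<And>j. j \<in> Q \<Longrightarrow> 0 \<le> p' j" "\<And>j. j \<in> Q \<Longrightarrow> 0 \<le> q' j"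
      "\<And>j. j \<in> Q \<Longrightarrow> q' j = 0 \<Longrightarrow> b j * p' j = 0"
    and total: "(\<Sum>i\<in>P. a i * p i) = (\<Sum>j\<in>Q. b j * p' j)"
    and le: "\<And>s. 0 < s \<Longrightarrow> (\<Sum>j\<in>Q. b j * (p' j)\<^sup>2 / (q' j + s * p' j)) \<le> (\<Sum>i\<in>P. a i * (p i)\<^sup>2 / (q i + s * p i))"
  shows "(\<Sum>j\<in>Q. b j * p' j * (ln (p' j) - ln (q' j))) \<le> (\<Sum>i\<in>P. a i * p i * (ln (p i) - ln (q i)))"
proof -
  define G where "G = (\<lambda>s. (\<Sum>i\<in>P. a i * p i * ln (q i + s * p i)) - (\<Sum>j\<in>Q. b j * p' j * ln (q' j + s * p' j)))"
  define G' where "G' = (\<lambda>s. (\<Sum>i\<in>P. a i * (p i)\<^sup>2 / (q i + s * p i)) - (\<Sum>j\<in>Q. b j * (p' j)\<^sup>2 / (q' j + s * p' j)))"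
  \<comment> \<open>The support condition covers the case of a vanishing argument of
    \<open>ln\<close>, so the derivative exists also at \<open>s = 0\<close>, where the mean value
    theorem asks for it.\<close>
  have der_term: "((\<lambda>s. c * x * ln (y + s * x)) has_real_derivative c * x\<^sup>2 / (y + s * x)) (at s)"
    if "0 \<le> x" "0 \<le> y" "y = 0 \<Longrightarrow> c * x = 0" "0 \<le> s" for c x y s :: real
  proof (cases "c * x = 0")
    case True
    then have "(\<lambda>s. c * x * ln (y + s * x)) = (\<lambda>s. 0)" "c * x\<^sup>2 / (y + s * x) = 0"
      by (auto simp: power2_eq_square)
    then show ?thesis by (simp only: DERIV_const)
  next
    case False
    then have "y + s * x > 0" using that by (metis add_pos_nonneg mult_nonneg_nonneg order_le_less)
    then show ?thesis
      by (auto intro!: derivative_eq_intros simp: power2_eq_square)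
  qed
  have der: "(G has_real_derivative G' s) (at s)" if "0 \<le> s" for s
    unfolding G_def G'_def using P Q that by (intro DERIV_diff DERIV_sum der_term) auto
  have mono: "G 0 \<le> G s" if s: "0 < s" for s
  proof -
    obtain z where z: "0 < z" "z < s" "G s - G 0 = (s - 0) * G' z"
      using MVT2[OF s, of G G'] der by auto
    have "0 \<le> G' z" using le[OF z(1)] by (simp add: G'_def)
    then have "0 \<le> s * G' z" using s by simp
    then show ?thesis using z by simp
  qed
  have lim_term: "((\<lambda>s. c * x * (ln (y + s * x) - ln s)) \<longlongrightarrow> c * x * ln x) at_top"
    if "0 \<le> x" "0 \<le> y" for c x y :: real
  proof (cases "x = 0")
    case False
    with that have x: "x > 0" by simp
    have "((\<lambda>s. y / s) \<longlongrightarrow> 0) at_top"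
      by (intro tendsto_divide_0[OF tendsto_const]) (simp add: filterlim_at_top_imp_at_infinity filterlim_ident)
    then have "((\<lambda>s. c * x * ln (y / s + x)) \<longlongrightarrow> c * x * ln (0 + x)) at_top"
      using x by (intro tendsto_intros) auto
    moreover have "\<forall>\<^sub>F s in at_top. c * x * (ln (y + s * x) - ln s) = c * x * ln (y / s + x)"
      using eventually_gt_at_top[of 0]
    proof eventually_elim
      case (elim s)
      have "y + s * x > 0" using elim x that by (simp add: add_nonneg_pos)
      then have "ln (y + s * x) - ln s = ln ((y + s * x) / s)" using elim by (simp add: ln_div)
      also have "(y + s * x) / s = y / s + x" using elim by (simp add: add_divide_distrib)
      finally show ?case by simp
    qed
    ultimately show ?thesis by (simp only: tendsto_cong add_0_left)
  qed auto
  \<comment> \<open>Both sums grow like the same multiple of \<open>ln s\<close>; equality of the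
    totals removes it and leaves a finite limit.\<close>
  have "(\<Sum>i\<in>P. a i * p i * ln s) = (\<Sum>j\<in>Q. b j * p' j * ln s)" for s
    unfolding sum_distrib_right[symmetric] total ..
  then have G2: "G s = (\<Sum>i\<in>P. a i * p i * (ln (q i + s * p i) - ln s))
      - (\<Sum>j\<in>Q. b j * p' j * (ln (q' j + s * p' j) - ln s))" for s
    by (simp add: G_def right_diff_distrib sum_subtractf)
  have "(G \<longlongrightarrow> (\<Sum>i\<in>P. a i * p i * ln (p i)) - (\<Sum>j\<in>Q. b j * p' j * ln (p' j))) at_top"
    unfolding G2 using P Q by (intro tendsto_diff tendsto_sum lim_term) auto
  then have "G 0 \<le> (\<Sum>i\<in>P. a i * p i * ln (p i)) - (\<Sum>j\<in>Q. b j * p' j * ln (p' j))"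
    using eventually_mono[OF eventually_gt_at_top[of 0] mono] by (rule tendsto_lowerbound) (simp_all add: trivial_limit_at_top_linorder)
  then show ?thesis by (simp add: G_def right_diff_distrib sum_subtractf)
qed

text \<open>For fixed \<open>s > 0\<close> the maximum of the following over all \<open>Y\<close> is
  \<open>\<Sum>\<^sub>j\<^sub>l |\<langle>w\<^sub>l, v\<^sub>j\<rangle>|\<^sup>2 p\<^sub>j\<^sup>2 / (q\<^sub>l + s p\<^sub>j)\<close> in terms of the eigenvalues and eigenvectors of \<open>\<rho>\<close> and \<open>\<sigma>\<close>. The three terms are the traces of \<open>Y\<^sup>* \<rho>\<close>,
  \<open>Y Y\<^sup>* \<sigma>\<close> and \<open>Y\<^sup>* Y \<rho>\<close>.\<close>

definition varfun :: "'a set \<Rightarrow> real \<Rightarrow> ('a \<Rightarrow> 'a \<Rightarrow> complex) \<Rightarrow> ('a \<Rightarrow> 'a \<Rightarrow> complex) \<Rightarrow>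
    ('a \<Rightarrow> 'a \<Rightarrow> complex) \<Rightarrow> real" where
  "varfun I s \<rho> \<sigma> Y = 2 * Re (\<Sum>x\<in>I. \<Sum>y\<in>I. cnj (Y x y) * \<rho> x y)
     - Re (\<Sum>z\<in>I. qform I \<sigma> (\<lambda>x. Y x z)) - s * Re (\<Sum>x\<in>I. qform I \<rho> (\<lambda>y. cnj (Y x y)))"

text \<open>Parseval in both eigenbases decouples the functional: each coordinate
  \<open>y l j\<close> of \<open>Y\<close> occurs in a quadratic polynomial of its own.\<close>

lemma varfun_eigen:
  fixes Y :: "'a \<Rightarrow> 'a \<Rightarrow> complex"
  assumes fin: "finite I" "finite J" "finite L"
    and v: "onb J I v" "eigen_expansion J I p v \<rho>"
    and w: "onb L I w" "eigen_expansion L I q w \<sigma>"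
  defines "y \<equiv> \<lambda>l j. inner_on I (w l) (mat_app I Y (v j))"
  shows "varfun I s \<rho> \<sigma> Y = (\<Sum>j\<in>J. \<Sum>l\<in>L. 2 * p j * Re (inner_on I (w l) (v j) * cnj (y l j))
     - (q l + s * p j) * (cmod (y l j))\<^sup>2)"
proof -
  have "(\<Sum>x\<in>I. \<Sum>y\<in>I. cnj (Y x y) * \<rho> x y)
      = (\<Sum>x\<in>I. \<Sum>y\<in>I. \<Sum>j\<in>J. complex_of_real (p j) * (cnj (Y x y * v j y) * v j x))"
    using v(2) by (intro sum.cong refl) (simp add: eigen_expansion_def sum_distrib_left mult_ac)
  also have "\<dots> = (\<Sum>j\<in>J. complex_of_real (p j) * inner_on I (mat_app I Y (v j)) (v j))"
    by (subst sum_rotate) (simp add: inner_on_def mat_app_def sum_distrib_left sum_distrib_right)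
  also have "\<dots> = (\<Sum>j\<in>J. \<Sum>l\<in>L. complex_of_real (p j) * (inner_on I (w l) (v j) * cnj (y l j)))"
    unfolding y_def cnj_inner_on sum_distrib_left[symmetric]
    by (intro sum.cong refl) (simp add: onb_parseval[OF w(1) fin(1), symmetric])
  finally have T1: "Re (\<Sum>x\<in>I. \<Sum>y\<in>I. cnj (Y x y) * \<rho> x y)
      = (\<Sum>j\<in>J. \<Sum>l\<in>L. p j * Re (inner_on I (w l) (v j) * cnj (y l j)))"
    by (simp add: Re_sum)
  define g where "g = (\<lambda>l z. inner_on I (w l) (\<lambda>x. Y x z))"
  have yg: "cmod (y l j) = cmod (inner_on I (v j) (\<lambda>z. cnj (g l z)))" for l j
  proof -
    have "y l j = cnj (inner_on I (v j) (\<lambda>z. cnj (g l z)))"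
      unfolding y_def g_def inner_on_def mat_app_def sum_distrib_left sum_distrib_right cnj_sum
      by (subst sum.swap) (simp add: sum_distrib_left mult_ac)
    then show ?thesis by simp
  qed
  have "Re (\<Sum>z\<in>I. qform I \<sigma> (\<lambda>x. Y x z)) = (\<Sum>z\<in>I. \<Sum>l\<in>L. q l * (cmod (g l z))\<^sup>2)"
    by (simp add: qform_eigen[OF w(2)] g_def del: of_real_sum)
  also have "\<dots> = (\<Sum>l\<in>L. q l * (\<Sum>z\<in>I. (cmod (cnj (g l z)))\<^sup>2))"
    by (subst sum.swap) (simp add: sum_distrib_left)
  also have "\<dots> = (\<Sum>l\<in>L. \<Sum>j\<in>J. q l * (cmod (y l j))\<^sup>2)"
    unfolding yg sum_distrib_left[symmetric] onb_parseval_norm[OF v(1) fin(1)] ..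
  also have "\<dots> = (\<Sum>j\<in>J. \<Sum>l\<in>L. q l * (cmod (y l j))\<^sup>2)"
    by (rule sum.swap)
  finally have T2: "Re (\<Sum>z\<in>I. qform I \<sigma> (\<lambda>x. Y x z)) = (\<Sum>j\<in>J. \<Sum>l\<in>L. q l * (cmod (y l j))\<^sup>2)" .
  have h: "cmod (inner_on I (v j) (\<lambda>y. cnj (Y x y))) = cmod (mat_app I Y (v j) x)" for j x
  proof -
    have "mat_app I Y (v j) x = cnj (inner_on I (v j) (\<lambda>y. cnj (Y x y)))"
      by (simp add: mat_app_def inner_on_def mult.commute)
    then show ?thesis by simp
  qed
  have "Re (\<Sum>x\<in>I. qform I \<rho> (\<lambda>y. cnj (Y x y))) = (\<Sum>x\<in>I. \<Sum>j\<in>J. p j * (cmod (mat_app I Y (v j) x))\<^sup>2)"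
    by (simp add: qform_eigen[OF v(2)] h del: of_real_sum)
  also have "\<dots> = (\<Sum>j\<in>J. p j * (\<Sum>x\<in>I. (cmod (mat_app I Y (v j) x))\<^sup>2))"
    by (subst sum.swap) (simp add: sum_distrib_left)
  also have "\<dots> = (\<Sum>j\<in>J. \<Sum>l\<in>L. p j * (cmod (y l j))\<^sup>2)"
    unfolding y_def sum_distrib_left[symmetric] onb_parseval_norm[OF w(1) fin(1)] ..
  finally have T3: "Re (\<Sum>x\<in>I. qform I \<rho> (\<lambda>y. cnj (Y x y))) = (\<Sum>j\<in>J. \<Sum>l\<in>L. p j * (cmod (y l j))\<^sup>2)" .
  show ?thesis
    unfolding varfun_def T1 T2 T3
    by (simp only: sum_distrib_left sum_subtractf[symmetric]) (simp add: algebra_simps)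
qed

lemma varfun_le:
  assumes fin: "finite I" "finite J" "finite L"
    and v: "onb J I v" "eigen_expansion J I p v \<rho>" "\<And>j. j \<in> J \<Longrightarrow> 0 \<le> p j"
    and w: "onb L I w" "eigen_expansion L I q w \<sigma>" "\<And>l. l \<in> L \<Longrightarrow> 0 \<le> q l"
    and "0 < s"
  shows "varfun I s \<rho> \<sigma> Y \<le> (\<Sum>j\<in>J. \<Sum>l\<in>L. (cmod (inner_on I (w l) (v j)))\<^sup>2 * (p j)\<^sup>2 / (q l + s * p j))"
proof -
  \<comment> \<open>Completing the square for a single coordinate. If the denominator is zero then
    so is \<open>x\<close>, and both sides vanish.\<close>
  have "2 * x * Re (c * cnj z) - (r + s * x) * (cmod z)\<^sup>2 \<le> (cmod c)\<^sup>2 * x\<^sup>2 / (r + s * x)"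
    if "0 \<le> x" "0 \<le> r" for x r :: real and c z :: complex
  proof (cases "r + s * x = 0")
    case True
    moreover have "0 \<le> s * x" using that \<open>0 < s\<close> by simp
    ultimately have "s * x = 0" using that by linarith
    then have "x = 0" using \<open>0 < s\<close> by simp
    then show ?thesis using True by simp
  next
    case False
    define t where "t = r + s * x"
    have t: "t > 0" using False that \<open>0 < s\<close> by (metis add_nonneg_nonneg less_eq_real_def mult_nonneg_nonneg t_def)
    have "Re (c * cnj z) \<le> cmod c * cmod z"
      using complex_Re_le_cmod[of "c * cnj z"] by (simp add: norm_mult)
    then have "2 * x * Re (c * cnj z) \<le> 2 * (x * cmod c) * cmod z"
      using that by (simp add: mult_left_mono mult.assoc)
    moreover have "0 \<le> (x * cmod c - t * cmod z)\<^sup>2 / t" using t by simp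
    moreover have "(x * cmod c - t * cmod z)\<^sup>2 / t = (cmod c)\<^sup>2 * x\<^sup>2 / t - 2 * (x * cmod c) * cmod z + t * (cmod z)\<^sup>2"
      using t by (simp add: field_simps power2_eq_square)
    ultimately show ?thesis unfolding t_def by linarith
  qed
  then show ?thesis
    unfolding varfun_eigen[OF fin v(1,2) w(1,2)] using v(3) w(3) by (intro sum_mono) auto
qed

lemma varfun_attained:
  assumes fin: "finite I" "finite J" "finite L"
    and v: "onb J I v" "eigen_expansion J I p v \<rho>" "\<And>j. j \<in> J \<Longrightarrow> 0 \<le> p j"
    and w: "onb L I w" "eigen_expansion L I q w \<sigma>" "\<And>l. l \<in> L \<Longrightarrow> 0 \<le> q l"
    and "0 < s"
  shows "\<exists>Y. varfun I s \<rho> \<sigma> Y = (\<Sum>j\<in>J. \<Sum>l\<in>L. (cmod (inner_on I (w l) (v j)))\<^sup>2 * (p j)\<^sup>2 / (q l + s * p j))"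
proof -
  \<comment> \<open>The stationary point of each quadratic. A zero denominator makes the quotient
    \<open>0\<close>, which is harmless because both sides of the termwise identity then
    vanish.\<close>
  define z where "z = (\<lambda>l j. complex_of_real (p j / (q l + s * p j)) * inner_on I (w l) (v j))"
  define Y where "Y = (\<lambda>x y. \<Sum>l\<in>L. \<Sum>j\<in>J. z l j * w l x * cnj (v j y))"
  have "inner_on I (w l) (mat_app I Y (v j)) = z l j" if "l \<in> L" "j \<in> J" for l j
  proof -
    have Yv: "mat_app I Y (v j) = (\<lambda>x. \<Sum>l\<in>L. z l j * w l x)"
    proof
      fix x
      have "mat_app I Y (v j) x = (\<Sum>y\<in>I. \<Sum>l\<in>L. \<Sum>i\<in>J. z l i * w l x * (cnj (v i y) * v j y))"
        by (simp add: mat_app_def Y_def sum_distrib_right mult.assoc)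
      also have "\<dots> = (\<Sum>l\<in>L. \<Sum>i\<in>J. \<Sum>y\<in>I. z l i * w l x * (cnj (v i y) * v j y))"
        by (rule sum_rotate[symmetric])
      also have "\<dots> = (\<Sum>l\<in>L. \<Sum>i\<in>J. z l i * w l x * inner_on I (v i) (v j))"
        by (simp add: inner_on_def sum_distrib_left)
      also have "\<dots> = (\<Sum>l\<in>L. \<Sum>i\<in>J. if j = i then z l i * w l x else 0)"
        using v(1) that by (intro sum.cong refl) (auto simp: onb_def)
      finally show "mat_app I Y (v j) x = (\<Sum>l\<in>L. z l j * w l x)" using fin that by simp
    qed
    have "inner_on I (w l) (mat_app I Y (v j)) = (\<Sum>k\<in>L. z k j * inner_on I (w l) (w k))"
      unfolding Yv inner_on_sum_right ..
    also have "\<dots> = (\<Sum>k\<in>L. if l = k then z k j else 0)"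
      using w(1) that by (intro sum.cong refl) (auto simp: onb_def)
    finally show ?thesis using fin that by simp
  qed
  then have "varfun I s \<rho> \<sigma> Y = (\<Sum>j\<in>J. \<Sum>l\<in>L. 2 * p j * Re (inner_on I (w l) (v j) * cnj (z l j))
     - (q l + s * p j) * (cmod (z l j))\<^sup>2)"
    unfolding varfun_eigen[OF fin v(1,2) w(1,2)] by simp
  also have "\<dots> = (\<Sum>j\<in>J. \<Sum>l\<in>L. (cmod (inner_on I (w l) (v j)))\<^sup>2 * (p j)\<^sup>2 / (q l + s * p j))"
  proof (intro sum.cong refl)
    fix j l assume "j \<in> J" "l \<in> L"
    define t where "t = q l + s * p j"
    define c where "c = inner_on I (w l) (v j)"
    have zc: "z l j = complex_of_real (p j / t) * c" by (simp add: z_def t_def c_def)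
    have 1: "c * cnj (z l j) = complex_of_real (p j / t * (cmod c)\<^sup>2)"
      by (simp add: zc complex_norm_square mult_ac del: of_real_power)
    have 2: "(cmod (z l j))\<^sup>2 = (p j / t)\<^sup>2 * (cmod c)\<^sup>2"
      by (simp only: zc norm_mult norm_of_real power_mult_distrib power2_abs)
    show "2 * p j * Re (inner_on I (w l) (v j) * cnj (z l j)) - (q l + s * p j) * (cmod (z l j))\<^sup>2
        = (cmod (inner_on I (w l) (v j)))\<^sup>2 * (p j)\<^sup>2 / (q l + s * p j)"
      unfolding c_def[symmetric] t_def[symmetric] 1 2 Re_complex_of_real
      by (cases "t = 0") (simp_all add: field_simps power2_eq_square)
  qed
  finally show ?thesis by blast
qed

text \<open>The last clause puts the support of \<open>\<rho>\<close> inside that of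
  \<open>\<sigma>\<close>: the relative entropy is then finite, and the convention
  \<open>ln 0 = 0\<close> hides no infinite term.\<close>

definition spectral_pair where
  "spectral_pair I J L p v q w \<rho> \<sigma> \<longleftrightarrow>
     onb J I v \<and> eigen_expansion J I p v \<rho> \<and> (\<forall>j\<in>J. 0 \<le> p j) \<and>
     onb L I w \<and> eigen_expansion L I q w \<sigma> \<and> (\<forall>l\<in>L. 0 \<le> q l) \<and>
     (\<forall>l\<in>L. q l = 0 \<longrightarrow> Re (qform I \<rho> (w l)) = 0)"

text \<open>This is \<open>ln 2\<close> times the relative entropy of \<open>\<rho>\<close> and \<open>\<sigma>\<close>.\<close>

definition rel_ent where
  "rel_ent I J L p q w \<rho> = (\<Sum>j\<in>J. p j * ln (p j)) - (\<Sum>l\<in>L. Re (qform I \<rho> (w l)) * ln (q l))"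

text \<open>The squared overlaps of a unit vector with a basis sum to one, so each
  \<open>p j\<close> can be spread over \<open>L\<close>. This gives the double sum with common
  weights that the scalar comparison handles; the support clause passes to single pairs by
  nonnegativity.\<close>

lemma rel_ent_eq:
  assumes "spectral_pair I J L p v q w \<rho> \<sigma>" "finite I"
  shows "rel_ent I J L p q w \<rho>
      = (\<Sum>j\<in>J. \<Sum>l\<in>L. (cmod (inner_on I (w l) (v j)))\<^sup>2 * p j * (ln (p j) - ln (q l)))"
    and "(\<Sum>j\<in>J. p j) = (\<Sum>j\<in>J. \<Sum>l\<in>L. (cmod (inner_on I (w l) (v j)))\<^sup>2 * p j)"
    and "j \<in> J \<Longrightarrow> l \<in> L \<Longrightarrow> finite J \<Longrightarrow> q l = 0 \<Longrightarrow> (cmod (inner_on I (w l) (v j)))\<^sup>2 * p j = 0"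
proof -
  have v: "onb J I v" "eigen_expansion J I p v \<rho>" "\<forall>j\<in>J. 0 \<le> p j" and w: "onb L I w"
    and supp: "\<forall>l\<in>L. q l = 0 \<longrightarrow> Re (qform I \<rho> (w l)) = 0"
    using assms(1) by (auto simp: spectral_pair_def)
  have sym: "cmod (inner_on I (v j) (w l)) = cmod (inner_on I (w l) (v j))" for j l
    using cnj_inner_on[of I "w l" "v j"] by (metis complex_mod_cnj)
  have one: "(\<Sum>l\<in>L. (cmod (inner_on I (w l) (v j)))\<^sup>2) = 1" if "j \<in> J" for j
  proof -
    have "complex_of_real (\<Sum>x\<in>I. (cmod (v j x))\<^sup>2) = 1"
      using v(1) that unfolding inner_on_self[symmetric] by (simp add: onb_def)
    then have "(\<Sum>x\<in>I. (cmod (v j x))\<^sup>2) = 1" using of_real_eq_1_iff by blast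
    then show ?thesis using onb_parseval_norm[OF w assms(2), of "v j"] by simp
  qed
  have q: "Re (qform I \<rho> (w l)) = (\<Sum>j\<in>J. (cmod (inner_on I (w l) (v j)))\<^sup>2 * p j)" for l
    unfolding qform_eigen[OF v(2)] sym by (simp add: mult.commute)
  show "(\<Sum>j\<in>J. p j) = (\<Sum>j\<in>J. \<Sum>l\<in>L. (cmod (inner_on I (w l) (v j)))\<^sup>2 * p j)"
    by (simp add: sum_distrib_right[symmetric] one)
  have "(\<Sum>l\<in>L. Re (qform I \<rho> (w l)) * ln (q l))
      = (\<Sum>j\<in>J. \<Sum>l\<in>L. (cmod (inner_on I (w l) (v j)))\<^sup>2 * p j * ln (q l))"
    unfolding q sum_distrib_right by (rule sum.swap)
  moreover have "(\<Sum>j\<in>J. p j * ln (p j))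
      = (\<Sum>j\<in>J. \<Sum>l\<in>L. (cmod (inner_on I (w l) (v j)))\<^sup>2 * p j * ln (p j))"
    by (simp add: sum_distrib_right[symmetric] one)
  ultimately show "rel_ent I J L p q w \<rho>
      = (\<Sum>j\<in>J. \<Sum>l\<in>L. (cmod (inner_on I (w l) (v j)))\<^sup>2 * p j * (ln (p j) - ln (q l)))"
    by (simp add: rel_ent_def right_diff_distrib sum_subtractf)
  assume jl: "j \<in> J" "l \<in> L" "finite J" "q l = 0"
  then have "(\<Sum>j\<in>J. (cmod (inner_on I (w l) (v j)))\<^sup>2 * p j) = 0"
    using supp by (simp add: q[symmetric])
  then show "(cmod (inner_on I (w l) (v j)))\<^sup>2 * p j = 0"
    using jl v(3) by (subst (asm) sum_nonneg_eq_0_iff) auto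
qed

lemma sum_Times3: "sum f (A \<times> B \<times> C) = (\<Sum>x\<in>A. \<Sum>y\<in>B. \<Sum>z\<in>C. f (x, y, z))"
  by (simp add: sum.cartesian_product split_def)

text \<open>The labels in \<open>K\<close> and \<open>K'\<close> are the blocks of block-diagonal
  operators, so a measurement outcome is treated as a classical label. With \<open>Y'\<close> the
  maximiser on the target, \<open>var\<close> supplies a trial operator on the source with at least
  the same value, and that value cannot exceed the maximum on the source.\<close>

lemma rel_ent_mono:
  assumes fin: "finite K" "finite I" "finite J" "finite L" "finite K'" "finite I'" "finite J'" "finite L'"
    and src: "\<And>k. k \<in> K \<Longrightarrow> spectral_pair I J L (p k) (v k) (q k) (w k) (\<rho> k) (\<sigma> k)"
    and tgt: "\<And>k. k \<in> K' \<Longrightarrow> spectral_pair I' J' L' (p' k) (v' k) (q' k) (w' k) (\<rho>' k) (\<sigma>' k)"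
    and total: "(\<Sum>k\<in>K. \<Sum>j\<in>J. p k j) = (\<Sum>k\<in>K'. \<Sum>j\<in>J'. p' k j)"
    and var: "\<And>s Y'. 0 < s \<Longrightarrow> \<exists>Y. (\<Sum>k\<in>K'. varfun I' s (\<rho>' k) (\<sigma>' k) (Y' k)) \<le> (\<Sum>k\<in>K. varfun I s (\<rho> k) (\<sigma> k) (Y k))"
  shows "(\<Sum>k\<in>K'. rel_ent I' J' L' (p' k) (q' k) (w' k) (\<rho>' k)) \<le> (\<Sum>k\<in>K. rel_ent I J L (p k) (q k) (w k) (\<rho> k))"
proof -
  define a where "a = (\<lambda>(k, j, l). (cmod (inner_on I (w k l) (v k j)))\<^sup>2)"
  define b where "b = (\<lambda>(k, j, l). (cmod (inner_on I' (w' k l) (v' k j)))\<^sup>2)"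
  let ?P = "K \<times> J \<times> L" and ?Q = "K' \<times> J' \<times> L'"
  let ?p = "\<lambda>(k, j, l). p k j" and ?q = "\<lambda>(k, j, l). q k l"
  let ?p' = "\<lambda>(k, j, l). p' k j" and ?q' = "\<lambda>(k, j, l). q' k l"
  have "(\<Sum>i\<in>?Q. b i * ?p' i * (ln (?p' i) - ln (?q' i))) \<le> (\<Sum>i\<in>?P. a i * ?p i * (ln (?p i) - ln (?q i)))"
  proof (rule relative_log_sum_mono)
    show "(\<Sum>i\<in>?P. a i * ?p i) = (\<Sum>i\<in>?Q. b i * ?p' i)"
      using total rel_ent_eq(2)[OF src fin(2)] rel_ent_eq(2)[OF tgt fin(6)]
      by (simp add: a_def b_def sum_Times3 cong: sum.cong)
  next
    fix s :: real assume s: "0 < s"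
    have "\<exists>Y. varfun I' s (\<rho>' k) (\<sigma>' k) Y
        = (\<Sum>j\<in>J'. \<Sum>l\<in>L'. (cmod (inner_on I' (w' k l) (v' k j)))\<^sup>2 * (p' k j)\<^sup>2 / (q' k l + s * p' k j))" if "k \<in> K'" for k
      using tgt[OF that] fin s unfolding spectral_pair_def by (intro varfun_attained) auto
    then have "\<exists>Y'. \<forall>k\<in>K'. varfun I' s (\<rho>' k) (\<sigma>' k) (Y' k)
        = (\<Sum>j\<in>J'. \<Sum>l\<in>L'. (cmod (inner_on I' (w' k l) (v' k j)))\<^sup>2 * (p' k j)\<^sup>2 / (q' k l + s * p' k j))"
      by (intro bchoice ballI)
    then obtain Y' where Y': "\<And>k. k \<in> K' \<Longrightarrow> varfun I' s (\<rho>' k) (\<sigma>' k) (Y' k)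
        = (\<Sum>j\<in>J'. \<Sum>l\<in>L'. (cmod (inner_on I' (w' k l) (v' k j)))\<^sup>2 * (p' k j)\<^sup>2 / (q' k l + s * p' k j))"
      by blast
    obtain Y where Y: "(\<Sum>k\<in>K'. varfun I' s (\<rho>' k) (\<sigma>' k) (Y' k)) \<le> (\<Sum>k\<in>K. varfun I s (\<rho> k) (\<sigma> k) (Y k))"
      using var[OF s] by blast
    have "varfun I s (\<rho> k) (\<sigma> k) (Y k)
        \<le> (\<Sum>j\<in>J. \<Sum>l\<in>L. (cmod (inner_on I (w k l) (v k j)))\<^sup>2 * (p k j)\<^sup>2 / (q k l + s * p k j))" if "k \<in> K" for k
      using src[OF that] fin s unfolding spectral_pair_def by (intro varfun_le) auto
    then have up: "(\<Sum>k\<in>K. varfun I s (\<rho> k) (\<sigma> k) (Y k))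
        \<le> (\<Sum>k\<in>K. \<Sum>j\<in>J. \<Sum>l\<in>L. (cmod (inner_on I (w k l) (v k j)))\<^sup>2 * (p k j)\<^sup>2 / (q k l + s * p k j))"
      by (rule sum_mono)
    have "(\<Sum>k\<in>K'. \<Sum>j\<in>J'. \<Sum>l\<in>L'. (cmod (inner_on I' (w' k l) (v' k j)))\<^sup>2 * (p' k j)\<^sup>2 / (q' k l + s * p' k j))
      \<le> (\<Sum>k\<in>K. \<Sum>j\<in>J. \<Sum>l\<in>L. (cmod (inner_on I (w k l) (v k j)))\<^sup>2 * (p k j)\<^sup>2 / (q k l + s * p k j))"
      using order_trans[OF Y up] by (simp add: Y')
    then show "(\<Sum>i\<in>?Q. b i * (?p' i)\<^sup>2 / (?q' i + s * ?p' i)) \<le> (\<Sum>i\<in>?P. a i * (?p i)\<^sup>2 / (?q i + s * ?p i))"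
      by (simp add: a_def b_def sum_Times3)
  next
    fix i assume "i \<in> ?P" "?q i = 0"
    then show "a i * ?p i = 0"
      by (cases i) (auto simp: a_def simp del: mult_eq_0_iff intro!: rel_ent_eq(3)[OF src fin(2) _ _ fin(3)])
  next
    fix i assume "i \<in> ?Q" "?q' i = 0"
    then show "b i * ?p' i = 0"
      by (cases i) (auto simp: b_def simp del: mult_eq_0_iff intro!: rel_ent_eq(3)[OF tgt fin(6) _ _ fin(7)])
  qed (use fin src tgt in \<open>auto simp: spectral_pair_def\<close>)
  then show ?thesis
    using rel_ent_eq(1)[OF src fin(2)] rel_ent_eq(1)[OF tgt fin(6)]
    by (simp add: a_def b_def sum_Times3 cong: sum.cong)
qed

section \<open>Partial traces\<close>

lemma vn_entropy_psd:
  assumes "finite I" "psd_on I X"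
  obtains p v where "onb {..<card I} I v" "eigen_expansion {..<card I} I p v X"
    "\<forall>j<card I. 0 \<le> p j"
    "ln 2 * vn_entropy I X = - (\<Sum>j<card I. p j * ln (p j))"
proof -
  have "hermitian_on I X" using assms(2) by (simp add: psd_on_def)
  then obtain p v where pv: "onb {..<card I} I v" "eigen_expansion {..<card I} I p v X"
      "vn_entropy I X = - (\<Sum>j<card I. p j * log 2 (p j))"
    by (rule vn_entropy_obtain[OF assms(1)])
  show thesis
  proof (rule that[OF pv(1,2)])
    show "\<forall>j<card I. 0 \<le> p j"
      using eigen_expansion_psd[OF pv(1,2) _ assms(2)] by simp
    show "ln 2 * vn_entropy I X = - (\<Sum>j<card I. p j * ln (p j))"
      by (simp add: pv(3) log_def sum_distrib_left)
  qed
qed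

lemma vn_entropy_choice:
  assumes "finite I" "\<And>k. k \<in> K \<Longrightarrow> psd_on I (X k)"
  obtains p v where "\<And>k. k \<in> K \<Longrightarrow> onb {..<card I} I (v k)"
    "\<And>k. k \<in> K \<Longrightarrow> eigen_expansion {..<card I} I (p k) (v k) (X k)"
    "\<And>k j. k \<in> K \<Longrightarrow> j < card I \<Longrightarrow> 0 \<le> p k j"
    "\<And>k. k \<in> K \<Longrightarrow> ln 2 * vn_entropy I (X k) = - (\<Sum>j<card I. p k j * ln (p k j))"
proof -
  define P where "P = (\<lambda>k pv. onb {..<card I} I (snd pv) \<and> eigen_expansion {..<card I} I (fst pv) (snd pv) (X k) \<and>
      (\<forall>j<card I. 0 \<le> fst pv j) \<and> ln 2 * vn_entropy I (X k) = - (\<Sum>j<card I. fst pv j * ln (fst pv j)))"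
  have "\<exists>pv. P k pv" if k: "k \<in> K" for k
  proof -
    obtain p v where "onb {..<card I} I v" "eigen_expansion {..<card I} I p v (X k)"
      "\<forall>j<card I. 0 \<le> p j"
      "ln 2 * vn_entropy I (X k) = - (\<Sum>j<card I. p j * ln (p j))"
      by (rule vn_entropy_psd[OF assms(1) assms(2)[OF k]])
    then have "P k (p, v)" by (simp add: P_def)
    then show ?thesis by blast
  qed
  then obtain pv where "\<And>k. k \<in> K \<Longrightarrow> P k (pv k)" by metis
  then show thesis
    by (intro that[of "\<lambda>k. snd (pv k)" "\<lambda>k. fst (pv k)"]) (auto simp: P_def)
qed

lemma trace_eigen:
  assumes "onb J I v" "eigen_expansion J I p v X" "finite I"
  shows "(\<Sum>x\<in>I. X x x) = complex_of_real (\<Sum>j\<in>J. p j)"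
proof -
  have "(\<Sum>x\<in>I. X x x) = (\<Sum>x\<in>I. \<Sum>j\<in>J. complex_of_real (p j) * (cnj (v j x) * v j x))"
    using assms by (intro sum.cong refl) (simp add: eigen_expansion_def mult_ac)
  also have "\<dots> = (\<Sum>j\<in>J. complex_of_real (p j) * inner_on I (v j) (v j))"
    by (subst sum.swap) (simp add: inner_on_def sum_distrib_left)
  also have "\<dots> = (\<Sum>j\<in>J. complex_of_real (p j))"
    using assms by (intro sum.cong) (simp_all add: onb_def)
  finally show ?thesis by simp
qed

section \<open>Quadratic forms and trial operators on product index sets\<close>

lemma qform_reindex:
  assumes "finite I" "inj_on f A" "f ` A \<subseteq> I" "\<And>x. x \<in> I \<Longrightarrow> x \<notin> f ` A \<Longrightarrow> u x = 0"
  shows "qform I X u = qform A (\<lambda>a b. X (f a) (f b)) (\<lambda>a. u (f a))"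
proof -
  have "qform I X u = (\<Sum>x\<in>f ` A. \<Sum>y\<in>I. cnj (u x) * X x y * u y)"
    unfolding qform_def using assms by (intro sum.mono_neutral_right) auto
  also have "\<dots> = (\<Sum>x\<in>f ` A. \<Sum>y\<in>f ` A. cnj (u x) * X x y * u y)"
    using assms by (intro sum.cong sum.mono_neutral_right) auto
  also have "\<dots> = qform A (\<lambda>a b. X (f a) (f b)) (\<lambda>a. u (f a))"
    unfolding qform_def using assms(2) by (simp add: sum.reindex)
  finally show ?thesis .
qed

lemma qform_slice_left:
  assumes "finite A" "finite B" "a \<in> A"
  shows "qform (A \<times> B) X (\<lambda>z. of_bool (fst z = a) * u (snd z)) = qform B (\<lambda>b b'. X (a, b) (a, b')) u"
proof -
  have "qform (A \<times> B) X (\<lambda>z. of_bool (fst z = a) * u (snd z))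
      = qform B (\<lambda>b b'. X (a, b) (a, b')) (\<lambda>b. of_bool (fst (a, b) = a) * u (snd (a, b)))"
    by (rule qform_reindex) (use assms in \<open>auto simp: inj_on_def\<close>)
  then show ?thesis by simp
qed

lemma qform_slice_right:
  assumes "finite A" "finite B" "b \<in> B"
  shows "qform (A \<times> B) X (\<lambda>z. of_bool (snd z = b) * u (fst z)) = qform A (\<lambda>a a'. X (a, b) (a', b)) u"
proof -
  have "qform (A \<times> B) X (\<lambda>z. of_bool (snd z = b) * u (fst z))
      = qform A (\<lambda>a a'. X (a, b) (a', b)) (\<lambda>a. of_bool (snd (a, b) = b) * u (fst (a, b)))"
    by (rule qform_reindex) (use assms in \<open>auto simp: inj_on_def\<close>)
  then show ?thesis by simp
qed

lemma qform_tensor: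
  "qform (A \<times> B) X (\<lambda>z. u (fst z) * w (snd z))
     = qform B (\<lambda>b b'. \<Sum>a\<in>A. \<Sum>a'\<in>A. cnj (u a) * X (a, b) (a', b') * u a') w"
proof -
  have "qform (A \<times> B) X (\<lambda>z. u (fst z) * w (snd z))
      = (\<Sum>a\<in>A. \<Sum>b\<in>B. \<Sum>a'\<in>A. \<Sum>b'\<in>B. cnj (w b) * (cnj (u a) * X (a, b) (a', b') * u a') * w b')"
    by (simp add: qform_def sum.cartesian_product' mult_ac)
  also have "\<dots> = (\<Sum>a\<in>A. \<Sum>b\<in>B. \<Sum>b'\<in>B. \<Sum>a'\<in>A. cnj (w b) * (cnj (u a) * X (a, b) (a', b') * u a') * w b')"
    by (intro sum.cong refl sum.swap)
  also have "\<dots> = (\<Sum>b\<in>B. \<Sum>b'\<in>B. \<Sum>a\<in>A. \<Sum>a'\<in>A. cnj (w b) * (cnj (u a) * X (a, b) (a', b') * u a') * w b')"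
    by (rule sum_rotate[symmetric])
  finally show ?thesis by (simp add: qform_def sum_distrib_left sum_distrib_right)
qed

lemma sum_of_bool_mult:
  fixes f :: "'a \<Rightarrow> complex"
  assumes "finite A" "a \<in> A"
  shows "(\<Sum>x\<in>A. of_bool (a = x) * f x) = f a" "(\<Sum>x\<in>A. of_bool (x = a) * f x) = f a"
proof -
  have "(\<Sum>x\<in>A. of_bool (a = x) * f x) = (\<Sum>x\<in>A. if a = x then f x else 0)"
    by (intro sum.cong) auto
  then show "(\<Sum>x\<in>A. of_bool (a = x) * f x) = f a" using assms by simp
  have "(\<Sum>x\<in>A. of_bool (x = a) * f x) = (\<Sum>x\<in>A. if a = x then f x else 0)"
    by (intro sum.cong) auto
  then show "(\<Sum>x\<in>A. of_bool (x = a) * f x) = f a" using assms by simp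
qed

text \<open>Block-diagonal trial operators see only the diagonal blocks of both states; this is the
  dual description of measuring the first factor in the computational basis.\<close>

lemma varfun_block:
  assumes "finite A" "finite B"
  shows "varfun (A \<times> B) s \<rho> \<sigma> (\<lambda>x y. of_bool (fst x = fst y) * Y (fst y) (snd x) (snd y))
     = (\<Sum>a\<in>A. varfun B s (\<lambda>b b'. \<rho> (a, b) (a, b')) (\<lambda>b b'. \<sigma> (a, b) (a, b')) (Y a))"
proof -
  let ?Y = "\<lambda>x y. of_bool (fst x = fst y) * Y (fst y) (snd x) (snd y)"
  have "(\<Sum>x\<in>A\<times>B. \<Sum>y\<in>A\<times>B. cnj (?Y x y) * \<rho> x y)
      = (\<Sum>a\<in>A. \<Sum>b\<in>B. \<Sum>a'\<in>A. of_bool (a = a') * (\<Sum>b'\<in>B. cnj (Y a' b b') * \<rho> (a, b) (a', b')))"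
    by (simp add: sum.cartesian_product' sum_distrib_left mult.assoc)
  then have T1: "(\<Sum>x\<in>A\<times>B. \<Sum>y\<in>A\<times>B. cnj (?Y x y) * \<rho> x y)
      = (\<Sum>a\<in>A. \<Sum>b\<in>B. \<Sum>b'\<in>B. cnj (Y a b b') * \<rho> (a, b) (a, b'))"
    using assms by (simp add: sum_of_bool_mult)
  have "(\<Sum>z\<in>A\<times>B. qform (A \<times> B) \<sigma> (\<lambda>x. ?Y x z))
      = (\<Sum>a\<in>A. \<Sum>b\<in>B. qform (A \<times> B) \<sigma> (\<lambda>x. of_bool (fst x = a) * Y a (snd x) b))"
    by (simp add: sum.cartesian_product')
  also have "\<dots> = (\<Sum>a\<in>A. \<Sum>b\<in>B. qform B (\<lambda>b b'. \<sigma> (a, b) (a, b')) (\<lambda>b'. Y a b' b))"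
    by (intro sum.cong refl qform_slice_left assms)
  finally have T2: "(\<Sum>z\<in>A\<times>B. qform (A \<times> B) \<sigma> (\<lambda>x. ?Y x z))
      = (\<Sum>a\<in>A. \<Sum>b\<in>B. qform B (\<lambda>b b'. \<sigma> (a, b) (a, b')) (\<lambda>b'. Y a b' b))" .
  have "(\<Sum>x\<in>A\<times>B. qform (A \<times> B) \<rho> (\<lambda>y. cnj (?Y x y)))
      = (\<Sum>a\<in>A. \<Sum>b\<in>B. qform (A \<times> B) \<rho> (\<lambda>y. of_bool (fst y = a) * cnj (Y a b (snd y))))"
    unfolding sum.cartesian_product'
    by (intro sum.cong refl arg_cong[where f = "qform (_ \<times> _) \<rho>"] ext) auto
  also have "\<dots> = (\<Sum>a\<in>A. \<Sum>b\<in>B. qform B (\<lambda>b b'. \<rho> (a, b) (a, b')) (\<lambda>b'. cnj (Y a b b')))"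
    by (intro sum.cong refl qform_slice_left assms)
  finally have T3: "(\<Sum>x\<in>A\<times>B. qform (A \<times> B) \<rho> (\<lambda>y. cnj (?Y x y)))
      = (\<Sum>a\<in>A. \<Sum>b\<in>B. qform B (\<lambda>b b'. \<rho> (a, b) (a, b')) (\<lambda>b'. cnj (Y a b b')))" .
  show ?thesis
    unfolding varfun_def T1 T2 T3 Re_sum by (simp add: sum_subtractf sum_distrib_left)
qed

text \<open>The trial operator is \<open>Y\<close> tensored with the identity on \<open>R\<close>,
  the adjoint of the partial trace. This embedding respects products, so all three terms reduce
  exactly, with no inequality.\<close>

lemma varfun_ampliation:
  assumes "finite C" "finite R"
  shows "varfun (C \<times> R) s \<rho> \<sigma> (\<lambda>x y. of_bool (snd x = snd y) * Y (fst x) (fst y))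
     = varfun C s (\<lambda>c c'. \<Sum>r\<in>R. \<rho> (c, r) (c', r)) (\<lambda>c c'. \<Sum>r\<in>R. \<sigma> (c, r) (c', r)) Y"
proof -
  let ?Y = "\<lambda>x y. of_bool (snd x = snd y) * Y (fst x) (fst y)"
  have "(\<Sum>x\<in>C\<times>R. \<Sum>y\<in>C\<times>R. cnj (?Y x y) * \<rho> x y)
      = (\<Sum>c\<in>C. \<Sum>r\<in>R. \<Sum>c'\<in>C. \<Sum>r'\<in>R. of_bool (r = r') * (cnj (Y c c') * \<rho> (c, r) (c', r')))"
    by (simp add: sum.cartesian_product' mult.assoc)
  also have "\<dots> = (\<Sum>c\<in>C. \<Sum>r\<in>R. \<Sum>c'\<in>C. cnj (Y c c') * \<rho> (c, r) (c', r))"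
    using assms by (simp add: sum_of_bool_mult)
  also have "\<dots> = (\<Sum>c\<in>C. \<Sum>c'\<in>C. \<Sum>r\<in>R. cnj (Y c c') * \<rho> (c, r) (c', r))"
    by (intro sum.cong refl sum.swap)
  finally have T1: "(\<Sum>x\<in>C\<times>R. \<Sum>y\<in>C\<times>R. cnj (?Y x y) * \<rho> x y)
      = (\<Sum>c\<in>C. \<Sum>c'\<in>C. cnj (Y c c') * (\<Sum>r\<in>R. \<rho> (c, r) (c', r)))"
    by (simp add: sum_distrib_left)
  have "(\<Sum>z\<in>C\<times>R. qform (C \<times> R) \<sigma> (\<lambda>x. ?Y x z))
      = (\<Sum>c\<in>C. \<Sum>r\<in>R. qform (C \<times> R) \<sigma> (\<lambda>x. of_bool (snd x = r) * Y (fst x) c))"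
    by (simp add: sum.cartesian_product')
  also have "\<dots> = (\<Sum>c\<in>C. \<Sum>r\<in>R. qform C (\<lambda>c c'. \<sigma> (c, r) (c', r)) (\<lambda>c'. Y c' c))"
    by (intro sum.cong refl qform_slice_right assms)
  finally have T2: "(\<Sum>z\<in>C\<times>R. qform (C \<times> R) \<sigma> (\<lambda>x. ?Y x z))
      = (\<Sum>c\<in>C. qform C (\<lambda>c c'. \<Sum>r\<in>R. \<sigma> (c, r) (c', r)) (\<lambda>c'. Y c' c))"
    unfolding qform_sum .
  have "(\<Sum>x\<in>C\<times>R. qform (C \<times> R) \<rho> (\<lambda>y. cnj (?Y x y)))
      = (\<Sum>c\<in>C. \<Sum>r\<in>R. qform (C \<times> R) \<rho> (\<lambda>y. of_bool (snd y = r) * cnj (Y c (fst y))))"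
    unfolding sum.cartesian_product'
    by (intro sum.cong refl arg_cong[where f = "qform (_ \<times> _) \<rho>"] ext) auto
  also have "\<dots> = (\<Sum>c\<in>C. \<Sum>r\<in>R. qform C (\<lambda>c c'. \<rho> (c, r) (c', r)) (\<lambda>c'. cnj (Y c c')))"
    by (intro sum.cong refl qform_slice_right assms)
  finally have T3: "(\<Sum>x\<in>C\<times>R. qform (C \<times> R) \<rho> (\<lambda>y. cnj (?Y x y)))
      = (\<Sum>c\<in>C. qform C (\<lambda>c c'. \<Sum>r\<in>R. \<rho> (c, r) (c', r)) (\<lambda>c'. cnj (Y c c')))"
    unfolding qform_sum .
  show ?thesis unfolding varfun_def T1 T2 T3 ..
qed

lemma psd_on_partial_trace:
  assumes "finite C" "finite R" "psd_on (C \<times> R) X"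
  shows "psd_on C (\<lambda>c c'. \<Sum>r\<in>R. X (c, r) (c', r))"
proof (rule psd_on_sum)
  fix r assume r: "r \<in> R"
  have "X (c', r) (c, r) = cnj (X (c, r) (c', r))" if "c \<in> C" "c' \<in> C" for c c'
    using assms(3) r that unfolding psd_on_def hermitian_on_def by blast
  moreover have "0 \<le> Re (qform C (\<lambda>c c'. X (c, r) (c', r)) u)" for u
    using assms(3) unfolding psd_on_def qform_slice_right[OF assms(1,2) r, symmetric] by blast
  ultimately show "psd_on C (\<lambda>c c'. X (c, r) (c', r))"
    unfolding psd_on_def hermitian_on_def by blast
qed

lemma psd_on_compress:
  assumes "psd_on (A \<times> B) X"
  shows "psd_on B (\<lambda>b b'. \<Sum>a\<in>A. \<Sum>a'\<in>A. cnj (u a) * X (a, b) (a', b') * u a')"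
proof -
  have "(\<Sum>a\<in>A. \<Sum>a'\<in>A. cnj (u a) * X (a, b') (a', b) * u a')
      = cnj (\<Sum>a\<in>A. \<Sum>a'\<in>A. cnj (u a) * X (a, b) (a', b') * u a')" if "b \<in> B" "b' \<in> B" for b b'
  proof -
    have "cnj (\<Sum>a\<in>A. \<Sum>a'\<in>A. cnj (u a) * X (a, b) (a', b') * u a')
        = (\<Sum>a'\<in>A. \<Sum>a\<in>A. cnj (cnj (u a) * X (a, b) (a', b') * u a'))"
      unfolding cnj_sum by (rule sum.swap)
    also have "\<dots> = (\<Sum>a'\<in>A. \<Sum>a\<in>A. cnj (u a') * X (a', b') (a, b) * u a)"
    proof (intro sum.cong refl)
      fix a a' assume "a \<in> A" "a' \<in> A"
      then have "X (a', b') (a, b) = cnj (X (a, b) (a', b'))"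
        using assms that unfolding psd_on_def hermitian_on_def by blast
      then show "cnj (cnj (u a) * X (a, b) (a', b') * u a') = cnj (u a') * X (a', b') (a, b) * u a"
        by simp
    qed
    finally show ?thesis ..
  qed
  moreover have "0 \<le> Re (qform B (\<lambda>b b'. \<Sum>a\<in>A. \<Sum>a'\<in>A. cnj (u a) * X (a, b) (a', b') * u a') w)" for w
    using assms unfolding psd_on_def qform_tensor[symmetric] by blast
  ultimately show ?thesis unfolding psd_on_def hermitian_on_def by blast
qed

text \<open>The \<open>X k\<close> act as unnormalised conditional states of a classical register
  \<open>K\<close>. Each is dominated by their sum, which settles the support clause, and the
  relative entropies to the sum add up to minus the conditional entropy of the register.\<close>

lemma spectral_pairs_of_sum:
  assumes K: "finite K" and I: "finite I" and X: "\<And>k. k \<in> K \<Longrightarrow> psd_on I (X k)"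
  obtains p v q w where
    "\<And>k. k \<in> K \<Longrightarrow> spectral_pair I {..<card I} {..<card I} (p k) (v k) q w (X k) (\<lambda>x y. \<Sum>k\<in>K. X k x y)"
    "(\<Sum>k\<in>K. rel_ent I {..<card I} {..<card I} (p k) q w (X k))
        = ln 2 * (vn_entropy I (\<lambda>x y. \<Sum>k\<in>K. X k x y) - (\<Sum>k\<in>K. vn_entropy I (X k)))"
    "\<And>k. k \<in> K \<Longrightarrow> (\<Sum>x\<in>I. X k x x) = complex_of_real (\<Sum>j<card I. p k j)"
proof -
  let ?\<sigma> = "\<lambda>x y. \<Sum>k\<in>K. X k x y" and ?n = "card I"
  obtain p v where v: "\<And>k. k \<in> K \<Longrightarrow> onb {..<?n} I (v k)"
      "\<And>k. k \<in> K \<Longrightarrow> eigen_expansion {..<?n} I (p k) (v k) (X k)"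
      "\<And>k j. k \<in> K \<Longrightarrow> j < ?n \<Longrightarrow> 0 \<le> p k j"
      "\<And>k. k \<in> K \<Longrightarrow> ln 2 * vn_entropy I (X k) = - (\<Sum>j<?n. p k j * ln (p k j))"
    by (rule vn_entropy_choice[OF I X]) (assumption, rule that, blast+)
  obtain q w where w: "onb {..<?n} I w" "eigen_expansion {..<?n} I q w ?\<sigma>"
      "\<forall>j<?n. 0 \<le> q j" "ln 2 * vn_entropy I ?\<sigma> = - (\<Sum>j<?n. q j * ln (q j))"
    by (rule vn_entropy_psd[OF I psd_on_sum[OF X]])
  have qs: "(\<Sum>k\<in>K. Re (qform I (X k) (w l))) = q l" if "l < ?n" for l
    unfolding Re_sum[symmetric] qform_sum[symmetric] using qform_eigenvector[OF w(1,2), of l] that by simp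
  have nn: "0 \<le> Re (qform I (X k) u)" if "k \<in> K" for k u
    using X[OF that] by (simp add: psd_on_def)
  have "Re (qform I (X k) (w l)) = 0" if "k \<in> K" "l < ?n" "q l = 0" for k l
    using qs[OF that(2)] that nn K by (simp add: sum_nonneg_eq_0_iff)
  then have "spectral_pair I {..<?n} {..<?n} (p k) (v k) q w (X k) ?\<sigma>" if "k \<in> K" for k
    using that v w by (simp add: spectral_pair_def)
  moreover have "(\<Sum>k\<in>K. rel_ent I {..<?n} {..<?n} (p k) q w (X k))
      = ln 2 * (vn_entropy I ?\<sigma> - (\<Sum>k\<in>K. vn_entropy I (X k)))"
  proof -
    have "(\<Sum>k\<in>K. \<Sum>l<?n. Re (qform I (X k) (w l)) * ln (q l)) = (\<Sum>l<?n. (\<Sum>k\<in>K. Re (qform I (X k) (w l))) * ln (q l))"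
      by (subst sum.swap) (simp add: sum_distrib_right)
    also have "\<dots> = (\<Sum>l<?n. q l * ln (q l))" using qs by (intro sum.cong) auto
    also have "\<dots> = - (ln 2 * vn_entropy I ?\<sigma>)" by (simp add: w(4))
    finally have 1: "(\<Sum>k\<in>K. \<Sum>l<?n. Re (qform I (X k) (w l)) * ln (q l)) = - (ln 2 * vn_entropy I ?\<sigma>)" .
    have 2: "(\<Sum>k\<in>K. \<Sum>j<?n. p k j * ln (p k j)) = - (ln 2 * (\<Sum>k\<in>K. vn_entropy I (X k)))"
      by (simp add: sum_distrib_left v(4) sum_negf)
    show ?thesis unfolding rel_ent_def sum_subtractf 1 2 by (simp add: algebra_simps)
  qed
  moreover have "(\<Sum>x\<in>I. X k x x) = complex_of_real (\<Sum>j<?n. p k j)" if "k \<in> K" for k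
    by (rule trace_eigen[OF v(1,2)[OF that] I])
  ultimately show thesis by (rule that)
qed

text \<open>Both sides are conditional entropies of a classical register \<open>K\<close>, given
  \<open>C \<times> R\<close> and given \<open>C\<close>: strong subadditivity with one classical
  system. The trial operators for \<open>C\<close> are tensored with the identity on
  \<open>R\<close>.\<close>

theorem conditional_entropy_partial_trace:
  assumes fin: "finite K" "finite C" "finite R"
    and psd: "\<And>k. k \<in> K \<Longrightarrow> psd_on (C \<times> R) (\<tau> k)"
  shows "(\<Sum>k\<in>K. vn_entropy (C \<times> R) (\<tau> k)) - vn_entropy (C \<times> R) (\<lambda>x y. \<Sum>k\<in>K. \<tau> k x y)
     \<le> (\<Sum>k\<in>K. vn_entropy C (\<lambda>c c'. \<Sum>r\<in>R. \<tau> k (c, r) (c', r)))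
       - vn_entropy C (\<lambda>c c'. \<Sum>k\<in>K. \<Sum>r\<in>R. \<tau> k (c, r) (c', r))"
proof -
  let ?I = "C \<times> R" and ?\<tau>C = "\<lambda>k c c'. \<Sum>r\<in>R. \<tau> k (c, r) (c', r)"
  have psdC: "\<And>k. k \<in> K \<Longrightarrow> psd_on C (?\<tau>C k)"
    using psd fin by (intro psd_on_partial_trace) auto
  obtain p v q w where s: "\<And>k. k \<in> K \<Longrightarrow> spectral_pair ?I {..<card ?I} {..<card ?I} (p k) (v k) q w (\<tau> k) (\<lambda>x y. \<Sum>k\<in>K. \<tau> k x y)"
      "(\<Sum>k\<in>K. rel_ent ?I {..<card ?I} {..<card ?I} (p k) q w (\<tau> k))
        = ln 2 * (vn_entropy ?I (\<lambda>x y. \<Sum>k\<in>K. \<tau> k x y) - (\<Sum>k\<in>K. vn_entropy ?I (\<tau> k)))"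
      "\<And>k. k \<in> K \<Longrightarrow> (\<Sum>x\<in>?I. \<tau> k x x) = complex_of_real (\<Sum>j<card ?I. p k j)"
    by (rule spectral_pairs_of_sum[OF fin(1) finite_cartesian_product[OF fin(2,3)] psd]) (assumption, rule that, blast+)
  obtain p' v' q' w' where t: "\<And>k. k \<in> K \<Longrightarrow> spectral_pair C {..<card C} {..<card C} (p' k) (v' k) q' w' (?\<tau>C k) (\<lambda>x y. \<Sum>k\<in>K. ?\<tau>C k x y)"
      "(\<Sum>k\<in>K. rel_ent C {..<card C} {..<card C} (p' k) q' w' (?\<tau>C k))
        = ln 2 * (vn_entropy C (\<lambda>x y. \<Sum>k\<in>K. ?\<tau>C k x y) - (\<Sum>k\<in>K. vn_entropy C (?\<tau>C k)))"
      "\<And>k. k \<in> K \<Longrightarrow> (\<Sum>x\<in>C. ?\<tau>C k x x) = complex_of_real (\<Sum>j<card C. p' k j)"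
    by (rule spectral_pairs_of_sum[OF fin(1,2) psdC]) (assumption, rule that, blast+)
  have swap: "(\<lambda>c c'. \<Sum>r\<in>R. \<Sum>k\<in>K. \<tau> k (c, r) (c', r)) = (\<lambda>c c'. \<Sum>k\<in>K. ?\<tau>C k c c')"
    by (intro ext) (rule sum.swap)
  have "(\<Sum>k\<in>K. rel_ent C {..<card C} {..<card C} (p' k) q' w' (?\<tau>C k))
     \<le> (\<Sum>k\<in>K. rel_ent ?I {..<card ?I} {..<card ?I} (p k) q w (\<tau> k))"
  proof (rule rel_ent_mono)
    have "complex_of_real (\<Sum>j<card ?I. p k j) = complex_of_real (\<Sum>j<card C. p' k j)" if "k \<in> K" for k
      unfolding s(3)[OF that, symmetric] t(3)[OF that, symmetric] by (simp add: sum.cartesian_product')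
    then show "(\<Sum>k\<in>K. \<Sum>j<card ?I. p k j) = (\<Sum>k\<in>K. \<Sum>j<card C. p' k j)"
      unfolding of_real_eq_iff by (rule sum.cong[OF refl])
  next
    fix s :: real and Y' :: "'a \<Rightarrow> 'b \<Rightarrow> 'b \<Rightarrow> complex"
    show "\<exists>Y. (\<Sum>k\<in>K. varfun C s (?\<tau>C k) (\<lambda>x y. \<Sum>k\<in>K. ?\<tau>C k x y) (Y' k))
        \<le> (\<Sum>k\<in>K. varfun ?I s (\<tau> k) (\<lambda>x y. \<Sum>k\<in>K. \<tau> k x y) (Y k))"
      by (intro exI[of _ "\<lambda>k x y. of_bool (snd x = snd y) * Y' k (fst x) (fst y)"])
        (simp only: varfun_ampliation[OF fin(2,3)] swap order_refl)
  qed (use fin s(1) t(1) in auto)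
  then show ?thesis unfolding s(2) t(2) by simp
qed

section \<open>The uncertainty relation with quantum memory\<close>

lemma inner_on_tensor:
  "inner_on (A \<times> B) (\<lambda>z. u (fst z) * v (snd z)) (\<lambda>z. u' (fst z) * v' (snd z)) = inner_on A u u' * inner_on B v v'"
  by (simp add: inner_on_def sum.cartesian_product' sum_product mult_ac)

text \<open>The second basis may depend on \<open>l\<close>: a state measured in the basis
  \<open>U\<close> has its own eigenbasis of the memory for each outcome.\<close>

lemma onb_tensor:
  assumes "onb L A U" "\<And>l. l \<in> L \<Longrightarrow> onb J B (z l)"
  shows "onb (L \<times> J) (A \<times> B) (\<lambda>lj x. U (fst lj) (fst x) * z (fst lj) (snd lj) (snd x))"
  unfolding onb_def
proof (intro conjI ballI)
  fix x y assume "x \<in> L \<times> J" "y \<in> L \<times> J"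
  then have m: "fst x \<in> L" "snd x \<in> J" "fst y \<in> L" "snd y \<in> J" by auto
  then have U: "inner_on A (U (fst x)) (U (fst y)) = of_bool (fst x = fst y)" using assms(1) by (simp add: onb_def)
  show "inner_on (A \<times> B) (\<lambda>w. U (fst x) (fst w) * z (fst x) (snd x) (snd w)) (\<lambda>w. U (fst y) (fst w) * z (fst y) (snd y) (snd w)) = of_bool (x = y)"
    unfolding inner_on_tensor U using assms(2)[OF m(1)] m by (cases "fst x = fst y") (auto simp: onb_def prod_eq_iff)
next
  fix x y assume "x \<in> A \<times> B" "y \<in> A \<times> B"
  then have m: "fst x \<in> A" "snd x \<in> B" "fst y \<in> A" "snd y \<in> B" by auto
  have "(\<Sum>k\<in>L \<times> J. U (fst k) (fst x) * z (fst k) (snd k) (snd x) * cnj (U (fst k) (fst y) * z (fst k) (snd k) (snd y)))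
      = (\<Sum>l\<in>L. U l (fst x) * cnj (U l (fst y)) * (\<Sum>j\<in>J. z l j (snd x) * cnj (z l j (snd y))))"
    by (simp add: sum.cartesian_product' sum_distrib_left mult_ac)
  also have "\<dots> = (\<Sum>l\<in>L. U l (fst x) * cnj (U l (fst y)) * of_bool (snd x = snd y))"
    using assms(2) m by (intro sum.cong) (auto simp: onb_def)
  also have "\<dots> = of_bool (fst x = fst y) * of_bool (snd x = snd y)"
    unfolding sum_distrib_right[symmetric] using assms(1) m by (simp add: onb_def)
  finally show "(\<Sum>k\<in>L \<times> J. U (fst k) (fst x) * z (fst k) (snd k) (snd x) * cnj (U (fst k) (fst y) * z (fst k) (snd k) (snd y))) = of_bool (x = y)"
    by (simp add: prod_eq_iff)
qed

lemma qform_scale: "qform I (\<lambda>x y. c * X x y) u = c * qform I X u"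
  by (simp add: qform_def sum_distrib_left mult_ac)

text \<open>The second state enters only through minus the trace of Y Y* with it, so an operator
  bound passes to the functional at once. This stands in for operator monotonicity of the
  logarithm.\<close>

lemma varfun_antimono:
  assumes "\<And>u. Re (qform I \<sigma> u) \<le> Re (qform I \<sigma>' u)"
  shows "varfun I s \<rho> \<sigma>' Y \<le> varfun I s \<rho> \<sigma> Y"
  unfolding varfun_def Re_sum using sum_mono[of I, OF assms] by simp

lemma ln_mult_nonneg: "0 < c \<Longrightarrow> 0 \<le> r \<Longrightarrow> r * ln (c * r) = r * ln c + r * ln r" for r :: real
  by (cases "r = 0") (simp_all add: ln_mult algebra_simps)

text \<open>The basis of the observable X is the index set \<open>K\<close> itself, so measuring X
  means keeping the diagonal blocks, and \<open>U\<close> holds the basis of Z. Nothing is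
  normalised, hence the trace beside \<open>log 2 c\<close>.\<close>

theorem memory_uncertainty:
  fixes \<rho> :: "'k \<times> 'b \<Rightarrow> 'k \<times> 'b \<Rightarrow> complex" and U :: "'l \<Rightarrow> 'k \<Rightarrow> complex"
  assumes fin: "finite K" "finite B" "finite L"
    and psd: "psd_on (K \<times> B) \<rho>"
    and U: "onb L K U" and c: "0 < c" "\<And>l k. l \<in> L \<Longrightarrow> k \<in> K \<Longrightarrow> (cmod (U l k))\<^sup>2 \<le> c"
  shows "vn_entropy (K \<times> B) \<rho> + vn_entropy B (\<lambda>b b'. \<Sum>k\<in>K. \<rho> (k, b) (k, b')) - log 2 c * Re (\<Sum>x\<in>K \<times> B. \<rho> x x)
     \<le> (\<Sum>k\<in>K. vn_entropy B (\<lambda>b b'. \<rho> (k, b) (k, b')))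
      + (\<Sum>l\<in>L. vn_entropy B (\<lambda>b b'. \<Sum>k\<in>K. \<Sum>k'\<in>K. cnj (U l k) * \<rho> (k, b) (k', b') * U l k'))"
proof -
  let ?I = "K \<times> B"
  let ?X = "\<lambda>k b b'. \<rho> (k, b) (k, b')"
  let ?Z = "\<lambda>l b b'. \<Sum>k\<in>K. \<Sum>k'\<in>K. cnj (U l k) * \<rho> (k, b) (k', b') * U l k'"
  let ?B = "\<lambda>b b'. \<Sum>k\<in>K. ?X k b b'"
  have I: "finite ?I" using fin by simp
  have psdX: "psd_on B (?X k)" if k: "k \<in> K" for k
  proof -
    have "?X k b' b = cnj (?X k b b')" if "b \<in> B" "b' \<in> B" for b b'
      using psd k that unfolding psd_on_def hermitian_on_def by blast
    moreover have "0 \<le> Re (qform B (?X k) u)" for u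
      using psd unfolding psd_on_def qform_slice_left[OF fin(1,2) k, symmetric] by blast
    ultimately show ?thesis unfolding psd_on_def hermitian_on_def by blast
  qed
  have psdZ: "psd_on B (?Z l)" if "l \<in> L" for l by (rule psd_on_compress[OF psd])
  have sumZ: "(\<Sum>l\<in>L. ?Z l b b') = ?B b b'" for b b'
  proof -
    have "(\<Sum>l\<in>L. ?Z l b b') = (\<Sum>k\<in>K. \<Sum>k'\<in>K. \<Sum>l\<in>L. \<rho> (k, b) (k', b') * (U l k' * cnj (U l k)))"
      by (subst sum_rotate[symmetric]) (simp add: mult_ac)
    also have "\<dots> = (\<Sum>k\<in>K. \<Sum>k'\<in>K. of_bool (k' = k) * \<rho> (k, b) (k', b'))"
      unfolding sum_distrib_left[symmetric] using U by (intro sum.cong) (auto simp: onb_def)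
    finally show ?thesis using fin by (simp add: sum_of_bool_mult)
  qed
  obtain e v where v: "onb {..<card ?I} ?I v" "eigen_expansion {..<card ?I} ?I e v \<rho>"
      "\<forall>j<card ?I. 0 \<le> e j" "ln 2 * vn_entropy ?I \<rho> = - (\<Sum>j<card ?I. e j * ln (e j))"
    by (rule vn_entropy_psd[OF I psd])
  obtain q z where z: "\<And>l. l \<in> L \<Longrightarrow> onb {..<card B} B (z l)"
      "\<And>l. l \<in> L \<Longrightarrow> eigen_expansion {..<card B} B (q l) (z l) (?Z l)"
      "\<And>l j. l \<in> L \<Longrightarrow> j < card B \<Longrightarrow> 0 \<le> q l j"
      "\<And>l. l \<in> L \<Longrightarrow> ln 2 * vn_entropy B (?Z l) = - (\<Sum>j<card B. q l j * ln (q l j))"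
    by (rule vn_entropy_choice[OF fin(2) psdZ]) (assumption, rule that, blast+)
  obtain p x where x: "\<And>k. k \<in> K \<Longrightarrow> onb {..<card B} B (x k)"
      "\<And>k. k \<in> K \<Longrightarrow> eigen_expansion {..<card B} B (p k) (x k) (?X k)"
      "\<And>k j. k \<in> K \<Longrightarrow> j < card B \<Longrightarrow> 0 \<le> p k j"
      "\<And>k. k \<in> K \<Longrightarrow> ln 2 * vn_entropy B (?X k) = - (\<Sum>j<card B. p k j * ln (p k j))"
    by (rule vn_entropy_choice[OF fin(2) psdX]) (assumption, rule that, blast+)
  obtain r y where y: "onb {..<card B} B y" "eigen_expansion {..<card B} B r y ?B"
      "\<forall>j<card B. 0 \<le> r j" "ln 2 * vn_entropy B ?B = - (\<Sum>j<card B. r j * ln (r j))"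
    by (rule vn_entropy_psd[OF fin(2) psd_on_sum[OF psdX]])
  define w where "w = (\<lambda>lj x. U (fst lj) (fst x) * z (fst lj) (snd lj) (snd x))"
  define q' where "q' = (\<lambda>lj. q (fst lj) (snd lj))"
  \<comment> \<open>The Z-pinching of \<open>\<rho>\<close>; its eigenbasis \<open>w\<close> is
    glued from the eigenbases of the conditional states.\<close>
  define \<sigma> where "\<sigma> = (\<lambda>x y. \<Sum>l\<in>L. U l (fst x) * ?Z l (snd x) (snd y) * cnj (U l (fst y)))"
  let ?LB = "L \<times> {..<card B}"
  have w1: "onb ?LB ?I w" unfolding w_def by (rule onb_tensor[OF U z(1)])
  have w2: "eigen_expansion ?LB ?I q' w \<sigma>"
    unfolding eigen_expansion_def
  proof (intro ballI)
    fix a b assume ab: "a \<in> ?I" "b \<in> ?I"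
    have "\<sigma> a b = (\<Sum>l\<in>L. U l (fst a) * (\<Sum>j<card B. complex_of_real (q l j) * z l j (snd a) * cnj (z l j (snd b))) * cnj (U l (fst b)))"
      unfolding \<sigma>_def using z(2) ab by (intro sum.cong refl) (auto simp: eigen_expansion_def)
    also have "\<dots> = (\<Sum>k\<in>?LB. complex_of_real (q' k) * w k a * cnj (w k b))"
      by (simp add: sum.cartesian_product' sum_distrib_left sum_distrib_right w_def q'_def mult_ac)
    finally show "\<sigma> a b = (\<Sum>k\<in>?LB. complex_of_real (q' k) * w k a * cnj (w k b))" .
  qed
  \<comment> \<open>Pinching keeps the diagonal of \<open>\<rho>\<close> in this basis, so the cross
    term of the relative entropy is, up to sign and the factor \<open>ln 2\<close>, the entropy of
    \<open>\<sigma>\<close>, and the support clause holds.\<close>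
  have w3: "qform ?I \<rho> (w lj) = complex_of_real (q' lj)" if "lj \<in> ?LB" for lj
    unfolding w_def qform_tensor q'_def
    using qform_eigenvector[OF z(1,2), of "fst lj" "snd lj"] that by auto
  have src: "spectral_pair ?I {..<card ?I} ?LB e v q' w \<rho> \<sigma>"
    unfolding spectral_pair_def using v(1-3) w1 w2 w3 z(3) by (auto simp: q'_def)
  have rs: "(\<Sum>k\<in>K. Re (qform B (?X k) (y j))) = r j" if "j < card B" for j
    unfolding Re_sum[symmetric] qform_sum[symmetric] using qform_eigenvector[OF y(1,2), of j] that by simp
  have nn: "0 \<le> Re (qform B (?X k) u)" if "k \<in> K" for k u
    using psdX[OF that] by (simp add: psd_on_def)
  have "Re (qform B (?X k) (y j)) = 0" if "k \<in> K" "j < card B" "r j = 0" for k j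
    using rs[OF that(2)] that nn fin(1) by (simp add: sum_nonneg_eq_0_iff)
  moreover have "eigen_expansion {..<card B} B (\<lambda>j. c * r j) y (\<lambda>b b'. complex_of_real c * ?B b b')"
    using y(2) by (simp add: eigen_expansion_def mult.assoc flip: sum_distrib_left)
  ultimately have tgt: "spectral_pair B {..<card B} {..<card B} (p k) (x k) (\<lambda>j. c * r j) y (?X k)
      (\<lambda>b b'. complex_of_real c * ?B b b')" if "k \<in> K" for k
    unfolding spectral_pair_def using x y(1,3) c(1) that by auto
  have trB: "complex_of_real (\<Sum>j<card B. r j) = (\<Sum>x\<in>?I. \<rho> x x)"
    unfolding trace_eigen[OF y(1,2) fin(2), symmetric] sum.cartesian_product' by (rule sum.swap)
  \<comment> \<open>The unmeasured state is a single block, indexed by \<open>()\<close>. The target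
    compares each measured block with \<open>c\<close> times the memory state instead of the pinched
    block.\<close>
  have main: "(\<Sum>k\<in>K. rel_ent B {..<card B} {..<card B} (p k) (\<lambda>j. c * r j) y (?X k))
     \<le> (\<Sum>k\<in>{()}. rel_ent ?I {..<card ?I} ?LB e q' w \<rho>)"
  proof (rule rel_ent_mono)
    have "complex_of_real (\<Sum>k\<in>{()}. \<Sum>j<card ?I. e j) = (\<Sum>x\<in>?I. \<rho> x x)"
      unfolding trace_eigen[OF v(1,2) I] by simp
    also have "\<dots> = complex_of_real (\<Sum>k\<in>K. \<Sum>j<card B. p k j)"
      unfolding of_real_sum[of _ K] sum.cartesian_product'
      by (intro sum.cong refl trace_eigen[OF x(1,2) fin(2)])
    finally show "(\<Sum>k\<in>{()}. \<Sum>j<card ?I. e j) = (\<Sum>k\<in>K. \<Sum>j<card B. p k j)"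
      unfolding of_real_eq_iff .
  next
    fix s :: real and Y' :: "'k \<Rightarrow> 'b \<Rightarrow> 'b \<Rightarrow> complex"
    let ?Y = "\<lambda>x y. of_bool (fst x = fst y) * Y' (fst y) (snd x) (snd y)"
    have "varfun B s (?X k) (\<lambda>b b'. complex_of_real c * ?B b b') (Y' k)
        \<le> varfun B s (?X k) (\<lambda>b b'. \<sigma> (k, b) (k, b')) (Y' k)" if k: "k \<in> K" for k
    proof (rule varfun_antimono)
      fix u
      \<comment> \<open>The block of \<open>\<sigma>\<close> at \<open>k\<close> is a sum of the
        conditional states with weights at most \<open>c\<close>; raising every weight to
        \<open>c\<close> and using \<open>sumZ\<close> gives \<open>c\<close> times the memory
        state.\<close>
      have "(\<lambda>b b'. \<sigma> (k, b) (k, b')) = (\<lambda>b b'. \<Sum>l\<in>L. complex_of_real ((cmod (U l k))\<^sup>2) * ?Z l b b')"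
        by (intro ext) (simp add: \<sigma>_def complex_norm_square mult_ac del: of_real_power)
      then have "Re (qform B (\<lambda>b b'. \<sigma> (k, b) (k, b')) u) = (\<Sum>l\<in>L. (cmod (U l k))\<^sup>2 * Re (qform B (?Z l) u))"
        by (simp only: qform_sum qform_scale Re_sum Re_complex_of_real times_complex.sel Im_complex_of_real mult_zero_left diff_0_right)
      also have "\<dots> \<le> (\<Sum>l\<in>L. c * Re (qform B (?Z l) u))"
        using c(2) psdZ k by (intro sum_mono mult_right_mono) (auto simp: psd_on_def)
      also have "\<dots> = c * Re (qform B (\<lambda>b b'. \<Sum>l\<in>L. ?Z l b b') u)"
        by (simp only: qform_sum Re_sum sum_distrib_left)
      also have "\<dots> = Re (qform B (\<lambda>b b'. complex_of_real c * ?B b b') u)"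
        unfolding sumZ qform_scale by simp
      finally show "Re (qform B (\<lambda>b b'. \<sigma> (k, b) (k, b')) u) \<le> Re (qform B (\<lambda>b b'. complex_of_real c * ?B b b') u)" .
    qed
    then have "(\<Sum>k\<in>K. varfun B s (?X k) (\<lambda>b b'. complex_of_real c * ?B b b') (Y' k))
        \<le> varfun ?I s \<rho> \<sigma> ?Y"
      unfolding varfun_block[OF fin(1,2)] by (rule sum_mono)
    then show "\<exists>Y. (\<Sum>k\<in>K. varfun B s (?X k) (\<lambda>b b'. complex_of_real c * ?B b b') (Y' k))
        \<le> (\<Sum>k\<in>{()}. varfun ?I s \<rho> \<sigma> (Y k))"
      by (intro exI[of _ "\<lambda>_. ?Y"]) simp
  qed (use fin I src tgt in auto)
  have "(\<Sum>lj\<in>?LB. Re (qform ?I \<rho> (w lj)) * ln (q' lj)) = (\<Sum>lj\<in>?LB. q' lj * ln (q' lj))"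
    using w3 by (intro sum.cong refl) simp
  also have "\<dots> = - (ln 2 * (\<Sum>l\<in>L. vn_entropy B (?Z l)))"
    by (simp add: sum.cartesian_product' q'_def sum_distrib_left z(4) sum_negf)
  finally have S: "(\<Sum>k\<in>{()}. rel_ent ?I {..<card ?I} ?LB e q' w \<rho>)
      = ln 2 * ((\<Sum>l\<in>L. vn_entropy B (?Z l)) - vn_entropy ?I \<rho>)"
    using v(4) by (simp add: rel_ent_def algebra_simps)
  have "(\<Sum>k\<in>K. \<Sum>j<card B. Re (qform B (?X k) (y j)) * ln (c * r j))
      = (\<Sum>j<card B. (\<Sum>k\<in>K. Re (qform B (?X k) (y j))) * ln (c * r j))"
    by (subst sum.swap) (simp add: sum_distrib_right)
  also have "\<dots> = (\<Sum>j<card B. r j * ln c + r j * ln (r j))"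
    using rs y(3) c(1) by (intro sum.cong refl) (simp add: ln_mult_nonneg)
  also have "\<dots> = ln c * (\<Sum>j<card B. r j) - ln 2 * vn_entropy B ?B"
    by (simp add: sum.distrib y(4) sum_distrib_left mult.commute)
  also have "(\<Sum>j<card B. r j) = Re (\<Sum>x\<in>?I. \<rho> x x)"
    unfolding trB[symmetric] by simp
  finally have T1: "(\<Sum>k\<in>K. \<Sum>j<card B. Re (qform B (?X k) (y j)) * ln (c * r j))
      = ln c * Re (\<Sum>x\<in>?I. \<rho> x x) - ln 2 * vn_entropy B ?B" .
  have T2: "(\<Sum>k\<in>K. \<Sum>j<card B. p k j * ln (p k j)) = - (ln 2 * (\<Sum>k\<in>K. vn_entropy B (?X k)))"
    by (simp add: sum_distrib_left x(4) sum_negf)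
  have "(\<Sum>k\<in>K. rel_ent B {..<card B} {..<card B} (p k) (\<lambda>j. c * r j) y (?X k))
      = ln 2 * (vn_entropy B ?B - log 2 c * Re (\<Sum>x\<in>?I. \<rho> x x) - (\<Sum>k\<in>K. vn_entropy B (?X k)))"
    unfolding rel_ent_def sum_subtractf T1 T2 by (simp add: log_def algebra_simps)
  then show ?thesis using main unfolding S by simp
qed

section \<open>Measurement and partial trace in terms of Gram factors\<close>

definition compress :: "'a set \<Rightarrow> ('a \<Rightarrow> complex) \<Rightarrow> ('a \<times> 'b \<Rightarrow> 'a \<times> 'b \<Rightarrow> complex) \<Rightarrow> 'b \<Rightarrow> 'b \<Rightarrow> complex" where
  "compress A u X = (\<lambda>b b'. \<Sum>a\<in>A. \<Sum>a'\<in>A. cnj (u a) * X (a, b) (a', b') * u a')"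

definition trace_left :: "'a set \<Rightarrow> ('a \<times> 'b \<Rightarrow> 'a \<times> 'b \<Rightarrow> complex) \<Rightarrow> 'b \<Rightarrow> 'b \<Rightarrow> complex" where
  "trace_left A X = (\<lambda>b b'. \<Sum>a\<in>A. X (a, b) (a, b'))"

text \<open>For a unit vector \<open>u\<close>, \<open>compress A u \<rho>\<close> is the
  unnormalised memory state after outcome \<open>u\<close>. Contracting the Gram factor of
  \<open>\<rho>\<close> with \<open>u\<close> gives a factor of it with the same environment
  \<open>E\<close>.\<close>

lemma compress_gram:
  assumes "\<And>x y. x \<in> A \<times> B \<Longrightarrow> y \<in> A \<times> B \<Longrightarrow> \<rho> x y = (\<Sum>e\<in>E. M x e * cnj (M y e))" "b \<in> B" "b' \<in> B"
  shows "compress A u \<rho> b b' = (\<Sum>e\<in>E. inner_on A u (\<lambda>a. M (a, b) e) * cnj (inner_on A u (\<lambda>a. M (a, b') e)))"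
proof -
  have "compress A u \<rho> b b' = (\<Sum>a\<in>A. \<Sum>a'\<in>A. \<Sum>e\<in>E. (cnj (u a) * M (a, b) e) * cnj (cnj (u a') * M (a', b') e))"
    unfolding compress_def using assms
    by (intro sum.cong refl) (simp add: sum_distrib_left sum_distrib_right mult_ac)
  then show ?thesis
    by (subst (asm) sum_rotate) (simp add: inner_on_def sum_product)
qed

lemma sum_onb_product:
  assumes "onb K A X" "finite A"
  shows "(\<Sum>k\<in>K. inner_on A (X k) u * cnj (inner_on A (X k) w)) = (\<Sum>a\<in>A. u a * cnj (w a))"
proof -
  have "(\<Sum>k\<in>K. inner_on A (X k) u * cnj (inner_on A (X k) w)) = inner_on A w u"
    unfolding cnj_inner_on onb_parseval[OF assms, of w u] ..
  then show ?thesis by (simp add: inner_on_def mult.commute)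
qed

lemma trace_left_gram:
  assumes "\<And>x y. x \<in> A \<times> B \<Longrightarrow> y \<in> A \<times> B \<Longrightarrow> \<rho> x y = (\<Sum>e\<in>E. M x e * cnj (M y e))" "b \<in> B" "b' \<in> B"
    and "onb K A X" "finite A"
  shows "trace_left A \<rho> b b'
      = (\<Sum>k\<in>K. \<Sum>e\<in>E. inner_on A (X k) (\<lambda>a. M (a, b) e) * cnj (inner_on A (X k) (\<lambda>a. M (a, b') e)))"
proof -
  have "trace_left A \<rho> b b' = (\<Sum>a\<in>A. \<Sum>e\<in>E. M (a, b) e * cnj (M (a, b') e))"
    unfolding trace_left_def using assms(1-3) by (intro sum.cong) auto
  also have "\<dots> = (\<Sum>e\<in>E. \<Sum>a\<in>A. M (a, b) e * cnj (M (a, b') e))"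
    by (rule sum.swap)
  also have "\<dots> = (\<Sum>e\<in>E. \<Sum>k\<in>K. inner_on A (X k) (\<lambda>a. M (a, b) e) * cnj (inner_on A (X k) (\<lambda>a. M (a, b') e)))"
    unfolding sum_onb_product[OF assms(4,5)] ..
  also have "\<dots> = (\<Sum>k\<in>K. \<Sum>e\<in>E. inner_on A (X k) (\<lambda>a. M (a, b) e) * cnj (inner_on A (X k) (\<lambda>a. M (a, b') e)))"
    by (rule sum.swap)
  finally show ?thesis .
qed

text \<open>The relation above wants one observable in the computational basis, so the first factor
  is rewritten in the coordinates of \<open>X\<close>. That this keeps the entropy is seen on the
  environment: the old and the new Gram factor have the same marginal on \<open>E\<close>.\<close>

theorem bipartite_uncertainty:
  fixes \<rho> :: "'a \<times> 'b \<Rightarrow> 'a \<times> 'b \<Rightarrow> complex" and M :: "'a \<times> 'b \<Rightarrow> 'e \<Rightarrow> complex"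
  assumes fin: "finite A" "finite B" "finite E" "finite K" "finite L"
    and \<rho>: "\<And>x y. x \<in> A \<times> B \<Longrightarrow> y \<in> A \<times> B \<Longrightarrow> \<rho> x y = (\<Sum>e\<in>E. M x e * cnj (M y e))"
    and X: "onb K A X" and Z: "onb L A Z"
    and c: "0 < c" "\<And>k l. k \<in> K \<Longrightarrow> l \<in> L \<Longrightarrow> (cmod (inner_on A (X k) (Z l)))\<^sup>2 \<le> c"
  shows "vn_entropy (A \<times> B) \<rho> + vn_entropy B (trace_left A \<rho>) - log 2 c * Re (\<Sum>b\<in>B. trace_left A \<rho> b b)
     \<le> (\<Sum>k\<in>K. vn_entropy B (compress A (X k) \<rho>)) + (\<Sum>l\<in>L. vn_entropy B (compress A (Z l) \<rho>))"
proof -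
  define U where "U = (\<lambda>l k. inner_on A (X k) (Z l))"
  define N where "N = (\<lambda>x e. inner_on A (X (fst x)) (\<lambda>a. M (a, snd x) e))"
  define \<rho>' where "\<rho>' = (\<lambda>x y. \<Sum>e\<in>E. N x e * cnj (N y e))"
  have U: "onb L K U"
    unfolding onb_def
  proof (intro conjI ballI)
    fix l l' assume "l \<in> L" "l' \<in> L"
    then have "inner_on A (Z l) (Z l') = of_bool (l = l')" using Z by (simp add: onb_def)
    then show "inner_on K (U l) (U l') = of_bool (l = l')"
      unfolding onb_parseval[OF X fin(1), of "Z l" "Z l'"] by (simp add: inner_on_def[of K] U_def cnj_inner_on mult.commute)
  next
    fix k k' assume "k \<in> K" "k' \<in> K"
    then have "inner_on A (X k) (X k') = of_bool (k = k')" using X by (simp add: onb_def)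
    then show "(\<Sum>l\<in>L. U l k * cnj (U l k')) = of_bool (k = k')"
      unfolding onb_parseval[OF Z fin(1), of "X k" "X k'"] by (simp add: U_def cnj_inner_on mult.commute)
  qed
  have N_Z: "(\<Sum>k\<in>K. cnj (U l k) * N (k, b) e) = inner_on A (Z l) (\<lambda>a. M (a, b) e)" for l b e
    using onb_parseval[OF X fin(1), of "Z l" "\<lambda>a. M (a, b) e"]
    by (simp add: U_def N_def cnj_inner_on mult.commute)
  have "vn_entropy (A \<times> B) \<rho> = vn_entropy (A \<times> B) (\<lambda>x y. \<Sum>e\<in>E. M x e * cnj (M y e))"
    by (rule vn_entropy_cong) (rule \<rho>)
  also have "\<dots> = vn_entropy E (\<lambda>e e'. \<Sum>x\<in>A \<times> B. M x e * cnj (M x e'))"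
    using fin by (intro vn_entropy_gram_swap) auto
  also have "(\<lambda>e e'. \<Sum>x\<in>A \<times> B. M x e * cnj (M x e')) = (\<lambda>e e'. \<Sum>x\<in>K \<times> B. N x e * cnj (N x e'))"
  proof (intro ext)
    fix e e'
    have "(\<Sum>x\<in>A \<times> B. M x e * cnj (M x e')) = (\<Sum>b\<in>B. \<Sum>a\<in>A. M (a, b) e * cnj (M (a, b) e'))"
      unfolding sum.cartesian_product' by (rule sum.swap)
    also have "\<dots> = (\<Sum>b\<in>B. \<Sum>k\<in>K. N (k, b) e * cnj (N (k, b) e'))"
      by (simp add: N_def sum_onb_product[OF X fin(1)])
    also have "\<dots> = (\<Sum>x\<in>K \<times> B. N x e * cnj (N x e'))"
      unfolding sum.cartesian_product' by (rule sum.swap)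
    finally show "(\<Sum>x\<in>A \<times> B. M x e * cnj (M x e')) = (\<Sum>x\<in>K \<times> B. N x e * cnj (N x e'))" .
  qed
  also have "vn_entropy E \<dots> = vn_entropy (K \<times> B) \<rho>'"
    unfolding \<rho>'_def using fin by (intro vn_entropy_gram_swap[symmetric]) auto
  finally have S: "vn_entropy (A \<times> B) \<rho> = vn_entropy (K \<times> B) \<rho>'" .
  have B: "trace_left A \<rho> b b' = (\<Sum>k\<in>K. \<rho>' (k, b) (k, b'))" if "b \<in> B" "b' \<in> B" for b b'
    unfolding \<rho>'_def N_def fst_conv snd_conv by (rule trace_left_gram[OF \<rho> that X fin(1)])
  have SB: "vn_entropy B (trace_left A \<rho>) = vn_entropy B (\<lambda>b b'. \<Sum>k\<in>K. \<rho>' (k, b) (k, b'))"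
    by (rule vn_entropy_cong) (rule B)
  have tr: "(\<Sum>x\<in>K \<times> B. \<rho>' x x) = (\<Sum>b\<in>B. trace_left A \<rho> b b)"
    unfolding sum.cartesian_product' by (subst sum.swap) (simp add: B)
  have SX: "vn_entropy B (compress A (X k) \<rho>) = vn_entropy B (\<lambda>b b'. \<rho>' (k, b) (k, b'))" for k
    by (rule vn_entropy_cong) (simp add: compress_gram[OF \<rho>] \<rho>'_def N_def)
  have SZ: "vn_entropy B (compress A (Z l) \<rho>)
      = vn_entropy B (\<lambda>b b'. \<Sum>k\<in>K. \<Sum>k'\<in>K. cnj (U l k) * \<rho>' (k, b) (k', b') * U l k')" for l
  proof (rule vn_entropy_cong)
    fix b b' assume b: "b \<in> B" "b' \<in> B"
    have "compress A (Z l) \<rho> b b' = (\<Sum>e\<in>E. (\<Sum>k\<in>K. cnj (U l k) * N (k, b) e) * cnj (\<Sum>k\<in>K. cnj (U l k) * N (k, b') e))"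
      unfolding N_Z by (rule compress_gram[OF \<rho> b])
    also have "\<dots> = (\<Sum>e\<in>E. \<Sum>k\<in>K. \<Sum>k'\<in>K. cnj (U l k) * (N (k, b) e * cnj (N (k', b') e)) * U l k')"
      unfolding cnj_sum sum_product by (intro sum.cong refl) (simp add: mult_ac)
    also have "\<dots> = (\<Sum>k\<in>K. \<Sum>k'\<in>K. \<Sum>e\<in>E. cnj (U l k) * (N (k, b) e * cnj (N (k', b') e)) * U l k')"
      by (rule sum_rotate[symmetric])
    finally show "compress A (Z l) \<rho> b b' = (\<Sum>k\<in>K. \<Sum>k'\<in>K. cnj (U l k) * \<rho>' (k, b) (k', b') * U l k')"
      by (simp add: \<rho>'_def sum_distrib_left sum_distrib_right)
  qed
  have "psd_on (K \<times> B) \<rho>'" unfolding \<rho>'_def by (rule psd_on_gram)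
  moreover have "(cmod (U l k))\<^sup>2 \<le> c" if "l \<in> L" "k \<in> K" for l k
    using c(2) that by (simp add: U_def)
  ultimately show ?thesis
    using memory_uncertainty[OF fin(4,2,5) _ U c(1), of \<rho>'] by (simp add: S SB SX SZ tr)
qed

text \<open>The memory \<open>C\<close> is enlarged to the purifying system \<open>C \<times> R\<close> of \<open>A \<times> B\<close>; the entropies of the
  enlarged system are those of the pair \<open>A \<times> B\<close>, where the bipartite relation applies.\<close>

theorem tripartite_uncertainty:
  fixes \<phi> :: "'a \<Rightarrow> 'b \<Rightarrow> 'c \<Rightarrow> 'r \<Rightarrow> complex"
  assumes fin: "finite A" "finite B" "finite C" "finite R" "finite K" "finite L"
    and \<rho>: "\<And>x y. x \<in> A \<times> B \<Longrightarrow> y \<in> A \<times> B \<Longrightarrow>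
        \<rho> x y = (\<Sum>e\<in>C \<times> R. \<phi> (fst x) (snd x) (fst e) (snd e) * cnj (\<phi> (fst y) (snd y) (fst e) (snd e)))"
    and \<sigma>: "\<And>x y. x \<in> A \<times> C \<Longrightarrow> y \<in> A \<times> C \<Longrightarrow>
        \<sigma> x y = (\<Sum>e\<in>B \<times> R. \<phi> (fst x) (fst e) (snd x) (snd e) * cnj (\<phi> (fst y) (fst e) (snd y) (snd e)))"
    and X: "onb K A X" and Z: "onb L A Z"
    and c: "0 < c" "\<And>k l. k \<in> K \<Longrightarrow> l \<in> L \<Longrightarrow> (cmod (inner_on A (X k) (Z l)))\<^sup>2 \<le> c"
  shows "vn_entropy B (trace_left A \<rho>) + vn_entropy C (trace_left A \<sigma>) - log 2 c * Re (\<Sum>b\<in>B. trace_left A \<rho> b b)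
     \<le> (\<Sum>k\<in>K. vn_entropy B (compress A (X k) \<rho>)) + (\<Sum>l\<in>L. vn_entropy C (compress A (Z l) \<sigma>))"
proof -
  let ?M = "\<lambda>x e. \<phi> (fst x) (snd x) (fst e) (snd e)"
  let ?M' = "\<lambda>x e. \<phi> (fst x) (fst e) (snd x) (snd e)"
  define N where "N = (\<lambda>l b e. inner_on A (Z l) (\<lambda>a. \<phi> a b (fst e) (snd e)))"
  \<comment> \<open>The unnormalised state of \<open>C \<times> R\<close> given outcome
    \<open>l\<close>. Given that outcome, \<open>B\<close> and \<open>C \<times> R\<close> are
    jointly pure, so it has the entropy of the conditional state of \<open>B\<close>; its sum over
    \<open>l\<close> is the unmeasured state of \<open>C \<times> R\<close>.\<close>
  define \<tau> where "\<tau> = (\<lambda>l e e'. \<Sum>b\<in>B. N l b e * cnj (N l b e'))"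
  have CR: "finite (C \<times> R)" using fin by simp
  have SZ: "vn_entropy B (compress A (Z l) \<rho>) = vn_entropy (C \<times> R) (\<tau> l)" for l
  proof -
    have "vn_entropy B (compress A (Z l) \<rho>) = vn_entropy B (\<lambda>b b'. \<Sum>e\<in>C \<times> R. N l b e * cnj (N l b' e))"
      by (rule vn_entropy_cong) (simp add: compress_gram[OF \<rho>] N_def)
    then show ?thesis unfolding \<tau>_def by (simp only: vn_entropy_gram_swap[OF fin(2) CR])
  qed
  have "vn_entropy (A \<times> B) \<rho> = vn_entropy (A \<times> B) (\<lambda>x y. \<Sum>e\<in>C \<times> R. ?M x e * cnj (?M y e))"
    by (rule vn_entropy_cong) (rule \<rho>)
  also have "\<dots> = vn_entropy (C \<times> R) (\<lambda>e e'. \<Sum>x\<in>A \<times> B. ?M x e * cnj (?M x e'))"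
    using fin by (intro vn_entropy_gram_swap) auto
  also have "(\<lambda>e e'. \<Sum>x\<in>A \<times> B. ?M x e * cnj (?M x e')) = (\<lambda>e e'. \<Sum>l\<in>L. \<tau> l e e')"
  proof (intro ext)
    fix e e'
    have "(\<Sum>x\<in>A \<times> B. ?M x e * cnj (?M x e')) = (\<Sum>b\<in>B. \<Sum>a\<in>A. ?M (a, b) e * cnj (?M (a, b) e'))"
      unfolding sum.cartesian_product' by (rule sum.swap)
    also have "\<dots> = (\<Sum>b\<in>B. \<Sum>l\<in>L. N l b e * cnj (N l b e'))"
      by (simp add: N_def sum_onb_product[OF Z fin(1)])
    also have "\<dots> = (\<Sum>l\<in>L. \<tau> l e e')"
      unfolding \<tau>_def by (rule sum.swap)
    finally show "(\<Sum>x\<in>A \<times> B. ?M x e * cnj (?M x e')) = (\<Sum>l\<in>L. \<tau> l e e')" .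
  qed
  finally have SAB: "vn_entropy (A \<times> B) \<rho> = vn_entropy (C \<times> R) (\<lambda>e e'. \<Sum>l\<in>L. \<tau> l e e')" .
  have tr: "(\<Sum>r\<in>R. \<tau> l (c, r) (c', r)) = (\<Sum>e\<in>B \<times> R. inner_on A (Z l) (\<lambda>a. ?M' (a, c) e) * cnj (inner_on A (Z l) (\<lambda>a. ?M' (a, c') e)))" for l c c'
    unfolding \<tau>_def N_def sum.cartesian_product' by (subst sum.swap) simp
  have SZC: "vn_entropy C (compress A (Z l) \<sigma>) = vn_entropy C (\<lambda>c c'. \<Sum>r\<in>R. \<tau> l (c, r) (c', r))" for l
    unfolding tr by (rule vn_entropy_cong) (rule compress_gram[OF \<sigma>])
  have SC: "vn_entropy C (trace_left A \<sigma>) = vn_entropy C (\<lambda>c c'. \<Sum>l\<in>L. \<Sum>r\<in>R. \<tau> l (c, r) (c', r))"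
    unfolding tr by (rule vn_entropy_cong) (rule trace_left_gram[OF \<sigma> _ _ Z fin(1)])
  have "psd_on (C \<times> R) (\<tau> l)" for l
    unfolding \<tau>_def using psd_on_gram[of "C \<times> R" "\<lambda>e b. N l b e" B] .
  then have "(\<Sum>l\<in>L. vn_entropy (C \<times> R) (\<tau> l)) - vn_entropy (C \<times> R) (\<lambda>e e'. \<Sum>l\<in>L. \<tau> l e e')
     \<le> (\<Sum>l\<in>L. vn_entropy C (\<lambda>c c'. \<Sum>r\<in>R. \<tau> l (c, r) (c', r)))
       - vn_entropy C (\<lambda>c c'. \<Sum>l\<in>L. \<Sum>r\<in>R. \<tau> l (c, r) (c', r))"
    by (intro conditional_entropy_partial_trace fin)
  moreover have "vn_entropy (A \<times> B) \<rho> + vn_entropy B (trace_left A \<rho>) - log 2 c * Re (\<Sum>b\<in>B. trace_left A \<rho> b b)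
     \<le> (\<Sum>k\<in>K. vn_entropy B (compress A (X k) \<rho>)) + (\<Sum>l\<in>L. vn_entropy B (compress A (Z l) \<rho>))"
    by (rule bipartite_uncertainty[OF fin(1,2) CR fin(5,6) \<rho> X Z c])
  ultimately show ?thesis by (simp add: SZ SAB SZC SC)
qed

text \<open>The vectors \<open>X k\<close>, tensored with the eigenvectors of \<open>N k\<close>,
  diagonalise the measured state. The \<open>N k\<close> are not normalised, so the entropy of the
  outcome distribution is already contained in the sum.\<close>

theorem vn_entropy_measured:
  assumes fin: "finite A" "finite B" "finite K" and X: "onb K A X"
    and N: "\<And>k. k \<in> K \<Longrightarrow> psd_on B (N k)"
  shows "vn_entropy (A \<times> B) (\<lambda>x y. \<Sum>k\<in>K. X k (fst x) * N k (snd x) (snd y) * cnj (X k (fst y)))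
      = (\<Sum>k\<in>K. vn_entropy B (N k))"
proof -
  obtain p v where v: "\<And>k. k \<in> K \<Longrightarrow> onb {..<card B} B (v k)"
      "\<And>k. k \<in> K \<Longrightarrow> eigen_expansion {..<card B} B (p k) (v k) (N k)"
      "\<And>k j. k \<in> K \<Longrightarrow> j < card B \<Longrightarrow> 0 \<le> p k j"
      "\<And>k. k \<in> K \<Longrightarrow> ln 2 * vn_entropy B (N k) = - (\<Sum>j<card B. p k j * ln (p k j))"
    by (rule vn_entropy_choice[OF fin(2) N]) (assumption, rule that, blast+)
  let ?J = "K \<times> {..<card B}" and ?p = "\<lambda>kj. p (fst kj) (snd kj)"
  let ?w = "\<lambda>kj x. X (fst kj) (fst x) * v (fst kj) (snd kj) (snd x)"
  let ?Y = "\<lambda>x y. \<Sum>k\<in>K. X k (fst x) * N k (snd x) (snd y) * cnj (X k (fst y))"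
  have "eigen_expansion ?J (A \<times> B) ?p ?w ?Y"
    unfolding eigen_expansion_def
  proof (intro ballI)
    fix x y assume xy: "x \<in> A \<times> B" "y \<in> A \<times> B"
    have "?Y x y = (\<Sum>k\<in>K. X k (fst x) * (\<Sum>j<card B. complex_of_real (p k j) * v k j (snd x) * cnj (v k j (snd y))) * cnj (X k (fst y)))"
      using v(2) xy by (intro sum.cong refl) (auto simp: eigen_expansion_def)
    then show "?Y x y = (\<Sum>k\<in>?J. complex_of_real (?p k) * ?w k x * cnj (?w k y))"
      by (simp add: sum.cartesian_product' sum_distrib_left sum_distrib_right mult_ac)
  qed
  moreover have "onb ?J (A \<times> B) ?w" by (rule onb_tensor[OF X v(1)])
  ultimately have "vn_entropy (A \<times> B) ?Y = - (\<Sum>k\<in>?J. ?p k * log 2 (?p k))"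
    using fin v(3) by (intro vn_entropy_orthonormal[where v = ?w]) (auto simp: onb_def)
  also have "\<dots> = (\<Sum>k\<in>K. - (\<Sum>j<card B. p k j * ln (p k j)) / ln 2)"
    by (simp add: sum.cartesian_product' log_def sum_negf sum_divide_distrib)
  also have "\<dots> = (\<Sum>k\<in>K. vn_entropy B (N k))"
    using v(4) by (intro sum.cong refl) (simp add: field_simps)
  finally show ?thesis .
qed

section \<open>Invariance of entropy under relabelling\<close>

lemma spectral_decomp_bij:
  assumes h: "bij_betw h I I'" and sd: "spectral_decomp I' X lam"
  shows "spectral_decomp I (\<lambda>x y. X (h x) (h y)) lam"
proof -
  obtain v where v: "\<forall>k<card I'. \<forall>l<card I'. (\<Sum>x\<in>I'. cnj (v k x) * v l x) = (if k = l then 1 else 0)"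
    "\<forall>x\<in>I'. \<forall>y\<in>I'. X x y = (\<Sum>k<card I'. complex_of_real (lam k) * v k x * cnj (v k y))"
    using sd unfolding spectral_decomp_def by blast
  have "(\<Sum>x\<in>I. cnj (v k (h x)) * v l (h x)) = (\<Sum>x\<in>I'. cnj (v k x) * v l x)" for k l
    by (rule sum.reindex_bij_betw[OF h])
  moreover have "h x \<in> I'" if "x \<in> I" for x using bij_betwE[OF h] that by blast
  ultimately show ?thesis
    unfolding spectral_decomp_def bij_betw_same_card[OF h] using v
    by (intro exI[of _ "\<lambda>k x. v k (h x)"]) auto
qed

text \<open>Relabelling preserves the set of admissible eigenvalue lists, so the choice operator in
  the definition picks the same list on both sides.\<close>

lemma vn_entropy_bij:
  assumes h: "bij_betw h I I'"
  shows "vn_entropy I' X = vn_entropy I (\<lambda>x y. X (h x) (h y))"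
proof -
  have "spectral_decomp I' X lam" if "spectral_decomp I (\<lambda>x y. X (h x) (h y)) lam" for lam
  proof -
    have "spectral_decomp I' (\<lambda>x y. X (h (inv_into I h x)) (h (inv_into I h y))) lam"
      by (rule spectral_decomp_bij[OF bij_betw_inv_into[OF h] that])
    then show ?thesis
      using h by (simp add: spectral_decomp_def bij_betw_inv_into_right)
  qed
  then have "spectral_decomp I' X = spectral_decomp I (\<lambda>x y. X (h x) (h y))"
    using spectral_decomp_bij[OF h] by blast
  then show ?thesis by (simp add: vn_entropy_def bij_betw_same_card[OF h])
qed

section \<open>Subsystems indexed by configurations\<close>

lemma finite_cfg: 
  assumes "finite S"
  shows "finite (cfg D S)"
proof (rule finite_subset)
  show "cfg D S \<subseteq> {f. \<forall>x. (x \<in> S \<longrightarrow> f x \<in> (\<Union>j\<in>S. {..<D j})) \<and> (x \<notin> S \<longrightarrow> f x = 0)}"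
    by (auto simp: cfg_def)
  show "finite {f. \<forall>x. (x \<in> S \<longrightarrow> f x \<in> (\<Union>j\<in>S. {..<D j})) \<and> (x \<notin> S \<longrightarrow> f x = (0::nat))}"
    using assms by (intro finite_set_of_finite_funs) auto
qed

lemma cfg_empty [simp]: "cfg D {} = {\<lambda>_. 0}"
  by (auto simp: cfg_def)

text \<open>Configurations vanish outside their set, so pointwise addition glues two of them over
  disjoint sets; \<open>ptrace\<close> inserts the traced-out coordinates in this way.\<close>

lemma bij_betw_cfg_Un:
  assumes "S \<inter> S' = {}"
  shows "bij_betw (\<lambda>z j. fst z j + snd z j) (cfg D S \<times> cfg D S') (cfg D (S \<union> S'))"
proof (rule bij_betw_byWitness[where f' = "\<lambda>x. (\<lambda>j. if j \<in> S then x j else 0, \<lambda>j. if j \<in> S' then x j else 0)"])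
  show "\<forall>a\<in>cfg D S \<times> cfg D S'. (\<lambda>j. if j \<in> S then fst a j + snd a j else 0, \<lambda>j. if j \<in> S' then fst a j + snd a j else 0) = a"
    using assms by (auto simp: cfg_def fun_eq_iff prod_eq_iff)
  show "\<forall>x\<in>cfg D (S \<union> S'). (\<lambda>j. fst (\<lambda>j. if j \<in> S then x j else 0, \<lambda>j. if j \<in> S' then x j else 0) j
      + snd (\<lambda>j. if j \<in> S then x j else 0, \<lambda>j. if j \<in> S' then x j else 0) j) = x"
    using assms by (auto simp: cfg_def fun_eq_iff)
  show "(\<lambda>z j. fst z j + snd z j) ` (cfg D S \<times> cfg D S') \<subseteq> cfg D (S \<union> S')"
    using assms by (fastforce simp: cfg_def)
  show "(\<lambda>x. (\<lambda>j. if j \<in> S then x j else 0, \<lambda>j. if j \<in> S' then x j else 0)) ` cfg D (S \<union> S') \<subseteq> cfg D S \<times> cfg D S'"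
    by (auto simp: cfg_def)
qed

lemma bij_betw_cfg_insert:
  assumes "0 \<notin> S"
  shows "bij_betw (\<lambda>x. (snd x)(0 := fst x)) ({..<D 0} \<times> cfg D S) (cfg D (insert 0 S))"
  by (rule bij_betw_byWitness[where f' = "\<lambda>x. (x 0, x(0 := 0))"])
    (use assms in \<open>auto simp: cfg_def fun_eq_iff\<close>)

lemma sum_cfg_Un:
  assumes "S \<inter> S' = {}"
  shows "(\<Sum>x\<in>cfg D (S \<union> S'). f x) = (\<Sum>x\<in>cfg D S. \<Sum>y\<in>cfg D S'. f (\<lambda>j. x j + y j))"
  using sum.reindex_bij_betw[OF bij_betw_cfg_Un[OF assms], of f D] by (simp add: sum.cartesian_product')

lemma sum_cfg_insert:
  assumes "0 \<notin> S"
  shows "(\<Sum>x\<in>cfg D (insert 0 S). f x) = (\<Sum>a<D 0. \<Sum>x\<in>cfg D S. f (x(0 := a)))"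
  using sum.reindex_bij_betw[OF bij_betw_cfg_insert[OF assms], of f D] by (simp add: sum.cartesian_product')

text \<open>The factor consists of the eigenvectors scaled by the square roots of their eigenvalues:
  a purification with an environment of dimension \<open>card I\<close>.\<close>

lemma psd_gram:
  assumes "finite I" "psd_on I X"
  shows "\<exists>M. \<forall>x\<in>I. \<forall>y\<in>I. X x y = (\<Sum>e<card I. M x e * cnj (M y e))"
proof -
  obtain p v where pv: "onb {..<card I} I v" "eigen_expansion {..<card I} I p v X" "\<forall>j<card I. 0 \<le> p j"
    by (rule vn_entropy_psd[OF assms])
  have "complex_of_real (p j) * v j x * cnj (v j y)
      = (complex_of_real (sqrt (p j)) * v j x) * cnj (complex_of_real (sqrt (p j)) * v j y)" if "j < card I" for j x y
  proof -
    have "complex_of_real (p j) = complex_of_real (sqrt (p j)) * complex_of_real (sqrt (p j))"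
      unfolding of_real_mult[symmetric] using pv(3) that by (simp del: of_real_mult)
    then show ?thesis by (simp only: complex_cnj_mult complex_cnj_complex_of_real mult_ac)
  qed
  moreover define M where "M = (\<lambda>x j. complex_of_real (sqrt (p j)) * v j x)"
  ultimately have M: "complex_of_real (p j) * v j x * cnj (v j y) = M x j * cnj (M y j)" if "j < card I" for j x y
    using that by (simp only: M_def)
  have "X x y = (\<Sum>j<card I. M x j * cnj (M y j))" if "x \<in> I" "y \<in> I" for x y
  proof -
    have "X x y = (\<Sum>j<card I. complex_of_real (p j) * v j x * cnj (v j y))"
      using pv(2) that by (simp add: eigen_expansion_def)
    also have "\<dots> = (\<Sum>j<card I. M x j * cnj (M y j))"
      by (intro sum.cong refl M) simp
    finally show ?thesis .
  qed
  then show ?thesis by (intro exI[of _ M]) simp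
qed

lemma density_psd:
  assumes "density D S \<rho>"
  shows "psd_on (cfg D S) \<rho>"
  using assms unfolding density_def psd_on_def hermitian_on_def qform_def
  by (elim conjE) (intro conjI, assumption, blast)

text \<open>The reduced state of A and \<open>S\<close> on a product index set, the form in which
  the uncertainty relations are stated. An empty \<open>S\<close> gives trivial memory.\<close>

definition joint :: "(nat \<Rightarrow> nat) \<Rightarrow> nat set \<Rightarrow> op \<Rightarrow> nat set \<Rightarrow> nat \<times> (nat \<Rightarrow> nat) \<Rightarrow> nat \<times> (nat \<Rightarrow> nat) \<Rightarrow> complex" where
  "joint D T \<rho> S = (\<lambda>x y. ptrace D T (insert 0 S) \<rho> ((snd x)(0 := fst x)) ((snd y)(0 := fst y)))"

lemma vn_entropy_joint:
  assumes "0 \<notin> S"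
  shows "vn_entropy (cfg D (insert 0 S)) (ptrace D T (insert 0 S) \<rho>) = vn_entropy ({..<D 0} \<times> cfg D S) (joint D T \<rho> S)"
  unfolding joint_def by (rule vn_entropy_bij[OF bij_betw_cfg_insert[OF assms]])

lemma ptrace_eq_trace_left:
  assumes "0 \<in> T" "0 \<notin> S" "b \<in> cfg D S" "b' \<in> cfg D S"
  shows "ptrace D T S \<rho> b b' = trace_left {..<D 0} (joint D T \<rho> S) b b'"
proof -
  have T: "T - S = insert 0 (T - insert 0 S)" using assms by auto
  have "(\<lambda>j. x j + (z(0 := a)) j) = (\<lambda>j. (x(0 := a)) j + z j)" if "x \<in> cfg D S" "z \<in> cfg D (T - insert 0 S)" for x z a
    using that assms(2) by (auto simp: cfg_def fun_eq_iff)
  then show ?thesis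
    unfolding ptrace_def T joint_def trace_left_def using assms
    by (subst sum_cfg_insert) (auto intro!: sum.cong)
qed

text \<open>A purification of the global state purifies every reduced state: the traced-out
  subsystems join the environment.\<close>

lemma joint_gram:
  assumes "S \<subseteq> T" "0 \<in> T" "0 \<notin> S"
    and V: "\<forall>x\<in>cfg D T. \<forall>y\<in>cfg D T. \<rho> x y = (\<Sum>e<N. V x e * cnj (V y e))"
    and "x \<in> {..<D 0} \<times> cfg D S" "y \<in> {..<D 0} \<times> cfg D S"
  shows "joint D T \<rho> S x y = (\<Sum>e\<in>cfg D (T - insert 0 S) \<times> {..<N}.
      V (\<lambda>j. ((snd x)(0 := fst x)) j + fst e j) (snd e) * cnj (V (\<lambda>j. ((snd y)(0 := fst y)) j + fst e j) (snd e)))"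
proof -
  have "(\<lambda>j. ((snd x)(0 := fst x)) j + z j) \<in> cfg D T"
    if "x \<in> {..<D 0} \<times> cfg D S" "z \<in> cfg D (T - insert 0 S)" for x z
  proof -
    have "insert 0 S \<union> (T - insert 0 S) = T" using assms(1,2) by auto
    moreover have "(snd x)(0 := fst x) \<in> cfg D (insert 0 S)"
      using bij_betwE[OF bij_betw_cfg_insert[OF assms(3), of D]] that(1) by blast
    ultimately show ?thesis
      using bij_betwE[OF bij_betw_cfg_Un[of "insert 0 S" "T - insert 0 S" D]] that(2) by fastforce
  qed
  then show ?thesis
    using assms(4-6) unfolding joint_def ptrace_def sum.cartesian_product' by (intro sum.cong refl) simp
qed

lemma postmeas_joint:
  "postmeas (D 0) \<psi> (ptrace D T (insert 0 S) \<rho>) (b(0 := a)) (b'(0 := a'))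
     = (\<Sum>k<D 0. \<psi> k a * compress {..<D 0} (\<psi> k) (joint D T \<rho> S) b b' * cnj (\<psi> k a'))"
  unfolding postmeas_def compress_def joint_def by (simp add: sum_distrib_left sum_distrib_right mult_ac)

lemma vn_entropy_postmeas:
  assumes "finite S" "0 \<notin> S" "onb {..<D 0} {..<D 0} \<psi>" "psd_on ({..<D 0} \<times> cfg D S) (joint D T \<rho> S)"
  shows "vn_entropy (cfg D (insert 0 S)) (postmeas (D 0) \<psi> (ptrace D T (insert 0 S) \<rho>))
      = (\<Sum>k<D 0. vn_entropy (cfg D S) (compress {..<D 0} (\<psi> k) (joint D T \<rho> S)))"
  unfolding vn_entropy_bij[OF bij_betw_cfg_insert[OF assms(2)]] postmeas_joint
  by (rule vn_entropy_measured)
    (use assms finite_cfg psd_on_compress[OF assms(4)] in \<open>auto simp: compress_def\<close>)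

text \<open>Measuring A commutes with tracing out the memory, so the reduced measured state does not
  depend on \<open>t\<close>, although its expression does.\<close>

lemma ptrace_postmeas:
  assumes "t \<noteq> 0" "t \<in> T" "0 \<in> T" "x \<in> cfg D {0}" "y \<in> cfg D {0}"
  shows "ptrace D {0, t} {0} (postmeas d \<psi> (ptrace D T {0, t} \<rho>)) x y = postmeas d \<psi> (ptrace D T {0} \<rho>) x y"
proof -
  have st: "{0, t} - {0} = {t}" using assms(1) by auto
  have tT: "T - {0} = {t} \<union> (T - {0, t})" "{t} \<inter> (T - {0, t}) = {}" using assms by auto
  have z: "(\<lambda>j. u j + z j)(0 := a) = (\<lambda>j. (u(0 := a)) j + z j)" "u 0 + z 0 = u 0" if "z \<in> cfg D {t}" for u z a
    using that assms(1) by (auto simp: cfg_def fun_eq_iff)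
  have P: "ptrace D T {0} \<rho> u v = (\<Sum>z\<in>cfg D {t}. ptrace D T {0, t} \<rho> (\<lambda>j. u j + z j) (\<lambda>j. v j + z j))" for u v
    unfolding ptrace_def tT(1) sum_cfg_Un[OF tT(2)] by (simp add: add.assoc)
  have "ptrace D {0, t} {0} (postmeas d \<psi> (ptrace D T {0, t} \<rho>)) x y
      = (\<Sum>z\<in>cfg D {t}. \<Sum>k<d. \<Sum>a<d. \<Sum>b<d. \<psi> k (x 0) * cnj (\<psi> k a) *
          ptrace D T {0, t} \<rho> (\<lambda>j. (x(0 := a)) j + z j) (\<lambda>j. (y(0 := b)) j + z j) * \<psi> k b * cnj (\<psi> k (y 0)))"
    unfolding ptrace_def[of D "{0, t}"] postmeas_def st by (intro sum.cong refl) (simp only: z)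
  also have "\<dots> = (\<Sum>k<d. \<Sum>a<d. \<Sum>b<d. \<Sum>z\<in>cfg D {t}. \<psi> k (x 0) * cnj (\<psi> k a) *
          ptrace D T {0, t} \<rho> (\<lambda>j. (x(0 := a)) j + z j) (\<lambda>j. (y(0 := b)) j + z j) * \<psi> k b * cnj (\<psi> k (y 0)))"
    by (subst sum.swap, intro sum.cong refl, subst sum.swap, intro sum.cong refl, rule sum.swap)
  finally show ?thesis
    by (simp add: postmeas_def P sum_distrib_left sum_distrib_right)
qed

lemma trace_ptrace:
  assumes "S \<subseteq> T"
  shows "(\<Sum>b\<in>cfg D S. ptrace D T S \<rho> b b) = (\<Sum>x\<in>cfg D T. \<rho> x x)"
proof -
  have "T = S \<union> (T - S)" using assms by auto
  then have "(\<Sum>x\<in>cfg D T. \<rho> x x) = (\<Sum>x\<in>cfg D (S \<union> (T - S)). \<rho> x x)" by simp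
  also have "\<dots> = (\<Sum>b\<in>cfg D S. ptrace D T S \<rho> b b)"
    unfolding ptrace_def by (rule sum_cfg_Un) auto
  finally show ?thesis ..
qed

lemma vn_entropy_point: "X x x = 1 \<Longrightarrow> vn_entropy {x} X = 0"
  by (subst vn_entropy_orthonormal[where J = "{x}" and p = "\<lambda>_. 1" and v = "\<lambda>_ _. 1"])
    (auto simp: inner_on_def eigen_expansion_def)

lemma inner_vec_eq: "inner_vec d u v = inner_on {..<d} u v"
  by (simp add: inner_vec_def inner_on_def)

text \<open>Positivity, needed before logarithms of overlaps are taken, comes from Parseval: a unit
  vector cannot be orthogonal to a whole basis.\<close>

lemma overlap_bounds:
  assumes "0 < d" "onb {..<d} {..<d} \<psi>" "onb {..<d} {..<d} \<phi>"
  shows "0 < overlap d \<psi> \<phi>"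
    and "k < d \<Longrightarrow> l < d \<Longrightarrow> (cmod (inner_on {..<d} (\<psi> k) (\<phi> l)))\<^sup>2 \<le> overlap d \<psi> \<phi>"
proof -
  let ?Q = "{(cmod (inner_vec d (\<psi> k) (\<phi> l)))\<^sup>2 | k l. k < d \<and> l < d}"
  have "?Q = (\<lambda>(k, l). (cmod (inner_vec d (\<psi> k) (\<phi> l)))\<^sup>2) ` ({..<d} \<times> {..<d})" by auto
  then have fin: "finite ?Q" by simp
  show le: "(cmod (inner_on {..<d} (\<psi> k) (\<phi> l)))\<^sup>2 \<le> overlap d \<psi> \<phi>" if "k < d" "l < d" for k l
    unfolding overlap_def by (rule Max_ge[OF fin]) (use that in \<open>auto simp: inner_vec_eq\<close>)
  have "\<exists>k<d. inner_on {..<d} (\<psi> k) (\<phi> 0) \<noteq> 0"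
  proof (rule ccontr)
    assume "\<not> (\<exists>k<d. inner_on {..<d} (\<psi> k) (\<phi> 0) \<noteq> 0)"
    then have "inner_on {..<d} (\<phi> 0) (\<phi> 0) = 0"
      using onb_parseval[OF assms(2), of "\<phi> 0" "\<phi> 0"] by simp
    then show False using assms(1,3) by (simp add: onb_def)
  qed
  then obtain k where "k < d" "0 < (cmod (inner_on {..<d} (\<psi> k) (\<phi> 0)))\<^sup>2" by auto
  then show "0 < overlap d \<psi> \<phi>" using le[of k 0] assms(1) by linarith
qed

lemma measured_state_uncertainty:
  fixes D \<rho> T \<psi> \<phi>
  assumes T: "finite T" "0 \<in> T" and dens: "density D T \<rho>"
    and onb: "onb {..<D 0} {..<D 0} \<psi>" "onb {..<D 0} {..<D 0} \<phi>"
  defines "SA \<equiv> vn_entropy (cfg D {0}) (ptrace D T {0} \<rho>)"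
    and "SB \<equiv> \<lambda>t. vn_entropy (cfg D {t}) (ptrace D T {t} \<rho>)"
    and "SAB \<equiv> \<lambda>t. vn_entropy (cfg D {0, t}) (ptrace D T {0, t} \<rho>)"
    and "SMB \<equiv> \<lambda>\<psi> t. vn_entropy (cfg D {0, t}) (postmeas (D 0) \<psi> (ptrace D T {0, t} \<rho>))"
    and "SM \<equiv> \<lambda>\<psi> t. vn_entropy (cfg D {0}) (ptrace D {0, t} {0} (postmeas (D 0) \<psi> (ptrace D T {0, t} \<rho>)))"
  shows "0 < overlap (D 0) \<psi> \<phi>"
    and "t \<in> T \<Longrightarrow> t \<noteq> 0 \<Longrightarrow> SAB t + SB t - log 2 (overlap (D 0) \<psi> \<phi>) \<le> SMB \<psi> t + SMB \<phi> t"
    and "s \<in> T \<Longrightarrow> s \<noteq> 0 \<Longrightarrow> t \<in> T \<Longrightarrow> t \<noteq> 0 \<Longrightarrow> s \<noteq> t \<Longrightarrow>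
           SB t + SB s - log 2 (overlap (D 0) \<psi> \<phi>) \<le> SMB \<psi> t + SMB \<phi> s"
    and "s \<in> T \<Longrightarrow> s \<noteq> 0 \<Longrightarrow> t \<in> T \<Longrightarrow> t \<noteq> 0 \<Longrightarrow>
           SA - log 2 (overlap (D 0) \<psi> \<phi>) \<le> SM \<psi> t + SM \<phi> s"
proof -
  let ?A = "{..<D 0}" and ?c = "overlap (D 0) \<psi> \<phi>"
  have tr: "(\<Sum>x\<in>cfg D T. \<rho> x x) = 1" using dens unfolding density_def by (elim conjE)
  \<comment> \<open>Unit trace excludes an empty index set, so \<open>D 0\<close> is positive and
    the maximum in \<open>overlap\<close> is over a nonempty set.\<close>
  then have "cfg D T \<noteq> {}" by auto
  then have d: "0 < D 0" using T by (auto simp: cfg_def)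
  note ov = overlap_bounds[OF d onb]
  show c: "0 < ?c" by (rule ov(1))
  have ov2: "(cmod (inner_on ?A (\<psi> k) (\<phi> l)))\<^sup>2 \<le> ?c" if "k \<in> ?A" "l \<in> ?A" for k l
    using ov(2) that by simp
  \<comment> \<open>One purification of the global state serves all subsystems, so that two memories
    appear as parts of the same pure state.\<close>
  obtain V where V: "\<forall>x\<in>cfg D T. \<forall>y\<in>cfg D T. \<rho> x y = (\<Sum>e<card (cfg D T). V x e * cnj (V y e))"
    using psd_gram[OF finite_cfg[OF T(1)] density_psd[OF dens]] by blast
  let ?N = "card (cfg D T)"
  let ?M = "\<lambda>x e. V (\<lambda>j. ((snd x)(0 := fst x)) j + fst e j) (snd e)"
  have finE: "finite (cfg D (T - S) \<times> {..<?N})" for S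
    using T finite_cfg[of "T - S" D] by simp
  have gram: "joint D T \<rho> S x y = (\<Sum>e\<in>cfg D (T - insert 0 S) \<times> {..<?N}. ?M x e * cnj (?M y e))"
    if "S \<subseteq> T" "0 \<notin> S" "x \<in> ?A \<times> cfg D S" "y \<in> ?A \<times> cfg D S" for S x y
    by (rule joint_gram[OF that(1) T(2) that(2) V that(3,4)])
  have psd: "psd_on (?A \<times> cfg D S) (joint D T \<rho> S)" if "S \<subseteq> T" "0 \<notin> S" for S
  proof -
    have "psd_on (?A \<times> cfg D S) (\<lambda>x y. \<Sum>e\<in>cfg D (T - insert 0 S) \<times> {..<?N}. ?M x e * cnj (?M y e))"
      by (rule psd_on_gram)
    then show ?thesis
      using gram[OF that] by (simp add: psd_on_def hermitian_on_def qform_def)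
  qed
  have trB: "(\<Sum>b\<in>cfg D S. trace_left ?A (joint D T \<rho> S) b b) = 1" if "S \<subseteq> T" "0 \<notin> S" for S
    unfolding tr[symmetric] trace_ptrace[OF that(1), symmetric]
    using ptrace_eq_trace_left[OF T(2) that(2)] by (intro sum.cong) auto
  have post: "vn_entropy (cfg D (insert 0 S)) (postmeas (D 0) \<chi> (ptrace D T (insert 0 S) \<rho>))
      = (\<Sum>k<D 0. vn_entropy (cfg D S) (compress ?A (\<chi> k) (joint D T \<rho> S)))"
    if "S \<subseteq> T" "0 \<notin> S" "onb ?A ?A \<chi>" for S \<chi>
    using vn_entropy_postmeas[OF finite_subset[OF that(1) T(1)] that(2,3) psd[OF that(1,2)]] .
  have trace: "vn_entropy (cfg D S) (ptrace D T S \<rho>) = vn_entropy (cfg D S) (trace_left ?A (joint D T \<rho> S))"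
    if "0 \<notin> S" for S
    by (rule vn_entropy_cong) (rule ptrace_eq_trace_left[OF T(2) that])
  \<comment> \<open>Stated for any \<open>S\<close>: a singleton gives the relation with one memory,
    the empty set the relation without memory.\<close>
  have bi: "vn_entropy (cfg D (insert 0 S)) (ptrace D T (insert 0 S) \<rho>)
      + vn_entropy (cfg D S) (trace_left ?A (joint D T \<rho> S)) - log 2 ?c
      \<le> vn_entropy (cfg D (insert 0 S)) (postmeas (D 0) \<psi> (ptrace D T (insert 0 S) \<rho>))
        + vn_entropy (cfg D (insert 0 S)) (postmeas (D 0) \<phi> (ptrace D T (insert 0 S) \<rho>))"
    if S: "S \<subseteq> T" "0 \<notin> S" for S
  proof -
    have "vn_entropy (?A \<times> cfg D S) (joint D T \<rho> S) + vn_entropy (cfg D S) (trace_left ?A (joint D T \<rho> S))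
        - log 2 ?c * Re (\<Sum>b\<in>cfg D S. trace_left ?A (joint D T \<rho> S) b b)
      \<le> (\<Sum>k<D 0. vn_entropy (cfg D S) (compress ?A (\<psi> k) (joint D T \<rho> S)))
        + (\<Sum>k<D 0. vn_entropy (cfg D S) (compress ?A (\<phi> k) (joint D T \<rho> S)))"
      by (rule bipartite_uncertainty[OF finite_lessThan finite_cfg[OF finite_subset[OF S(1) T(1)]] finE
          finite_lessThan finite_lessThan gram[OF S] onb c ov2])
    then show ?thesis
      unfolding post[OF S onb(1)] post[OF S onb(2)] vn_entropy_joint[OF S(2)] trB[OF S] by simp
  qed
  show "SAB t + SB t - log 2 ?c \<le> SMB \<psi> t + SMB \<phi> t" if "t \<in> T" "t \<noteq> 0"
    using bi[of "{t}"] that unfolding SAB_def SB_def SMB_def by (simp add: trace)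
  show "SA - log 2 ?c \<le> SM \<psi> t + SM \<phi> s" if "s \<in> T" "s \<noteq> 0" "t \<in> T" "t \<noteq> 0"
  proof -
    have SM: "SM \<chi> t = vn_entropy (cfg D {0}) (postmeas (D 0) \<chi> (ptrace D T {0} \<rho>))" if "t \<in> T" "t \<noteq> 0" for \<chi> t
      unfolding SM_def by (rule vn_entropy_cong) (rule ptrace_postmeas[OF that(2,1) T(2)])
    have "vn_entropy (cfg D {}) (trace_left ?A (joint D T \<rho> {})) = 0"
      using trB[of "{}"] by (simp add: vn_entropy_point)
    then show ?thesis using bi[of "{}"] that by (simp add: SM SA_def)
  qed
  show "SB t + SB s - log 2 ?c \<le> SMB \<psi> t + SMB \<phi> s"
    if st: "s \<in> T" "s \<noteq> 0" "t \<in> T" "t \<noteq> 0" "s \<noteq> t"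
  proof -
    let ?R = "cfg D (T - {0, s, t}) \<times> {..<?N}"
    \<comment> \<open>Amplitudes of one pure state on A, the memories \<open>t\<close> and
      \<open>s\<close>, and the rest \<open>?R\<close>; \<open>g1\<close> and \<open>g2\<close> read
      the two reduced states off it.\<close>
    define \<phi>' where "\<phi>' = (\<lambda>a b c r. V (\<lambda>j. (b(0 := a)) j + c j + fst r j) (snd r))"
    have split: "(\<Sum>e\<in>cfg D (T - {0, u}) \<times> {..<?N}. f e)
        = (\<Sum>e\<in>cfg D {v} \<times> ?R. f (\<lambda>j. fst e j + fst (snd e) j, snd (snd e)))"
      if "{u, v} = {s, t}" "u \<noteq> v" for u v and f :: "(nat \<Rightarrow> nat) \<times> nat \<Rightarrow> complex"
    proof -
      have T': "T - {0, u} = {v} \<union> (T - {0, s, t})" "{v} \<inter> (T - {0, s, t}) = {}"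
        using that st by (auto simp: doubleton_eq_iff)
      show ?thesis
        unfolding T'(1) sum.cartesian_product' sum_cfg_Un[OF T'(2)] by simp
    qed
    have g1: "joint D T \<rho> {t} x y = (\<Sum>e\<in>cfg D {s} \<times> ?R. \<phi>' (fst x) (snd x) (fst e) (snd e) * cnj (\<phi>' (fst y) (snd y) (fst e) (snd e)))"
      if "x \<in> ?A \<times> cfg D {t}" "y \<in> ?A \<times> cfg D {t}" for x y
      using gram[of "{t}" x y] that st split[of t s] by (simp add: \<phi>'_def add.assoc insert_commute)
    have g2: "joint D T \<rho> {s} x y = (\<Sum>e\<in>cfg D {t} \<times> ?R. \<phi>' (fst x) (fst e) (snd x) (snd e) * cnj (\<phi>' (fst y) (fst e) (snd y) (snd e)))"
      if "x \<in> ?A \<times> cfg D {s}" "y \<in> ?A \<times> cfg D {s}" for x y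
    proof -
      \<comment> \<open>The coordinate of A is written into the configuration of \<open>s\<close> on
        one side and of \<open>t\<close> on the other; both configurations vanish at
        \<open>0\<close>, so the sums agree.\<close>
      have eq: "(\<lambda>j. ((snd x)(0 := fst x)) j + (b j + r j)) = (\<lambda>j. (b(0 := fst x)) j + snd x j + r j)"
        if "b \<in> cfg D {t}" "x \<in> ?A \<times> cfg D {s}" for b r and x :: "nat \<times> (nat \<Rightarrow> nat)"
        using that st by (auto simp: cfg_def fun_eq_iff)
      have "joint D T \<rho> {s} x y = (\<Sum>e\<in>cfg D {t} \<times> ?R.
          V (\<lambda>j. ((snd x)(0 := fst x)) j + (fst e j + fst (snd e) j)) (snd (snd e)) *
          cnj (V (\<lambda>j. ((snd y)(0 := fst y)) j + (fst e j + fst (snd e) j)) (snd (snd e))))"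
        using gram[of "{s}" x y] that st split[of s t] by (simp add: insert_commute)
      also have "\<dots> = (\<Sum>e\<in>cfg D {t} \<times> ?R. \<phi>' (fst x) (fst e) (snd x) (snd e) * cnj (\<phi>' (fst y) (fst e) (snd y) (snd e)))"
      proof (intro sum.cong refl)
        fix e assume "e \<in> cfg D {t} \<times> ?R"
        then have "fst e \<in> cfg D {t}" by auto
        then show "V (\<lambda>j. ((snd x)(0 := fst x)) j + (fst e j + fst (snd e) j)) (snd (snd e)) *
            cnj (V (\<lambda>j. ((snd y)(0 := fst y)) j + (fst e j + fst (snd e) j)) (snd (snd e)))
          = \<phi>' (fst x) (fst e) (snd x) (snd e) * cnj (\<phi>' (fst y) (fst e) (snd y) (snd e))"
          by (simp only: \<phi>'_def eq[OF _ that(1)] eq[OF _ that(2)])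
      qed
      finally show ?thesis .
    qed
    have finR: "finite ?R" by (rule finE)
    have "vn_entropy (cfg D {t}) (trace_left ?A (joint D T \<rho> {t})) + vn_entropy (cfg D {s}) (trace_left ?A (joint D T \<rho> {s}))
        - log 2 ?c * Re (\<Sum>b\<in>cfg D {t}. trace_left ?A (joint D T \<rho> {t}) b b)
      \<le> (\<Sum>k<D 0. vn_entropy (cfg D {t}) (compress ?A (\<psi> k) (joint D T \<rho> {t})))
        + (\<Sum>l<D 0. vn_entropy (cfg D {s}) (compress ?A (\<phi> l) (joint D T \<rho> {s})))"
      by (rule tripartite_uncertainty[where \<phi> = \<phi>' and R = ?R, OF finite_lessThan finite_cfg finite_cfg finR
          finite_lessThan finite_lessThan g1 g2 onb c ov2]) simp_all
    then show ?thesis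
      using st trB[of "{t}"] post[of "{t}" \<psi>] post[of "{s}" \<phi>] onb
      by (simp add: SB_def SMB_def trace)
  qed
qed

section \<open>Summation over pairs of observables\<close>

lemma sum_pairs_Suc:
  fixes g :: "nat \<Rightarrow> nat \<Rightarrow> real"
  shows "(\<Sum>i\<in>{1..Suc m}. \<Sum>j\<in>{i<..Suc m}. g i j)
    = (\<Sum>i\<in>{1..m}. \<Sum>j\<in>{i<..m}. g i j) + (\<Sum>i\<in>{1..m}. g i (Suc m))"
proof -
  have "{i<..Suc m} = insert (Suc m) {i<..m}" if "i \<in> {1..m}" for i using that by auto
  then have "(\<Sum>i\<in>{1..m}. \<Sum>j\<in>{i<..Suc m}. g i j) = (\<Sum>i\<in>{1..m}. g i (Suc m) + (\<Sum>j\<in>{i<..m}. g i j))"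
    by (intro sum.cong refl) simp
  then show ?thesis by (simp add: sum.distrib)
qed

text \<open>Each index occurs in \<open>m - 1\<close> of the pairs.\<close>

lemma sum_pairs_add:
  fixes f :: "nat \<Rightarrow> real"
  shows "(\<Sum>i\<in>{1..m}. \<Sum>j\<in>{i<..m}. f i + f j) = (real m - 1) * (\<Sum>i\<in>{1..m}. f i)"
  by (induction m) (simp_all only: sum_pairs_Suc, simp_all add: sum.distrib algebra_simps)

text \<open>For an indicator \<open>f\<close> this counts the pairs inside a set:
  \<open>k * (k - 1) / 2\<close> of them for \<open>k\<close> elements.\<close>

lemma sum_pairs_mult:
  fixes f :: "nat \<Rightarrow> real"
  shows "(\<Sum>i\<in>{1..m}. \<Sum>j\<in>{i<..m}. f i * f j) = ((\<Sum>i\<in>{1..m}. f i)\<^sup>2 - (\<Sum>i\<in>{1..m}. (f i)\<^sup>2)) / 2"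
  by (induction m) (simp_all only: sum_pairs_Suc, simp_all add: sum_distrib_right[symmetric] power2_eq_square field_simps)

text \<open>A pair inside one block \<open>\<S> t\<close> gains \<open>c t\<close>, and the block
  has \<open>card (\<S> t)\<close> choose two such pairs. The form is general because both bounds
  need it: once with \<open>c\<close> the conditional entropy of A, once with \<open>c = 0\<close>
  and S(A) moved into \<open>L\<close>.\<close>

lemma sum_pairs_partition:
  fixes F :: "nat \<Rightarrow> nat \<Rightarrow> real" and L :: "nat \<Rightarrow> nat \<Rightarrow> real" and c :: "nat \<Rightarrow> real"
  assumes disj: "\<forall>s\<in>{1..n}. \<forall>t\<in>{1..n}. s \<noteq> t \<longrightarrow> \<S> s \<inter> \<S> t = {}"
    and union: "(\<Union>t\<in>{1..n}. \<S> t) = {1..m}"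
    and F: "\<And>i j s t. s \<in> {1..n} \<Longrightarrow> t \<in> {1..n} \<Longrightarrow> i \<in> \<S> s \<Longrightarrow> j \<in> \<S> t \<Longrightarrow> i < j \<Longrightarrow>
        (if s = t then c s else 0) - L i j \<le> F i s + F j t"
  shows "(\<Sum>t=1..n. real (card (\<S> t)) * (real (card (\<S> t)) - 1) / 2 * c t) - (\<Sum>i\<in>{1..m}. \<Sum>j\<in>{i<..m}. L i j)
     \<le> (real m - 1) * (\<Sum>t=1..n. \<Sum>i\<in>\<S> t. F i t)"
proof -
  have "\<forall>i\<in>{1..m}. \<exists>t. t \<in> {1..n} \<and> i \<in> \<S> t" using union by blast
  then obtain \<tau> where \<tau>: "\<And>i. i \<in> {1..m} \<Longrightarrow> \<tau> i \<in> {1..n}" "\<And>i. i \<in> {1..m} \<Longrightarrow> i \<in> \<S> (\<tau> i)"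
    by metis
  have sub: "\<S> t \<subseteq> {1..m}" if "t \<in> {1..n}" for t using union that by blast
  have \<tau>_eq: "\<tau> i = t \<longleftrightarrow> i \<in> \<S> t" if "i \<in> {1..m}" "t \<in> {1..n}" for i t
    using disj \<tau>[OF that(1)] that by blast
  have "(\<Sum>t=1..n. \<Sum>i\<in>\<S> t. F i t) = (\<Sum>t=1..n. \<Sum>i\<in>\<S> t. F i (\<tau> i))"
    using sub \<tau>_eq by (intro sum.cong refl) (metis subsetD)
  also have "\<dots> = (\<Sum>i\<in>(\<Union>t\<in>{1..n}. \<S> t). F i (\<tau> i))"
    using disj sub by (intro sum.UNION_disjoint[symmetric]) (simp_all add: finite_subset[OF sub])
  finally have FS: "(\<Sum>t=1..n. \<Sum>i\<in>\<S> t. F i t) = (\<Sum>i\<in>{1..m}. F i (\<tau> i))"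
    unfolding union .
  have count: "(\<Sum>i\<in>{1..m}. \<Sum>j\<in>{i<..m}. of_bool (i \<in> \<S> t) * of_bool (j \<in> \<S> t))
      = real (card (\<S> t)) * (real (card (\<S> t)) - 1) / 2" if "t \<in> {1..n}" for t
  proof -
    have "(\<Sum>i\<in>{1..m}. of_bool (i \<in> \<S> t)) = real (card (\<S> t))"
      using sub[OF that] by (simp add: Int_absorb1)
    moreover have "(\<Sum>i\<in>{1..m}. (of_bool (i \<in> \<S> t) :: real)\<^sup>2) = (\<Sum>i\<in>{1..m}. of_bool (i \<in> \<S> t))"
      by (intro sum.cong) auto
    ultimately show ?thesis
      unfolding sum_pairs_mult by (simp add: power2_eq_square algebra_simps)
  qed
  \<comment> \<open>Writing the same-block condition as a sum over \<open>t\<close> of products of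
    indicators lets the blocks be counted one at a time.\<close>
  have "(\<Sum>i\<in>{1..m}. \<Sum>j\<in>{i<..m}. if \<tau> i = \<tau> j then c (\<tau> i) else 0)
      = (\<Sum>i\<in>{1..m}. \<Sum>j\<in>{i<..m}. \<Sum>t=1..n. of_bool (i \<in> \<S> t) * of_bool (j \<in> \<S> t) * c t)"
  proof (intro sum.cong refl)
    fix i j assume ij: "i \<in> {1..m}" "j \<in> {i<..m}"
    then have j: "j \<in> {1..m}" by auto
    have "(\<Sum>t=1..n. of_bool (i \<in> \<S> t) * of_bool (j \<in> \<S> t) * c t)
        = (\<Sum>t=1..n. if \<tau> i = t then if \<tau> i = \<tau> j then c (\<tau> i) else 0 else 0)"
      using \<tau>_eq[OF ij(1)] \<tau>_eq[OF j] by (intro sum.cong refl) auto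
    then show "(if \<tau> i = \<tau> j then c (\<tau> i) else 0) = (\<Sum>t=1..n. of_bool (i \<in> \<S> t) * of_bool (j \<in> \<S> t) * c t)"
      using \<tau>(1)[OF ij(1)] by simp
  qed
  also have "\<dots> = (\<Sum>t=1..n. (\<Sum>i\<in>{1..m}. \<Sum>j\<in>{i<..m}. of_bool (i \<in> \<S> t) * of_bool (j \<in> \<S> t)) * c t)"
    unfolding sum_distrib_right by (rule trans[OF sum.cong[OF refl sum.swap] sum.swap])
  also have "\<dots> = (\<Sum>t=1..n. real (card (\<S> t)) * (real (card (\<S> t)) - 1) / 2 * c t)"
    using count by (intro sum.cong) auto
  finally have C: "(\<Sum>i\<in>{1..m}. \<Sum>j\<in>{i<..m}. if \<tau> i = \<tau> j then c (\<tau> i) else 0)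
      = (\<Sum>t=1..n. real (card (\<S> t)) * (real (card (\<S> t)) - 1) / 2 * c t)" .
  have "(\<Sum>i\<in>{1..m}. \<Sum>j\<in>{i<..m}. (if \<tau> i = \<tau> j then c (\<tau> i) else 0) - L i j)
      \<le> (\<Sum>i\<in>{1..m}. \<Sum>j\<in>{i<..m}. F i (\<tau> i) + F j (\<tau> j))"
  proof (intro sum_mono)
    fix i j assume "i \<in> {1..m}" "j \<in> {i<..m}"
    then show "(if \<tau> i = \<tau> j then c (\<tau> i) else 0) - L i j \<le> F i (\<tau> i) + F j (\<tau> j)"
      using \<tau>[of i] \<tau>[of j] by (intro F) auto
  qed
  then show ?thesis
    unfolding sum_subtractf C FS sum_pairs_add[of "\<lambda>i. F i (\<tau> i)"] .
qed

lemma log_prod_pairs: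
  fixes c :: "nat \<Rightarrow> nat \<Rightarrow> real"
  assumes "\<And>i j. i \<in> {1..m} \<Longrightarrow> j \<in> {1..m} \<Longrightarrow> 0 < c i j"
  shows "log 2 (\<Prod>i\<in>{1..m}. \<Prod>j\<in>{i<..m}. c i j) = (\<Sum>i\<in>{1..m}. \<Sum>j\<in>{i<..m}. log 2 (c i j))"
proof -
  have nz: "c i j \<noteq> 0" if "i \<in> {1..m}" "j \<in> {i<..m}" for i j
    using assms[of i j] that by auto
  have "ln (\<Prod>i\<in>{1..m}. \<Prod>j\<in>{i<..m}. c i j) = (\<Sum>i\<in>{1..m}. ln (\<Prod>j\<in>{i<..m}. c i j))"
    using nz by (intro ln_prod) simp_all
  also have "\<dots> = (\<Sum>i\<in>{1..m}. \<Sum>j\<in>{i<..m}. ln (c i j))"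
    using nz by (intro sum.cong refl ln_prod) simp_all
  finally show ?thesis by (simp add: log_def sum_divide_distrib)
qed

theorem theorem1:
  fixes m n d :: nat
    and D :: "nat \<Rightarrow> nat"
    and \<rho> :: op
    and M :: "nat \<Rightarrow> nat \<Rightarrow> nat \<Rightarrow> complex"
    and \<psi> :: "nat \<Rightarrow> nat \<Rightarrow> nat \<Rightarrow> complex"
    and \<mu> :: "nat \<Rightarrow> nat \<Rightarrow> real"
    and \<S> :: "nat \<Rightarrow> nat set"
  assumes hm: "m \<ge> 2" and hn1: "1 \<le> n" and hnm: "n \<le> m"
    and hd: "D 0 = d"
    and h\<rho>: "density D {0..n} \<rho>"
    and hMherm: "\<forall>i\<in>{1..m}. \<forall>a<d. \<forall>b<d. M i b a = cnj (M i a b)"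
    and hONB: "\<forall>i\<in>{1..m}. \<forall>k<d. \<forall>l<d.
                 inner_vec d (\<psi> i k) (\<psi> i l) = (if k = l then 1 else 0)"
    and heig: "\<forall>i\<in>{1..m}. \<forall>k<d. \<forall>a<d.
                 (\<Sum>b<d. M i a b * \<psi> i k b) = complex_of_real (\<mu> i k) * \<psi> i k a"
    and hSne: "\<forall>t\<in>{1..n}. \<S> t \<noteq> {}"
    and hSdisj: "\<forall>s\<in>{1..n}. \<forall>t\<in>{1..n}. s \<noteq> t \<longrightarrow> \<S> s \<inter> \<S> t = {}"
    and hSunion: "(\<Union>t\<in>{1..n}. \<S> t) = {1..m}"
  shows
    "let SA = vn_entropy (cfg D {0}) (ptrace D {0..n} {0} \<rho>);
         SB = (\<lambda>t. vn_entropy (cfg D {t}) (ptrace D {0..n} {t} \<rho>));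
         SAB = (\<lambda>t. vn_entropy (cfg D {0, t}) (ptrace D {0..n} {0, t} \<rho>));
         SMB = (\<lambda>i t. vn_entropy (cfg D {0, t}) (postmeas d (\<psi> i) (ptrace D {0..n} {0, t} \<rho>)));
         SM = (\<lambda>i t. vn_entropy (cfg D {0})
                 (ptrace D {0, t} {0} (postmeas d (\<psi> i) (ptrace D {0..n} {0, t} \<rho>))));
         condA = (\<lambda>t. SAB t - SB t);
         condM = (\<lambda>i t. SMB i t - SB t);
         IA = (\<lambda>t. SA + SB t - SAB t);
         IM = (\<lambda>i t. SM i t + SB t - SMB i t);
         mt = (\<lambda>t. real (card (\<S> t)));
         c = (\<lambda>i j. overlap d (\<psi> i) (\<psi> j));
         \<delta> = (real m * (real m - 1) - (\<Sum>t=1..n. mt t * (mt t - 1))) / (2 * (real m - 1)) * SA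
             + (\<Sum>t=1..n. mt t * (mt t - 1) / (2 * (real m - 1)) * IA t)
             - (\<Sum>t=1..n. \<Sum>i\<in>\<S> t. IM i t)
     in (\<Sum>t=1..n. \<Sum>i\<in>\<S> t. condM i t)
        \<ge> - (1 / (real m - 1)) * log 2 (\<Prod>i\<in>{1..m}. \<Prod>j\<in>{i<..m}. c i j)
          + (1 / (real m - 1)) * (\<Sum>t=1..n. mt t * (mt t - 1) / 2 * condA t)
          + max 0 \<delta>"
proof -
  let ?T = "{0..n}"
  define SA where "SA = vn_entropy (cfg D {0}) (ptrace D ?T {0} \<rho>)"
  define SB where "SB = (\<lambda>t. vn_entropy (cfg D {t}) (ptrace D ?T {t} \<rho>))"
  define SAB where "SAB = (\<lambda>t. vn_entropy (cfg D {0, t}) (ptrace D ?T {0, t} \<rho>))"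
  define SMB where "SMB = (\<lambda>i t. vn_entropy (cfg D {0, t}) (postmeas d (\<psi> i) (ptrace D ?T {0, t} \<rho>)))"
  define SM where "SM = (\<lambda>i t. vn_entropy (cfg D {0}) (ptrace D {0, t} {0} (postmeas d (\<psi> i) (ptrace D ?T {0, t} \<rho>))))"
  define c where "c = (\<lambda>i j. overlap d (\<psi> i) (\<psi> j))"
  define q where "q = (\<lambda>t. real (card (\<S> t)) * (real (card (\<S> t)) - 1))"
  define \<delta> where "\<delta> = (real m * (real m - 1) - (\<Sum>t=1..n. q t)) / (2 * (real m - 1)) * SA
      + (\<Sum>t=1..n. q t / (2 * (real m - 1)) * (SA + SB t - SAB t))
      - (\<Sum>t=1..n. \<Sum>i\<in>\<S> t. SM i t + SB t - SMB i t)"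
  define \<Lambda> where "\<Lambda> = log 2 (\<Prod>i\<in>{1..m}. \<Prod>j\<in>{i<..m}. c i j)"
  have onb: "onb {..<d} {..<d} (\<psi> i)" if "i \<in> {1..m}" for i
    using orthonormal_imp_onb[of "{..<d}" "\<psi> i"] hONB that by (simp add: inner_vec_eq)
  have mem: "i \<in> {1..m}" if "t \<in> {1..n}" "i \<in> \<S> t" for i t using hSunion that by blast
  have pair: "0 < c i j"
      "t \<in> {1..n} \<Longrightarrow> SAB t + SB t - log 2 (c i j) \<le> SMB i t + SMB j t"
      "s \<in> {1..n} \<Longrightarrow> t \<in> {1..n} \<Longrightarrow> s \<noteq> t \<Longrightarrow> SB s + SB t - log 2 (c i j) \<le> SMB i s + SMB j t"
      "s \<in> {1..n} \<Longrightarrow> t \<in> {1..n} \<Longrightarrow> SA - log 2 (c i j) \<le> SM i s + SM j t"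
    if "i \<in> {1..m}" "j \<in> {1..m}" for i j s t
    using measured_state_uncertainty[of ?T D \<rho> "\<psi> i" "\<psi> j"] h\<rho> onb[OF that(1)] onb[OF that(2)]
    unfolding SA_def SB_def SAB_def SMB_def SM_def c_def hd by auto
  have \<Lambda>: "\<Lambda> = (\<Sum>i\<in>{1..m}. \<Sum>j\<in>{i<..m}. log 2 (c i j))"
    unfolding \<Lambda>_def by (rule log_prod_pairs) (rule pair(1))
  have m: "real m - 1 > 0" using hm by simp
  have "(\<Sum>t=1..n. real (card (\<S> t)) * (real (card (\<S> t)) - 1) / 2 * (SAB t - SB t)) - \<Lambda>
      \<le> (real m - 1) * (\<Sum>t=1..n. \<Sum>i\<in>\<S> t. SMB i t - SB t)"
    unfolding \<Lambda>
  proof (rule sum_pairs_partition[OF hSdisj hSunion])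
    fix i j s t assume a: "s \<in> {1..n}" "t \<in> {1..n}" "i \<in> \<S> s" "j \<in> \<S> t" "i < j"
    \<comment> \<open>For \<open>s = t\<close> the one-memory relation is lowered by twice
      \<open>SB s\<close>; for different memories the other relation is lowered by
      \<open>SB s + SB t\<close>, which leaves only the log overlap.\<close>
    show "(if s = t then SAB s - SB s else 0) - log 2 (c i j) \<le> SMB i s - SB s + (SMB j t - SB t)"
      using pair(2)[OF mem[OF a(1,3)] mem[OF a(2,4)] a(1)] pair(3)[OF mem[OF a(1,3)] mem[OF a(2,4)] a(1,2)]
      by (cases "s = t") auto
  qed
  then have 1: "- (1 / (real m - 1)) * \<Lambda> + (1 / (real m - 1)) * (\<Sum>t=1..n. q t / 2 * (SAB t - SB t))
      \<le> (\<Sum>t=1..n. \<Sum>i\<in>\<S> t. SMB i t - SB t)"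
  proof -
    assume "(\<Sum>t=1..n. real (card (\<S> t)) * (real (card (\<S> t)) - 1) / 2 * (SAB t - SB t)) - \<Lambda>
      \<le> (real m - 1) * (\<Sum>t=1..n. \<Sum>i\<in>\<S> t. SMB i t - SB t)"
    then have "((\<Sum>t=1..n. q t / 2 * (SAB t - SB t)) - \<Lambda>) / (real m - 1) \<le> (\<Sum>t=1..n. \<Sum>i\<in>\<S> t. SMB i t - SB t)"
      unfolding pos_divide_le_eq[OF m] q_def by (simp only: mult.commute)
    then show ?thesis by (simp add: diff_divide_distrib)
  qed
  define Q where "Q = (\<Sum>t=1..n. \<Sum>i\<in>\<S> t. SM i t)"
  \<comment> \<open>The memoryless relation has no same-block gain; \<open>SA\<close> is credited to
    every pair by subtracting it from the log overlap.\<close>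
  have "(\<Sum>t=1..n. real (card (\<S> t)) * (real (card (\<S> t)) - 1) / 2 * 0) - (\<Sum>i\<in>{1..m}. \<Sum>j\<in>{i<..m}. log 2 (c i j) - SA)
      \<le> (real m - 1) * Q"
    unfolding Q_def
  proof (rule sum_pairs_partition[OF hSdisj hSunion])
    fix i j s t assume a: "s \<in> {1..n}" "t \<in> {1..n}" "i \<in> \<S> s" "j \<in> \<S> t" "i < j"
    show "(if s = t then 0 else 0) - (log 2 (c i j) - SA) \<le> SM i s + SM j t"
      using pair(4)[OF mem[OF a(1,3)] mem[OF a(2,4)] a(1,2)] by simp
  qed
  moreover have "(\<Sum>i\<in>{1..m}. \<Sum>j\<in>{i<..m}. SA) = (real m - 1) * (real m * SA / 2)"
    using sum_pairs_add[of "\<lambda>_. SA / 2" m] by simp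
  ultimately have "(real m - 1) * (real m * SA / 2) - \<Lambda> \<le> (real m - 1) * Q"
    unfolding \<Lambda> by (simp only: sum_subtractf mult_zero_right sum.neutral_const)
  then have "real m * SA / 2 - \<Lambda> / (real m - 1) \<le> Q"
    using m by (simp add: field_simps)
  \<comment> \<open>The mutual information is S(A) minus S(A|B). Its sum in \<open>\<delta>\<close>
    thus splits into a multiple of \<open>SA\<close>, which the next identity cancels, and the
    negative of the memory term of the first bound.\<close>
  moreover have "(\<Sum>t=1..n. q t / (2 * (real m - 1)) * (SA + SB t - SAB t))
      = (\<Sum>t=1..n. q t) / (2 * (real m - 1)) * SA - 1 / (real m - 1) * (\<Sum>t=1..n. q t / 2 * (SAB t - SB t))"
    unfolding sum_distrib_left sum_distrib_right sum_divide_distrib sum_subtractf[symmetric]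
  proof (intro sum.cong refl)
    fix t
    show "q t / (2 * (real m - 1)) * (SA + SB t - SAB t)
        = q t / (2 * (real m - 1)) * SA - 1 / (real m - 1) * (q t / 2 * (SAB t - SB t))"
    proof -
      define r where "r = real m - 1"
      have "r > 0" using m by (simp add: r_def)
      then show ?thesis unfolding r_def[symmetric] by (simp add: field_simps)
    qed
  qed
  moreover have "(real m * (real m - 1) - (\<Sum>t=1..n. q t)) / (2 * (real m - 1)) * SA
      = real m * SA / 2 - (\<Sum>t=1..n. q t) / (2 * (real m - 1)) * SA"
  proof -
    define r where "r = real m - 1"
    have "r > 0" using m by (simp add: r_def)
    then show ?thesis unfolding r_def[symmetric] by (simp add: field_simps)
  qed
  \<comment> \<open>The Holevo quantity is S(M) minus S(M|B), so subtracting it turns the memoryless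
    bound on \<open>Q\<close> into one on the conditional entropies.\<close>
  moreover have "(\<Sum>t=1..n. \<Sum>i\<in>\<S> t. SM i t + SB t - SMB i t) = Q - (\<Sum>t=1..n. \<Sum>i\<in>\<S> t. SMB i t - SB t)"
    unfolding Q_def sum_subtractf[symmetric] by (intro sum.cong refl) simp
  ultimately have 2: "- (1 / (real m - 1)) * \<Lambda> + (1 / (real m - 1)) * (\<Sum>t=1..n. q t / 2 * (SAB t - SB t)) + \<delta>
      \<le> (\<Sum>t=1..n. \<Sum>i\<in>\<S> t. SMB i t - SB t)"
    unfolding \<delta>_def by simp
  have "- (1 / (real m - 1)) * \<Lambda> + (1 / (real m - 1)) * (\<Sum>t=1..n. q t / 2 * (SAB t - SB t)) + max 0 \<delta>
      \<le> (\<Sum>t=1..n. \<Sum>i\<in>\<S> t. SMB i t - SB t)"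
    using 1 2 by (simp add: max_def)
  then show ?thesis
    unfolding \<delta>_def \<Lambda>_def q_def SA_def SB_def SAB_def SMB_def SM_def c_def Let_def .
qed

end
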